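(* Let $R$ be a one-dimensional Noetherian domain, $I$ an ideal of $R$, $M$ a finitely generated $R$-module, and let $F$ be a functor arising from a middle finite complex $A\xrightarrow{\alpha}B\xrightarrow{\beta}C$. Then the sequence of sets $\{\operatorname{Ass}_R F(M/I^nM)\}_{n\ge1}$ is eventually constant.
   Context: For a complex $\mathcal{E}\colon A\to B\to C$ of $R$-modules, the functor arising from $\mathcal{E}$ is the $R$-linear functor $F$ on all $R$-modules given by $F(X)=H(\mathcal{E}\otimes_R X)$, the homology at the middle term of $A\otimes X\to B\otimes X\to C\otimes X$. The complex is middle finite if $B$ is finitely generated ($A$ and $C$ arbitrary). *)

theory Defs
  imports "HOL-Algebra.Algebra" "HOL-Library.Extended_Nat"
begin

text \<open>R-linear maps between R-modules (only their values on the carrier matter).\<close>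
definition mod_hom :: "('r,'c) ring_scheme \<Rightarrow> ('r,'a,'d) module_scheme \<Rightarrow> ('r,'b,'e) module_scheme \<Rightarrow> ('a \<Rightarrow> 'b) set"
  where "mod_hom R M N = {f. f \<in> carrier M \<rightarrow> carrier N
     \<and> (\<forall>x\<in>carrier M. \<forall>y\<in>carrier M. f (x \<oplus>\<^bsub>M\<^esub> y) = f x \<oplus>\<^bsub>N\<^esub> f y)
     \<and> (\<forall>r\<in>carrier R. \<forall>x\<in>carrier M. f (r \<odot>\<^bsub>M\<^esub> x) = r \<odot>\<^bsub>N\<^esub> f x)}"

definition gen_submodule :: "('r,'c) ring_scheme \<Rightarrow> ('r,'a,'d) module_scheme \<Rightarrow> 'a set \<Rightarrow> 'a set"
  where "gen_submodule R M S = \<Inter>{N. submodule N R M \<and> S \<subseteq> N}"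

definition fin_gen_module :: "('r,'c) ring_scheme \<Rightarrow> ('r,'a,'d) module_scheme \<Rightarrow> bool"
  where "fin_gen_module R M \<longleftrightarrow> (\<exists>S. finite S \<and> S \<subseteq> carrier M \<and> gen_submodule R M S = carrier M)"

text \<open>Quotient module M/N, with carrier the cosets of N.
  (The multiplicative fields are irrelevant for a module and are filled with dummies.)\<close>
definition quot_module :: "('r,'c) ring_scheme \<Rightarrow> ('r,'a,'d) module_scheme \<Rightarrow> 'a set \<Rightarrow> ('r,'a set) module"
  where "quot_module R M N = \<lparr>carrier = a_rcosets\<^bsub>M\<^esub> N, monoid.mult = (\<lambda>_ _. N), monoid.one = N, ring.zero = N,
     ring.add = set_add M, module.smult = (\<lambda>r C. \<Union>m\<in>C. N +>\<^bsub>M\<^esub> (r \<odot>\<^bsub>M\<^esub> m))\<rparr>"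

primrec ideal_pow :: "('r,'c) ring_scheme \<Rightarrow> 'r set \<Rightarrow> nat \<Rightarrow> 'r set" where
  "ideal_pow R I 0 = carrier R"
| "ideal_pow R I (Suc n) = ideal_prod R I (ideal_pow R I n)"

definition ideal_smult :: "('r,'c) ring_scheme \<Rightarrow> 'r set \<Rightarrow> ('r,'a,'d) module_scheme \<Rightarrow> 'a set"
  where "ideal_smult R J M = gen_submodule R M {r \<odot>\<^bsub>M\<^esub> m | r m. r \<in> J \<and> m \<in> carrier M}"

definition ann_elem :: "('r,'c) ring_scheme \<Rightarrow> ('r,'a,'d) module_scheme \<Rightarrow> 'a \<Rightarrow> 'r set"
  where "ann_elem R M m = {r \<in> carrier R. r \<odot>\<^bsub>M\<^esub> m = \<zero>\<^bsub>M\<^esub>}"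

definition Ass :: "('r,'c) ring_scheme \<Rightarrow> ('r,'a,'d) module_scheme \<Rightarrow> 'r set set"
  where "Ass R M = {P. primeideal P R \<and> (\<exists>m\<in>carrier M. P = ann_elem R M m)}"

definition prime_chain :: "('r,'c) ring_scheme \<Rightarrow> nat \<Rightarrow> bool"
  where "prime_chain R n \<longleftrightarrow> (\<exists>P :: nat \<Rightarrow> 'r set. (\<forall>i\<le>n. primeideal (P i) R) \<and> (\<forall>i<n. P i \<subset> P (Suc i)))"

definition krull_dim :: "('r,'c) ring_scheme \<Rightarrow> enat"
  where "krull_dim R = Sup {enat n | n. prime_chain R n}"

definition free_module :: "('r,'c) ring_scheme \<Rightarrow> 'p set \<Rightarrow> ('r, 'p \<Rightarrow> 'r) module"
  where "free_module R S = \<lparr>carrier = {f. (\<forall>p. f p \<in> carrier R) \<and> (\<forall>p. p \<notin> S \<longrightarrow> f p = \<zero>\<^bsub>R\<^esub>)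
                                        \<and> finite {p. f p \<noteq> \<zero>\<^bsub>R\<^esub>}},
     monoid.mult = (\<lambda>_ _ _. \<zero>\<^bsub>R\<^esub>), monoid.one = (\<lambda>_. \<zero>\<^bsub>R\<^esub>), ring.zero = (\<lambda>_. \<zero>\<^bsub>R\<^esub>),
     ring.add = (\<lambda>f g p. f p \<oplus>\<^bsub>R\<^esub> g p), module.smult = (\<lambda>r f p. r \<otimes>\<^bsub>R\<^esub> f p)\<rparr>"

definition basis_vec :: "('r,'c) ring_scheme \<Rightarrow> 'p \<Rightarrow> 'p \<Rightarrow> 'r"
  where "basis_vec R q = (\<lambda>p. if p = q then \<one>\<^bsub>R\<^esub> else \<zero>\<^bsub>R\<^esub>)"

definition tensor_rels :: "('r,'c) ring_scheme \<Rightarrow> ('r,'a,'d) module_scheme \<Rightarrow> ('r,'x,'e) module_scheme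
    \<Rightarrow> ('a \<times> 'x \<Rightarrow> 'r) set"
  where "tensor_rels R A Y =
     {(\<lambda>p. a_minus R (a_minus R (basis_vec R (a \<oplus>\<^bsub>A\<^esub> a', x) p) (basis_vec R (a, x) p)) (basis_vec R (a', x) p))
        | a a' x. a \<in> carrier A \<and> a' \<in> carrier A \<and> x \<in> carrier Y}
   \<union> {(\<lambda>p. a_minus R (a_minus R (basis_vec R (a, x \<oplus>\<^bsub>Y\<^esub> x') p) (basis_vec R (a, x) p)) (basis_vec R (a, x') p))
        | a x x'. a \<in> carrier A \<and> x \<in> carrier Y \<and> x' \<in> carrier Y}
   \<union> {(\<lambda>p. a_minus R (basis_vec R (r \<odot>\<^bsub>A\<^esub> a, x) p) (r \<otimes>\<^bsub>R\<^esub> basis_vec R (a, x) p))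
        | r a x. r \<in> carrier R \<and> a \<in> carrier A \<and> x \<in> carrier Y}
   \<union> {(\<lambda>p. a_minus R (basis_vec R (a, r \<odot>\<^bsub>Y\<^esub> x) p) (r \<otimes>\<^bsub>R\<^esub> basis_vec R (a, x) p))
        | r a x. r \<in> carrier R \<and> a \<in> carrier A \<and> x \<in> carrier Y}"

definition tensor_rel_sub :: "('r,'c) ring_scheme \<Rightarrow> ('r,'a,'d) module_scheme \<Rightarrow> ('r,'x,'e) module_scheme
    \<Rightarrow> ('a \<times> 'x \<Rightarrow> 'r) set"
  where "tensor_rel_sub R A Y = gen_submodule R (free_module R (carrier A \<times> carrier Y)) (tensor_rels R A Y)"

definition tensor :: "('r,'c) ring_scheme \<Rightarrow> ('r,'a,'d) module_scheme \<Rightarrow> ('r,'x,'e) module_scheme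
    \<Rightarrow> ('r, ('a \<times> 'x \<Rightarrow> 'r) set) module"
  where "tensor R A Y = quot_module R (free_module R (carrier A \<times> carrier Y)) (tensor_rel_sub R A Y)"

definition push_fwd :: "('r,'c) ring_scheme \<Rightarrow> ('a \<Rightarrow> 'b) \<Rightarrow> ('a \<times> 'x \<Rightarrow> 'r) \<Rightarrow> ('b \<times> 'x \<Rightarrow> 'r)"
  where "push_fwd R f g = (\<lambda>(b, x). finsum R (\<lambda>a. g (a, x)) {a. g (a, x) \<noteq> \<zero>\<^bsub>R\<^esub> \<and> f a = b})"

definition tensor_map :: "('r,'c) ring_scheme \<Rightarrow> ('r,'b,'d) module_scheme \<Rightarrow> ('r,'x,'e) module_scheme
    \<Rightarrow> ('a \<Rightarrow> 'b) \<Rightarrow> ('a \<times> 'x \<Rightarrow> 'r) set \<Rightarrow> ('b \<times> 'x \<Rightarrow> 'r) set"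
  where "tensor_map R B Y f C =
     (\<Union>g\<in>C. tensor_rel_sub R B Y +>\<^bsub>free_module R (carrier B \<times> carrier Y)\<^esub> push_fwd R f g)"

definition complex_functor :: "('r,'c) ring_scheme \<Rightarrow> ('r,'a,'d1) module_scheme \<Rightarrow> ('r,'b,'d2) module_scheme
    \<Rightarrow> ('r,'g,'d3) module_scheme \<Rightarrow> ('a \<Rightarrow> 'b) \<Rightarrow> ('b \<Rightarrow> 'g) \<Rightarrow> ('r,'x,'e) module_scheme
    \<Rightarrow> ('r, ('b \<times> 'x \<Rightarrow> 'r) set set) module"
  where "complex_functor R A B C \<alpha> \<beta> Y =
     (let TB = tensor R B Y;
          K = {t \<in> carrier TB. tensor_map R C Y \<beta> t = \<zero>\<^bsub>tensor R C Y\<^esub>};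
          Im = tensor_map R B Y \<alpha> ` carrier (tensor R A Y)
      in quot_module R (TB\<lparr>carrier := K\<rparr>) Im)"

end

theory Submission
  imports Defs
begin

text \<open>
  The functor sends \<open>Y\<close> to the kernel of \<open>coker (\<alpha> \<otimes> Y) \<rightarrow> C \<otimes> Y\<close>.  By right exactness of the tensor
  product, \<open>F(M/I\<^sup>nM) = K\<^sub>n/I\<^sup>nX\<close> with \<open>X = coker (\<alpha> \<otimes> M)\<close>, where \<open>K\<^sub>n\<close> is the preimage of
  \<open>I\<^sup>n(C \<otimes> M)\<close> in \<open>X\<close>.  As \<open>C\<close> is arbitrary, Artin--Rees is not available for \<open>C \<otimes> M\<close>; the argument
  only uses that \<open>X\<close> is finitely generated and that \<open>I K\<^sub>n \<subseteq> K\<^sub>n\<^sub>+\<^sub>1 \<subseteq> K\<^sub>n\<close> and \<open>I\<^sup>nX \<subseteq> K\<^sub>n\<close>.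
  For \<open>I \<noteq> 0\<close> only the finitely many primes \<open>P \<supseteq> I\<close>, all of them maximal, can be associated, and \<open>P\<close> is
  associated iff \<open>K\<^sub>n \<noteq> I\<^sup>nX\<close> locally at \<open>P\<close>.  If equality holds at \<open>P\<close> for infinitely many \<open>n\<close>, then it
  holds for all large \<open>n\<close>: modulo torsion this follows from \<open>(I\<^sup>n\<^sup>+\<^sup>mX : I\<^sup>m) = I\<^sup>nX\<close> for large \<open>n\<close>
  (Ratliff), an instance of the Noetherian property of Rees modules, and on the torsion of \<open>X\<close> because
  a power of \<open>I\<close> is locally contained in any nonzero principal ideal.
\<close>

section \<open>Submodules and homomorphisms\<close>

context abelian_group
begin

lemma a_diff_add_cancel: "x \<in> carrier G \<Longrightarrow> y \<in> carrier G \<Longrightarrow> (x \<ominus> y) \<oplus> y = x"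
  by (simp add: a_minus_def a_assoc l_neg)

lemma a_add_diff_cancel_left: "x \<in> carrier G \<Longrightarrow> y \<in> carrier G \<Longrightarrow> (y \<oplus> x) \<ominus> y = x"
  by (simp add: a_minus_def a_comm[of y x] a_assoc r_neg)

lemma a_add_diff_cancel_right: "x \<in> carrier G \<Longrightarrow> y \<in> carrier G \<Longrightarrow> (x \<oplus> y) \<ominus> y = x"
  by (simp add: a_minus_def a_assoc r_neg)

lemma a_diff_eq_zero_iff: "x \<in> carrier G \<Longrightarrow> y \<in> carrier G \<Longrightarrow> x \<ominus> y = \<zero> \<longleftrightarrow> x = y"
  using a_diff_add_cancel[of x y] by (auto simp: a_minus_def r_neg)

end

lemma mod_homI:
  assumes "\<And>x. x \<in> carrier M \<Longrightarrow> f x \<in> carrier N"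
    and "\<And>x y. x \<in> carrier M \<Longrightarrow> y \<in> carrier M \<Longrightarrow> f (x \<oplus>\<^bsub>M\<^esub> y) = f x \<oplus>\<^bsub>N\<^esub> f y"
    and "\<And>r x. r \<in> carrier R \<Longrightarrow> x \<in> carrier M \<Longrightarrow> f (r \<odot>\<^bsub>M\<^esub> x) = r \<odot>\<^bsub>N\<^esub> f x"
  shows "f \<in> mod_hom R M N"
  using assms by (auto simp: mod_hom_def)

lemma mod_homD:
  assumes "f \<in> mod_hom R M N"
  shows "x \<in> carrier M \<Longrightarrow> f x \<in> carrier N"
    and "x \<in> carrier M \<Longrightarrow> y \<in> carrier M \<Longrightarrow> f (x \<oplus>\<^bsub>M\<^esub> y) = f x \<oplus>\<^bsub>N\<^esub> f y"
    and "r \<in> carrier R \<Longrightarrow> x \<in> carrier M \<Longrightarrow> f (r \<odot>\<^bsub>M\<^esub> x) = r \<odot>\<^bsub>N\<^esub> f x"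
  using assms by (auto simp: mod_hom_def)

lemma mod_hom_compose:
  assumes "f \<in> mod_hom R M N" "g \<in> mod_hom R N L"
  shows "(\<lambda>x. g (f x)) \<in> mod_hom R M L"
  by (rule mod_homI) (simp_all add: mod_homD[OF assms(1)] mod_homD[OF assms(2)])

lemma mod_hom_zero:
  assumes "module R M" "module R N" "f \<in> mod_hom R M N"
  shows "f \<zero>\<^bsub>M\<^esub> = \<zero>\<^bsub>N\<^esub>"
proof -
  interpret M: module R M by fact
  interpret N: module R N by fact
  have "f (\<zero>\<^bsub>R\<^esub> \<odot>\<^bsub>M\<^esub> \<zero>\<^bsub>M\<^esub>) = \<zero>\<^bsub>R\<^esub> \<odot>\<^bsub>N\<^esub> f \<zero>\<^bsub>M\<^esub>"
    by (rule mod_homD(3)[OF assms(3)]) auto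
  then show ?thesis using mod_homD(1)[OF assms(3), of "\<zero>\<^bsub>M\<^esub>"] by simp
qed

lemma mod_hom_minus:
  assumes "module R M" "module R N" "f \<in> mod_hom R M N" "x \<in> carrier M"
  shows "f (\<ominus>\<^bsub>M\<^esub> x) = \<ominus>\<^bsub>N\<^esub> f x"
proof -
  interpret M: module R M by fact
  interpret N: module R N by fact
  have "f (\<ominus>\<^bsub>R\<^esub> \<one>\<^bsub>R\<^esub> \<odot>\<^bsub>M\<^esub> x) = \<ominus>\<^bsub>R\<^esub> \<one>\<^bsub>R\<^esub> \<odot>\<^bsub>N\<^esub> f x"
    by (rule mod_homD(3)[OF assms(3)]) (use assms(4) in auto)
  then show ?thesis
    using mod_homD(1)[OF assms(3,4)] assms(4) by (simp add: M.smult_l_minus N.smult_l_minus)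
qed

lemma mod_hom_diff:
  assumes "module R M" "module R N" "f \<in> mod_hom R M N" "x \<in> carrier M" "y \<in> carrier M"
  shows "f (x \<ominus>\<^bsub>M\<^esub> y) = f x \<ominus>\<^bsub>N\<^esub> f y"
proof -
  interpret M: module R M by fact
  show ?thesis using assms(4,5)
    by (simp add: a_minus_def mod_homD(2)[OF assms(3)] mod_hom_minus[OF assms(1-3)])
qed

context module
begin

abbreviation smult_M (infixl \<open>\<bullet>\<close> 70) where "smult_M \<equiv> smult M"

abbreviation add_M (infixl \<open>\<boxplus>\<close> 65) where "add_M \<equiv> add M"

abbreviation set_add_M (infixl \<open>\<uplus>\<close> 60) where "set_add_M \<equiv> set_add M"

lemma smult_r_diff:
  assumes "r \<in> carrier R" "x \<in> carrier M" "y \<in> carrier M"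
  shows "r \<bullet> (x \<ominus>\<^bsub>M\<^esub> y) = r \<bullet> x \<ominus>\<^bsub>M\<^esub> r \<bullet> y"
  using assms by (simp add: a_minus_def smult_r_distr smult_r_minus)

lemma smult_left_commute:
  assumes "r \<in> carrier R" "s \<in> carrier R" "x \<in> carrier M"
  shows "r \<bullet> (s \<bullet> x) = s \<bullet> (r \<bullet> x)"
  using assms by (metis R.m_comm smult_assoc1)

lemma smult_mod_hom: "r \<in> carrier R \<Longrightarrow> (\<bullet>) r \<in> mod_hom R M M"
  by (rule mod_homI) (simp_all add: smult_r_distr smult_left_commute)

lemma submoduleD:
  assumes "submodule N R M"
  shows "x \<in> N \<Longrightarrow> x \<in> carrier M"
    and "\<zero>\<^bsub>M\<^esub> \<in> N"
    and "x \<in> N \<Longrightarrow> y \<in> N \<Longrightarrow> x \<boxplus> y \<in> N"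
    and "x \<in> N \<Longrightarrow> \<ominus>\<^bsub>M\<^esub> x \<in> N"
    and "x \<in> N \<Longrightarrow> y \<in> N \<Longrightarrow> x \<ominus>\<^bsub>M\<^esub> y \<in> N"
    and "r \<in> carrier R \<Longrightarrow> x \<in> N \<Longrightarrow> r \<bullet> x \<in> N"
  using submoduleE[OF assms] subgroup.one_closed[OF submodule.axioms(1)[OF assms]]
  by (auto simp: a_minus_def)

lemma submodule_mem_if_add_mem:
  assumes "submodule N R M" "x \<in> carrier M" "y \<in> N" "x \<boxplus> y \<in> N"
  shows "x \<in> N"
  using submoduleD(5)[OF assms(1,4,3)] M.a_add_diff_cancel_right[OF assms(2)]
    submoduleD(1)[OF assms(1,3)] by simp

lemma submodule_zero: "submodule {\<zero>\<^bsub>M\<^esub>} R M"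
  by (rule submoduleI) auto

lemma submodule_Inter:
  assumes "\<And>N. N \<in> F \<Longrightarrow> submodule N R M" "F \<noteq> {}"
  shows "submodule (\<Inter>F) R M"
  using assms by (intro submoduleI) (auto dest: submoduleD[OF assms(1)])

lemma submodule_Int:
  assumes "submodule N R M" "submodule N' R M"
  shows "submodule (N \<inter> N') R M"
  using submodule_Inter[of "{N, N'}"] assms by auto

lemma submodule_cyclic:
  assumes "u \<in> carrier M"
  shows "submodule ((\<lambda>r. r \<bullet> u) ` carrier R) R M"
proof (rule submoduleI)
  show "\<zero>\<^bsub>M\<^esub> \<in> (\<lambda>r. r \<bullet> u) ` carrier R"
    by (rule image_eqI[of _ _ \<zero>]) (use assms in auto)
qed (use assms in \<open>auto simp flip: smult_l_distr smult_l_minus smult_assoc1\<close>)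

lemma set_add_iff: "x \<in> N \<uplus> N' \<longleftrightarrow> (\<exists>y\<in>N. \<exists>z\<in>N'. x = y \<boxplus> z)"
  by (auto simp: set_add_def')

lemma set_add_memI: "y \<in> N \<Longrightarrow> z \<in> N' \<Longrightarrow> y \<boxplus> z \<in> N \<uplus> N'"
  by (auto simp: set_add_iff)

lemma set_add_mono: "N \<subseteq> D \<Longrightarrow> N' \<subseteq> D' \<Longrightarrow> N \<uplus> N' \<subseteq> D \<uplus> D'"
  unfolding set_add_iff subset_iff by blast

lemma submodule_set_add:
  assumes "submodule N R M" "submodule N' R M"
  shows "submodule (N \<uplus> N') R M"
proof (rule submodule.intro)
  have "additive_subgroup (N \<uplus> N') M"
    using M.add_additive_subgroups assms by (simp add: additive_subgroupI submodule.axioms(1))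
  then show "subgroup (N \<uplus> N') (add_monoid M)" by (rule additive_subgroup.a_subgroup)
  show "submodule_axioms (N \<uplus> N') R M"
  proof
    fix r x assume r: "r \<in> carrier R" and "x \<in> N \<uplus> N'"
    then obtain y z where yz: "y \<in> N" "z \<in> N'" "x = y \<boxplus> z" unfolding set_add_iff by auto
    then have "r \<bullet> x = r \<bullet> y \<boxplus> r \<bullet> z"
      using submoduleD(1)[OF assms(1)] submoduleD(1)[OF assms(2)] r by (simp add: smult_r_distr)
    then show "r \<bullet> x \<in> N \<uplus> N'"
      using yz r submoduleD(6)[OF assms(1)] submoduleD(6)[OF assms(2)] by (simp add: set_add_memI)
  qed
qed

lemma set_add_upper1:
  assumes "submodule N R M" "submodule N' R M" shows "N \<subseteq> N \<uplus> N'"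
proof
  fix x assume x: "x \<in> N"
  then show "x \<in> N \<uplus> N'"
    using set_add_memI[OF x submoduleD(2)[OF assms(2)]] submoduleD(1)[OF assms(1)] by simp
qed

lemma set_add_upper2:
  assumes "submodule N R M" "submodule N' R M" shows "N' \<subseteq> N \<uplus> N'"
proof
  fix x assume x: "x \<in> N'"
  then show "x \<in> N \<uplus> N'"
    using set_add_memI[OF submoduleD(2)[OF assms(1)] x] submoduleD(1)[OF assms(2)] by simp
qed

lemma smult_mem_set_add:
  assumes "r \<in> carrier R" "submodule N R M" "submodule N' R M" "x \<in> N \<uplus> N'"
    and "\<And>y. y \<in> N \<Longrightarrow> r \<bullet> y \<in> D" "\<And>y. y \<in> N' \<Longrightarrow> r \<bullet> y \<in> D'"
  shows "r \<bullet> x \<in> D \<uplus> D'"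
proof -
  obtain y z where yz: "y \<in> N" "z \<in> N'" "x = y \<boxplus> z" using assms(4) by (auto simp: set_add_iff)
  then have "r \<bullet> x = r \<bullet> y \<boxplus> r \<bullet> z"
    using smult_r_distr[OF assms(1) submoduleD(1)[OF assms(2)] submoduleD(1)[OF assms(3)]] by simp
  then show ?thesis using yz assms(5,6) by (simp add: set_add_memI)
qed

lemma submodule_gen:
  assumes "S \<subseteq> carrier M" shows "submodule (gen_submodule R M S) R M"
  unfolding gen_submodule_def
  by (rule submodule_Inter) (use assms carrier_is_submodule in auto)

lemma gen_submodule_incl: "S \<subseteq> gen_submodule R M S"
  by (auto simp: gen_submodule_def)

lemma gen_submodule_least: "submodule N R M \<Longrightarrow> S \<subseteq> N \<Longrightarrow> gen_submodule R M S \<subseteq> N"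
  by (auto simp: gen_submodule_def)

end

lemma submodule_preimage:
  assumes "module R M" "module R N" "f \<in> mod_hom R M N" "submodule D R N"
  shows "submodule {x \<in> carrier M. f x \<in> D} R M"
proof -
  interpret M: module R M by fact
  interpret N: module R N by fact
  note D = N.submoduleD[OF assms(4)]
  show ?thesis
    by (rule M.submoduleI)
       (auto simp: mod_hom_zero[OF assms(1-3)] mod_hom_minus[OF assms(1-3)] mod_homD[OF assms(3)] D(2-6))
qed

lemma submodule_kernel:
  assumes "module R M" "module R N" "f \<in> mod_hom R M N"
  shows "submodule {x \<in> carrier M. f x = \<zero>\<^bsub>N\<^esub>} R M"
  using submodule_preimage[OF assms module.submodule_zero[OF assms(2)]] by simp

lemma submodule_image:
  assumes "module R M" "module R N" "f \<in> mod_hom R M N" "submodule D R M"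
  shows "submodule (f ` D) R N"
proof -
  interpret M: module R M by fact
  interpret N: module R N by fact
  note D = M.submoduleD[OF assms(4)] and f = mod_homD[OF assms(3)]
  show ?thesis
  proof (rule N.submoduleI)
    show "f ` D \<subseteq> carrier N" using f(1) D(1) by auto
    show "\<zero>\<^bsub>N\<^esub> \<in> f ` D" using mod_hom_zero[OF assms(1-3)] D(2) by (metis image_eqI)
    show "\<ominus>\<^bsub>N\<^esub> a \<in> f ` D" if "a \<in> f ` D" for a
      using that D(1,4) by (auto simp flip: mod_hom_minus[OF assms(1-3)])
    show "a \<oplus>\<^bsub>N\<^esub> b \<in> f ` D" if "a \<in> f ` D" "b \<in> f ` D" for a b
      using that D(1,3) by (auto simp flip: f(2))
    show "r \<odot>\<^bsub>N\<^esub> a \<in> f ` D" if "r \<in> carrier R" "a \<in> f ` D" for r a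
      using that D(1,6) by (auto simp flip: f(3))
  qed
qed

lemma (in module) submodule_smult_vimage:
  assumes "submodule N R M" "r \<in> carrier R"
  shows "submodule {x \<in> carrier M. r \<bullet> x \<in> N} R M"
  by (rule submodule_preimage[OF module_axioms module_axioms smult_mod_hom[OF assms(2)] assms(1)])

section \<open>Products of ideals and submodules\<close>

definition set_smult :: "('r,'c) ring_scheme \<Rightarrow> ('r,'a,'d) module_scheme \<Rightarrow> 'r set \<Rightarrow> 'a set \<Rightarrow> 'a set"
  where "set_smult R M S N = gen_submodule R M {r \<odot>\<^bsub>M\<^esub> x | r x. r \<in> S \<and> x \<in> N}"

lemma ideal_smult_eq_set_smult: "ideal_smult R J M = set_smult R M J (carrier M)"
  by (simp add: ideal_smult_def set_smult_def)

lemma ideal_subset_carrier: "ideal I R \<Longrightarrow> I \<subseteq> carrier R"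
  by (rule additive_subgroup.a_subset[OF ideal.axioms(1)])

context cring
begin

lemma cring_idealI:
  assumes "J \<subseteq> carrier R" "\<zero> \<in> J" "\<And>x y. x \<in> J \<Longrightarrow> y \<in> J \<Longrightarrow> x \<oplus> y \<in> J"
    "\<And>r x. r \<in> carrier R \<Longrightarrow> x \<in> J \<Longrightarrow> r \<otimes> x \<in> J"
  shows "ideal J R"
proof (rule idealI)
  show "ring R" by (rule ring_axioms)
  have neg: "\<ominus> x \<in> J" if "x \<in> J" for x
    using assms(4)[of "\<ominus> \<one>" x] that assms(1) by (auto simp: l_minus)
  show "subgroup J (add_monoid R)"
    by (rule subgroup.intro) (use assms neg in \<open>auto simp: a_inv_def\<close>)
  show "x \<otimes> a \<in> J" if "a \<in> J" "x \<in> carrier R" for a x using that assms by auto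
  then show "a \<otimes> x \<in> J" if "a \<in> J" "x \<in> carrier R" for a x
    using that assms(1) m_comm[of a x] by auto
qed

lemma ideal_pow_is_ideal: "ideal I R \<Longrightarrow> ideal (ideal_pow R I n) R"
  by (induction n) (auto intro: oneideal ideal_prod_is_ideal)

lemmas ideal_pow_subset_carrier = ideal_subset_carrier[OF ideal_pow_is_ideal]

end

context module
begin

abbreviation set_smult_M (infixr \<open>\<star>\<close> 75) where "set_smult_M \<equiv> set_smult R M"

abbreviation adic :: "'a set \<Rightarrow> nat \<Rightarrow> 'c set" where "adic I n \<equiv> ideal_smult R (ideal_pow R I n) M"

lemma submodule_set_smult:
  assumes "S \<subseteq> carrier R" "N \<subseteq> carrier M"
  shows "submodule (S \<star> N) R M"
  unfolding set_smult_def by (rule submodule_gen) (use assms in auto)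

lemma set_smult_incl: "r \<in> S \<Longrightarrow> x \<in> N \<Longrightarrow> r \<bullet> x \<in> S \<star> N"
  unfolding set_smult_def by (rule subsetD[OF gen_submodule_incl]) auto

lemma set_smult_least:
  assumes "submodule W R M" "\<And>r x. r \<in> S \<Longrightarrow> x \<in> N \<Longrightarrow> r \<bullet> x \<in> W"
  shows "S \<star> N \<subseteq> W"
  unfolding set_smult_def by (rule gen_submodule_least) (use assms in auto)

lemma submodule_ideal_smult: "J \<subseteq> carrier R \<Longrightarrow> submodule (ideal_smult R J M) R M"
  unfolding ideal_smult_eq_set_smult by (rule submodule_set_smult[OF _ order.refl])

lemma set_smult_mono: "S \<subseteq> S' \<Longrightarrow> N \<subseteq> N' \<Longrightarrow> S \<star> N \<subseteq> S' \<star> N'"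
  unfolding set_smult_def gen_submodule_def by blast

lemma set_smult_subset:
  assumes "submodule N R M" "S \<subseteq> carrier R"
  shows "S \<star> N \<subseteq> N"
  using assms by (intro set_smult_least) (auto intro: submoduleD(6)[OF assms(1)])

lemma set_smult_Idl:
  assumes "S \<subseteq> carrier R" "N \<subseteq> carrier M"
  shows "Idl S \<star> N = S \<star> N"
proof
  have sW: "submodule (S \<star> N) R M" by (rule submodule_set_smult[OF assms])
  have "ideal {i \<in> carrier R. \<forall>x\<in>N. i \<bullet> x \<in> S \<star> N} R"
    by (rule R.cring_idealI)
       (use submoduleD[OF sW] assms(2) in \<open>auto simp: smult_l_distr smult_assoc1 subset_iff\<close>)
  moreover have "S \<subseteq> {i \<in> carrier R. \<forall>x\<in>N. i \<bullet> x \<in> S \<star> N}"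
    using assms(1) set_smult_incl[of _ S] by auto
  ultimately have "Idl S \<subseteq> {i \<in> carrier R. \<forall>x\<in>N. i \<bullet> x \<in> S \<star> N}"
    by (rule R.genideal_minimal)
  then show "Idl S \<star> N \<subseteq> S \<star> N" by (intro set_smult_least[OF sW]) auto
qed (rule set_smult_mono[OF R.genideal_self[OF assms(1)] order.refl])

lemma carrier_set_smult:
  assumes "submodule N R M" shows "carrier R \<star> N = N"
proof
  show "N \<subseteq> carrier R \<star> N"
  proof
    fix x assume x: "x \<in> N"
    then show "x \<in> carrier R \<star> N"
      using set_smult_incl[OF R.one_closed x] submoduleD(1)[OF assms x] by simp
  qed
qed (rule set_smult_subset[OF assms order.refl])

lemma ideal_prod_set_smult:
  assumes I: "ideal I R" and J: "ideal J R" and N: "N \<subseteq> carrier M"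
  shows "ideal_prod R I J \<star> N = I \<star> (J \<star> N)"
proof
  interpret I: ideal I R by fact
  interpret J: ideal J R by fact
  have JN: "submodule (J \<star> N) R M" by (rule submodule_set_smult[OF J.a_subset N])
  then have IJN: "submodule (I \<star> (J \<star> N)) R M"
    using submodule_set_smult[OF I.a_subset] submoduleD(1)[OF JN] by blast
  have "r \<in> carrier R \<and> (\<forall>x\<in>N. r \<bullet> x \<in> I \<star> (J \<star> N))" if "r \<in> ideal_prod R I J" for r
    using that
  proof (induction r rule: ideal_prod.induct)
    case (prod i j)
    then have "(i \<otimes> j) \<bullet> x = i \<bullet> (j \<bullet> x)" if "x \<in> N" for x
      using that N I.Icarr J.Icarr by (intro smult_assoc1) auto
    then show ?case using prod I.Icarr J.Icarr by (auto intro: set_smult_incl)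
  next
    case (sum r s)
    then show ?case using submoduleD(3)[OF IJN] N by (auto simp: smult_l_distr subset_iff)
  qed
  then show "ideal_prod R I J \<star> N \<subseteq> I \<star> (J \<star> N)" by (intro set_smult_least[OF IJN]) auto
  have W: "submodule (ideal_prod R I J \<star> N) R M"
    by (rule submodule_set_smult[OF R.ideal_prod_in_carrier[OF I J] N])
  have "J \<star> N \<subseteq> {y \<in> carrier M. i \<bullet> y \<in> ideal_prod R I J \<star> N}" if i: "i \<in> I" for i
  proof (rule set_smult_least[OF submodule_smult_vimage[OF W I.Icarr[OF i]]])
    fix j x assume j: "j \<in> J" and "x \<in> N"
    then have "(i \<otimes> j) \<bullet> x \<in> ideal_prod R I J \<star> N" "x \<in> carrier M"
      using i N by (auto intro: set_smult_incl ideal_prod.prod)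
    then show "j \<bullet> x \<in> {y \<in> carrier M. i \<bullet> y \<in> ideal_prod R I J \<star> N}"
      using I.Icarr[OF i] J.Icarr[OF j] by (simp add: smult_assoc1)
  qed
  then show "I \<star> (J \<star> N) \<subseteq> ideal_prod R I J \<star> N" by (intro set_smult_least[OF W]) auto
qed

lemma adic_0: "adic I 0 = carrier M"
  by (simp add: ideal_smult_eq_set_smult carrier_set_smult[OF carrier_is_submodule])

context
  fixes I assumes I: "ideal I R"
begin

lemma submodule_adic: "submodule (adic I n) R M"
  by (rule submodule_ideal_smult[OF R.ideal_pow_subset_carrier[OF I]])

lemma adic_subset_carrier: "adic I n \<subseteq> carrier M"
  using submoduleD(1)[OF submodule_adic] by blast

lemma adic_Suc: "adic I (Suc n) = I \<star> adic I n"
  by (simp add: ideal_smult_eq_set_smult ideal_prod_set_smult[OF I R.ideal_pow_is_ideal[OF I]])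

lemma smult_mem_adic_Suc: "r \<in> I \<Longrightarrow> x \<in> adic I n \<Longrightarrow> r \<bullet> x \<in> adic I (Suc n)"
  unfolding adic_Suc by (rule set_smult_incl)

lemma adic_Suc_subset: "adic I (Suc n) \<subseteq> adic I n"
  unfolding adic_Suc
  by (rule set_smult_subset[OF submodule_adic ideal_subset_carrier[OF I]])

lemma adic_antimono: "m \<le> n \<Longrightarrow> adic I n \<subseteq> adic I m"
  by (rule lift_Suc_antimono_le[of "adic I"]) (rule adic_Suc_subset)

lemma ideal_pow_set_smult_subset:
  assumes "\<And>n. submodule (K n) R M" "\<And>n. I \<star> K n \<subseteq> K (Suc n)"
  shows "ideal_pow R I m \<star> K n \<subseteq> K (n + m)"
proof (induction m)
  case 0
  then show ?case by (simp add: carrier_set_smult[OF assms(1)])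
next
  case (Suc m)
  have "K n \<subseteq> carrier M" using submoduleD(1)[OF assms(1)] by blast
  then have "ideal_pow R I (Suc m) \<star> K n = I \<star> (ideal_pow R I m \<star> K n)"
    using ideal_prod_set_smult[OF I R.ideal_pow_is_ideal[OF I]] by simp
  also have "\<dots> \<subseteq> I \<star> K (n + m)" by (rule set_smult_mono[OF order.refl Suc])
  also have "\<dots> \<subseteq> K (n + Suc m)" using assms(2)[of "n + m"] by simp
  finally show ?case .
qed

end

end

lemma mod_hom_image_set_smult:
  assumes mM: "module R M" and mN: "module R N" and f: "f \<in> mod_hom R M N"
    and S: "S \<subseteq> carrier R" and D: "D \<subseteq> carrier M"
  shows "f ` set_smult R M S D = set_smult R N S (f ` D)"
proof
  interpret M: module R M by fact
  interpret N: module R N by fact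
  have fD: "f ` D \<subseteq> carrier N" using mod_homD(1)[OF f] D by auto
  have f_smult: "f (r \<odot>\<^bsub>M\<^esub> x) = r \<odot>\<^bsub>N\<^esub> f x" if "r \<in> S" "x \<in> D" for r x
    using mod_homD(3)[OF f] that S D by blast
  have "set_smult R M S D \<subseteq> {x \<in> carrier M. f x \<in> set_smult R N S (f ` D)}"
  proof (rule M.set_smult_least[OF submodule_preimage[OF mM mN f N.submodule_set_smult[OF S fD]]])
    show "r \<odot>\<^bsub>M\<^esub> x \<in> {x \<in> carrier M. f x \<in> set_smult R N S (f ` D)}" if "r \<in> S" "x \<in> D" for r x
      using that S D f_smult[OF that] N.set_smult_incl[of r S "f x" "f ` D"] by auto
  qed
  then show "f ` set_smult R M S D \<subseteq> set_smult R N S (f ` D)" by auto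
  have "r \<odot>\<^bsub>N\<^esub> f x \<in> f ` set_smult R M S D" if "r \<in> S" "x \<in> D" for r x
    unfolding f_smult[OF that, symmetric] by (rule imageI[OF M.set_smult_incl[OF that]])
  then show "set_smult R N S (f ` D) \<subseteq> f ` set_smult R M S D"
    by (intro N.set_smult_least submodule_image[OF mM mN f M.submodule_set_smult[OF S D]]) auto
qed

lemma mod_hom_image_ideal_smult:
  assumes "module R M" "module R N" "f \<in> mod_hom R M N" "J \<subseteq> carrier R"
    and surj: "f ` carrier M = carrier N"
  shows "f ` ideal_smult R J M = ideal_smult R J N"
  using mod_hom_image_set_smult[OF assms(1-4) order.refl] by (simp add: ideal_smult_eq_set_smult surj)

lemma mod_hom_ideal_smult:
  assumes "module R M" "module R N" "f \<in> mod_hom R M N" "J \<subseteq> carrier R" "x \<in> ideal_smult R J M"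
  shows "f x \<in> ideal_smult R J N"
proof -
  interpret N: module R N by fact
  have "f x \<in> set_smult R N J (f ` carrier M)"
    using mod_hom_image_set_smult[OF assms(1-4) order.refl] assms(5) unfolding ideal_smult_eq_set_smult by blast
  moreover have "f ` carrier M \<subseteq> carrier N" using mod_homD(1)[OF assms(3)] by blast
  ultimately show ?thesis
    using N.set_smult_mono[OF order.refl] unfolding ideal_smult_eq_set_smult by blast
qed

section \<open>One-dimensional Noetherian domains\<close>

definition ideal_colon :: "('r,'c) ring_scheme \<Rightarrow> 'r set \<Rightarrow> 'r set \<Rightarrow> 'r set"
  where "ideal_colon R J S = {s \<in> carrier R. \<forall>t\<in>S. s \<otimes>\<^bsub>R\<^esub> t \<in> J}"

context cring
begin

lemma ideal_ideal_colon:
  assumes "ideal J R" "S \<subseteq> carrier R"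
  shows "ideal (ideal_colon R J S) R"
proof -
  interpret J: ideal J R by fact
  show ?thesis
  proof (rule cring_idealI)
    show "\<zero> \<in> ideal_colon R J S" using assms(2) by (auto simp: ideal_colon_def)
    show "x \<oplus> y \<in> ideal_colon R J S"
      if "x \<in> ideal_colon R J S" "y \<in> ideal_colon R J S" for x y
      using that assms(2) by (auto simp: ideal_colon_def l_distr subset_iff)
    show "r \<otimes> x \<in> ideal_colon R J S" if "r \<in> carrier R" "x \<in> ideal_colon R J S" for r x
      using that assms(2) by (auto simp: ideal_colon_def m_assoc subset_iff intro: J.I_l_closed)
  qed (auto simp: ideal_colon_def)
qed

lemma ideal_colon_antimono: "S \<subseteq> S' \<Longrightarrow> ideal_colon R J S' \<subseteq> ideal_colon R J S"
  by (auto simp: ideal_colon_def)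

lemma subset_ideal_colon:
  assumes "ideal J R" "S \<subseteq> carrier R" shows "J \<subseteq> ideal_colon R J S"
  using ideal.I_r_closed[OF assms(1)] ideal.Icarr[OF assms(1)] assms(2)
  by (auto simp: ideal_colon_def)

lemma ideal_colon_ideal_prod:
  assumes J: "ideal J R" and I: "ideal I R" and K: "ideal K R"
  shows "ideal_colon R J (ideal_prod R I K) = ideal_colon R (ideal_colon R J K) I"
proof
  interpret J: ideal J R by fact
  interpret I: ideal I R by fact
  interpret K: ideal K R by fact
  show "ideal_colon R J (ideal_prod R I K) \<subseteq> ideal_colon R (ideal_colon R J K) I"
    using I.Icarr K.Icarr by (auto simp: ideal_colon_def m_assoc intro!: ideal_prod.prod)
  show "ideal_colon R (ideal_colon R J K) I \<subseteq> ideal_colon R J (ideal_prod R I K)"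
  proof
    fix s assume s: "s \<in> ideal_colon R (ideal_colon R J K) I"
    then have sc: "s \<in> carrier R" by (simp add: ideal_colon_def)
    have "t \<in> carrier R \<and> s \<otimes> t \<in> J" if "t \<in> ideal_prod R I K" for t
      using that
    proof (induction t rule: ideal_prod.induct)
      case (prod i k)
      then show ?case using s I.Icarr[of i] K.Icarr[of k] by (auto simp: ideal_colon_def m_assoc[symmetric])
    qed (use sc in \<open>auto simp: r_distr\<close>)
    then show "s \<in> ideal_colon R J (ideal_prod R I K)" using sc by (simp add: ideal_colon_def)
  qed
qed

lemma primeideal_one_notin: "primeideal P R \<Longrightarrow> \<one> \<notin> P"
  using ideal.one_imp_carrier[OF primeideal.axioms(1)] primeideal.I_notcarr by metis

lemma primeideal_mult_notin:
  assumes "primeideal P R" "s \<in> carrier R - P" "t \<in> carrier R - P"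
  shows "s \<otimes> t \<in> carrier R - P"
  using primeideal.I_prime[OF assms(1), of s t] assms(2,3) by auto

lemma primeideal_ideal_pow_subset:
  assumes P: "primeideal P R" and I: "ideal I R" and "ideal_pow R I n \<subseteq> P"
  shows "I \<subseteq> P"
  using assms(3)
proof (induction n)
  case 0
  then show ?case using primeideal_one_notin[OF P] by auto
next
  case (Suc n)
  then show ?case
    using primeideal_divides_ideal_prod[OF P I ideal_pow_is_ideal[OF I, of n]] by auto
qed

end

context noetherian_ring
begin

lemma maximal_ideal_exists:
  assumes "F \<noteq> {}" "\<And>J. J \<in> F \<Longrightarrow> ideal J R"
  obtains J where "J \<in> F" "\<And>J'. J' \<in> F \<Longrightarrow> J \<subseteq> J' \<Longrightarrow> J' = J"
proof -
  have "\<exists>J\<in>F. \<forall>J'\<in>F. J \<subseteq> J' \<longrightarrow> J' = J"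
  proof (rule subset_Zorn)
    fix C assume C: "subset.chain F C"
    show "\<exists>U\<in>F. \<forall>Y\<in>C. Y \<subseteq> U"
    proof (cases "C = {}")
      case True
      then show ?thesis using assms(1) by auto
    next
      case False
      have "subset.chain {I. ideal I R} C" using C assms(2) unfolding pred_on.chain_def by blast
      then have "\<Union>C \<in> C" by (rule ideal_chain_is_trivial[OF False])
      then have "\<Union>C \<in> F" using C by (auto simp: pred_on.chain_def)
      then show ?thesis by (rule bexI[rotated]) auto
    qed
  qed
  then show ?thesis using that by blast
qed

lemma noetherian_induct [consumes 1, case_names step]:
  assumes "ideal J R"
    and step: "\<And>J. ideal J R \<Longrightarrow> (\<And>J'. ideal J' R \<Longrightarrow> J \<subset> J' \<Longrightarrow> Q J') \<Longrightarrow> Q J"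
  shows "Q J"
proof (rule ccontr)
  assume "\<not> Q J"
  then have "{J. ideal J R \<and> \<not> Q J} \<noteq> {}" using assms(1) by auto
  then obtain K where K: "K \<in> {J. ideal J R \<and> \<not> Q J}"
    and max: "\<And>J'. J' \<in> {J. ideal J R \<and> \<not> Q J} \<Longrightarrow> K \<subseteq> J' \<Longrightarrow> J' = K"
    by (rule maximal_ideal_exists) auto
  have "Q J'" if "ideal J' R" "K \<subset> J'" for J' using max[of J'] that by auto
  then show False using step[of K] K by auto
qed

lemma ideal_chain_stable:
  fixes J :: "nat \<Rightarrow> 'a set"
  assumes "\<And>i. ideal (J i) R" "\<And>i. J i \<subseteq> J (Suc i)"
  obtains k where "\<And>i. i \<ge> k \<Longrightarrow> J i = J k"
proof -
  have mono: "i \<le> j \<Longrightarrow> J i \<subseteq> J j" for i j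
    by (rule lift_Suc_mono_le[of J]) (use assms in auto)
  obtain k where max: "\<And>J'. J' \<in> range J \<Longrightarrow> J k \<subseteq> J' \<Longrightarrow> J' = J k"
    by (rule maximal_ideal_exists[of "range J"]) (use assms in auto)
  show ?thesis by (rule that[of k]) (rule max[OF rangeI mono])
qed

end

context cring
begin

lemma mem_ideal_colon_mult_iff:
  assumes "r \<in> carrier R" "s \<in> carrier R" "t \<in> carrier R"
  shows "s \<in> ideal_colon R J {r \<otimes> t} \<longleftrightarrow> s \<otimes> t \<in> ideal_colon R J {r}"
  using assms by (simp add: ideal_colon_def m_ac)

lemma primeideal_if_maximal_ideal_colon:
  assumes J: "ideal J R" and P: "primeideal P R"
    and r: "r \<in> carrier R" "ideal_colon R J {r} \<subseteq> P"
    and max: "\<And>t. t \<in> carrier R \<Longrightarrow> ideal_colon R J {r \<otimes> t} \<subseteq> P \<Longrightarrow>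
      ideal_colon R J {r \<otimes> t} = ideal_colon R J {r}"
  shows "primeideal (ideal_colon R J {r}) R"
proof (rule primeidealI)
  interpret P: primeideal P R by fact
  note mem_iff = mem_ideal_colon_mult_iff[where J = J, OF r(1)]
  show "ideal (ideal_colon R J {r}) R" using ideal_ideal_colon[OF J] r(1) by simp
  show "cring R" by (rule is_cring)
  show "carrier R \<noteq> ideal_colon R J {r}" using r(2) P.I_notcarr P.a_subset by auto
  fix b d assume bd: "b \<in> carrier R" "d \<in> carrier R" "b \<otimes> d \<in> ideal_colon R J {r}"
  show "b \<in> ideal_colon R J {r} \<or> d \<in> ideal_colon R J {r}"
  proof (cases "ideal_colon R J {r \<otimes> b} \<subseteq> P")
    case True
    then show ?thesis using max[OF bd(1)] mem_iff[OF bd(2,1)] bd m_comm by auto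
  next
    case False
    then obtain s where s: "s \<in> carrier R" "s \<otimes> b \<in> ideal_colon R J {r}" "s \<notin> P"
      using mem_iff[OF _ bd(1)] by (auto simp: ideal_colon_def)
    have "t \<in> P" if t: "t \<in> ideal_colon R J {r \<otimes> s}" for t
    proof -
      have tc: "t \<in> carrier R" using t by (simp add: ideal_colon_def)
      then show ?thesis using t mem_iff[OF tc s(1)] r(2) P.I_prime[OF tc s(1)] s(3) by auto
    qed
    then have "ideal_colon R J {r \<otimes> s} = ideal_colon R J {r}" using max[OF s(1)] by auto
    then show ?thesis using mem_iff[OF bd(1) s(1)] s(2) m_comm[OF bd(1) s(1)] by simp
  qed
qed

lemma prime_ideal_colon_exists:
  assumes "noetherian_ring R" and J: "ideal J R" and P: "primeideal P R" and "J \<subseteq> P"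
  obtains r where "r \<in> carrier R" "primeideal (ideal_colon R J {r}) R" "ideal_colon R J {r} \<subseteq> P"
proof -
  interpret noetherian_ring R by fact
  interpret J: ideal J R by fact
  define F where "F = {ideal_colon R J {r} | r. r \<in> carrier R \<and> ideal_colon R J {r} \<subseteq> P}"
  have "ideal_colon R J {\<one>} = J" using J.a_subset by (auto simp: ideal_colon_def)
  then have "F \<noteq> {}" using assms(4) by (auto simp: F_def intro!: exI[of _ \<one>])
  moreover have "ideal K R" if "K \<in> F" for K using that ideal_ideal_colon[OF J] by (auto simp: F_def)
  ultimately obtain K where K: "K \<in> F" and max: "\<And>K'. K' \<in> F \<Longrightarrow> K \<subseteq> K' \<Longrightarrow> K' = K"
    by (rule maximal_ideal_exists) auto
  obtain r where r: "r \<in> carrier R" "K = ideal_colon R J {r}" "K \<subseteq> P" using K by (auto simp: F_def)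
  have "ideal_colon R J {r \<otimes> t} = K" if t: "t \<in> carrier R" and "ideal_colon R J {r \<otimes> t} \<subseteq> P" for t
  proof (rule max)
    show "ideal_colon R J {r \<otimes> t} \<in> F" using that r(1) by (auto simp: F_def)
    show "K \<subseteq> ideal_colon R J {r \<otimes> t}"
      using r(1) t unfolding r(2) by (auto simp: ideal_colon_def m_assoc[symmetric] J.I_r_closed)
  qed
  then have "primeideal (ideal_colon R J {r}) R"
    using r by (intro primeideal_if_maximal_ideal_colon[OF J P]) auto
  then show ?thesis using r that by blast
qed

end

locale one_dim_noetherian_domain = noetherian_domain +
  assumes nonzero_primes_incomparable:
    "primeideal P R \<Longrightarrow> primeideal Q R \<Longrightarrow> P \<subseteq> Q \<Longrightarrow> P \<noteq> {\<zero>} \<Longrightarrow> P = Q"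

lemma one_dim_noetherian_domainI:
  assumes "noetherian_domain R" "krull_dim R = 1"
  shows "one_dim_noetherian_domain R"
proof -
  interpret noetherian_domain R by fact
  show ?thesis
  proof (unfold_locales, rule ccontr)
    fix P Q assume PQ: "primeideal P R" "primeideal Q R" "P \<subseteq> Q" "P \<noteq> {\<zero>\<^bsub>R\<^esub>}" "P \<noteq> Q"
    interpret P: primeideal P R by fact
    have "{\<zero>\<^bsub>R\<^esub>} \<subset> P" using PQ(4) P.zero_closed by blast
    then have "prime_chain R 2" unfolding prime_chain_def
      by (intro exI[of _ "\<lambda>i. if i = 0 then {\<zero>\<^bsub>R\<^esub>} else if i = 1 then P else Q"])
         (use PQ zeroprimeideal in \<open>auto simp: less_2_cases_iff\<close>)
    then have "enat 2 \<le> krull_dim R" unfolding krull_dim_def by (intro Sup_upper) auto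
    then show False using assms(2) by (simp add: one_enat_def)
  qed
qed

context one_dim_noetherian_domain
begin

lemma primeideal_eq_ideal_colon:
  assumes J: "ideal J R" "J \<noteq> {\<zero>}" and P: "primeideal P R" and "J \<subseteq> P"
  obtains r where "r \<in> carrier R" "ideal_colon R J {r} = P"
proof -
  obtain r where r: "r \<in> carrier R" "primeideal (ideal_colon R J {r}) R" "ideal_colon R J {r} \<subseteq> P"
    by (rule prime_ideal_colon_exists[OF noetherian_ring_axioms J(1) P assms(4)])
  have "ideal_colon R J {r} \<noteq> {\<zero>}"
    using subset_ideal_colon[OF J(1), of "{r}"] r(1) J(2)
      additive_subgroup.zero_closed[OF ideal.axioms(1)[OF J(1)]] by auto
  then show ?thesis using that[OF r(1)] nonzero_primes_incomparable[OF r(2) P r(3)] by blast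
qed

lemma finite_primes_above:
  assumes "ideal J R" "J \<noteq> {\<zero>}"
  shows "finite {P. primeideal P R \<and> J \<subseteq> P}"
  using assms
proof (induction J rule: noetherian_induct)
  case (step J)
  interpret J: ideal J R by fact
  consider "J = carrier R" | "primeideal J R" | "J \<noteq> carrier R" "\<not> primeideal J R" by blast
  then show ?case
  proof cases
    case 1
    then have no_primes: "{P. primeideal P R \<and> J \<subseteq> P} = {}" using primeideal_one_notin by auto
    show ?thesis unfolding no_primes by (rule finite.emptyI)
  next
    case 2
    then have "{P. primeideal P R \<and> J \<subseteq> P} \<subseteq> {J}"
      using nonzero_primes_incomparable step.prems by blast
    then show ?thesis by (rule finite_subset) simp
  next
    case 3
    obtain b d where bd: "b \<in> carrier R" "d \<in> carrier R" "b \<otimes> d \<in> J" "b \<notin> J" "d \<notin> J"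
      using J.primeidealCD[OF is_cring 3(2)] 3(1) by auto
    have fin: "finite {P. primeideal P R \<and> insert x J \<subseteq> P}" if x: "x \<in> carrier R" "x \<notin> J" for x
    proof -
      let ?G = "Idl (insert x J)"
      have sub: "insert x J \<subseteq> carrier R" using x J.a_subset by auto
      have G: "ideal ?G R" "insert x J \<subseteq> ?G"
        using genideal_ideal[OF sub] genideal_self[OF sub] by auto
      have "J \<subset> ?G" using G(2) x(2) by auto
      moreover have "?G \<noteq> {\<zero>}" using G(2) x(2) J.zero_closed by auto
      ultimately have "finite {P. primeideal P R \<and> ?G \<subseteq> P}" by (rule step.IH[OF G(1)])
      moreover have "{P. primeideal P R \<and> insert x J \<subseteq> P} \<subseteq> {P. primeideal P R \<and> ?G \<subseteq> P}"
        using genideal_minimal[OF primeideal.axioms(1)] by blast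
      ultimately show ?thesis by (rule finite_subset[rotated])
    qed
    have "{P. primeideal P R \<and> J \<subseteq> P} \<subseteq>
       {P. primeideal P R \<and> insert b J \<subseteq> P} \<union> {P. primeideal P R \<and> insert d J \<subseteq> P}"
      using primeideal.I_prime[OF _ bd(1,2)] bd(3) by blast
    then show ?thesis by (rule finite_subset) (use fin bd in simp)
  qed
qed

text \<open>Once the chain \<open>(dR : I\<^sup>m)\<close> is stationary, its limit \<open>J\<close> satisfies \<open>(J : I) = J\<close>; if \<open>J\<close> were
  contained in \<open>P\<close>, then \<open>P = (J : r)\<close> for some \<open>r \<in> (J : I)\<close>.\<close>
lemma ideal_pow_locally_principal:
  assumes I: "ideal I R" and P: "primeideal P R" and "I \<subseteq> P" and d: "d \<in> carrier R" "d \<noteq> \<zero>"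
  obtains s m where "s \<in> carrier R - P" "s \<in> ideal_colon R (PIdl d) (ideal_pow R I m)"
proof -
  have D: "ideal (PIdl d) R" by (rule cgenideal_ideal[OF d(1)])
  note pow = ideal_pow_is_ideal[OF I]
  note pow_carrier = ideal_pow_subset_carrier[OF I]
  define J where "J m = ideal_colon R (PIdl d) (ideal_pow R I m)" for m
  have J: "ideal (J m) R" for m unfolding J_def by (rule ideal_ideal_colon[OF D pow_carrier])
  have "ideal_pow R I (Suc m) \<subseteq> ideal_pow R I m" for m using ideal_prod_inter[OF I pow] by auto
  then have "J m \<subseteq> J (Suc m)" for m unfolding J_def by (rule ideal_colon_antimono)
  with J obtain m where m: "\<And>i. i \<ge> m \<Longrightarrow> J i = J m" by (rule ideal_chain_stable) (rule that)
  have J_Suc: "J (Suc m) = ideal_colon R (J m) I"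
    using ideal_colon_ideal_prod[OF D I pow] by (simp add: J_def)
  have "d \<in> J m"
    using subset_ideal_colon[OF D pow_carrier] cgenideal_self[OF d(1)] unfolding J_def by blast
  then have "J m \<noteq> {\<zero>}" using d(2) by blast
  have "\<not> J m \<subseteq> P"
  proof
    assume "J m \<subseteq> P"
    then obtain r where r: "r \<in> carrier R" "ideal_colon R (J m) {r} = P"
      by (rule primeideal_eq_ideal_colon[OF J \<open>J m \<noteq> {\<zero>}\<close> P])
    have "r \<otimes> b \<in> J m" if "b \<in> I" for b
    proof -
      have "b \<in> ideal_colon R (J m) {r}" using r(2) that assms(3) by auto
      then show ?thesis using r(1) by (simp add: ideal_colon_def m_comm)
    qed
    then have "r \<in> J (Suc m)" unfolding J_Suc using r(1) by (simp add: ideal_colon_def)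
    then have "\<one> \<in> ideal_colon R (J m) {r}" using m[of "Suc m"] r(1) by (simp add: ideal_colon_def)
    then show False using r(2) primeideal_one_notin[OF P] by simp
  qed
  then show ?thesis using that ideal.Icarr[OF J] unfolding J_def by blast
qed

end

section \<open>Noetherian modules\<close>

definition noetherian_module :: "('r,'c) ring_scheme \<Rightarrow> ('r,'a,'d) module_scheme \<Rightarrow> bool"
  where "noetherian_module R M \<longleftrightarrow> (\<forall>N :: nat \<Rightarrow> 'a set. (\<forall>i. submodule (N i) R M) \<longrightarrow>
     (\<forall>i. N i \<subseteq> N (Suc i)) \<longrightarrow> (\<exists>k. \<forall>i\<ge>k. N i = N k))"

definition ann_mod :: "('r,'c) ring_scheme \<Rightarrow> ('r,'a,'d) module_scheme \<Rightarrow> 'a set \<Rightarrow> 'a \<Rightarrow> 'r set"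
  where "ann_mod R M N x = {r \<in> carrier R. r \<odot>\<^bsub>M\<^esub> x \<in> N}"

context module
begin

lemma ideal_ann_mod:
  assumes "submodule N R M" "x \<in> carrier M"
  shows "ideal (ann_mod R M N x) R"
  unfolding ann_mod_def
  by (rule R.cring_idealI)
     (use assms(2) submoduleD[OF assms(1)] in \<open>auto simp: smult_l_distr smult_assoc1\<close>)

lemma noetherian_moduleD:
  assumes "noetherian_module R M" "\<And>i. submodule (N i) R M" "\<And>i. N i \<subseteq> N (Suc i)"
  obtains k where "\<And>i. i \<ge> k \<Longrightarrow> N i = N k"
  using assms(1)[unfolded noetherian_module_def, rule_format, of N] assms(2,3) by blast

lemma noetherian_module_maximal:
  assumes "noetherian_module R M" "F \<noteq> {}" "\<And>N. N \<in> F \<Longrightarrow> submodule N R M"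
  obtains N where "N \<in> F" "\<And>N'. N' \<in> F \<Longrightarrow> N \<subseteq> N' \<Longrightarrow> N' = N"
proof -
  have "\<exists>N\<in>F. \<forall>N'\<in>F. N \<subseteq> N' \<longrightarrow> N' = N"
  proof (rule ccontr)
    assume "\<not> ?thesis"
    then have "\<forall>N\<in>F. \<exists>N'. N' \<in> F \<and> N \<subset> N'" by blast
    then obtain f where f: "\<And>N. N \<in> F \<Longrightarrow> f N \<in> F \<and> N \<subset> f N" by metis
    obtain N0 where N0: "N0 \<in> F" using assms(2) by auto
    define N where "N i = (f ^^ i) N0" for i :: nat
    have NF: "N i \<in> F" for i by (induction i) (auto simp: N_def N0 f)
    have N_Suc: "N i \<subset> N (Suc i)" for i using f[OF NF[of i]] by (simp add: N_def)
    obtain k where "\<And>i. i \<ge> k \<Longrightarrow> N i = N k"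
      by (rule noetherian_moduleD[OF assms(1), of N]) (use assms(3)[OF NF] N_Suc in auto)
    then show False using N_Suc[of k] le_SucI[OF order.refl] by blast
  qed
  then show ?thesis using that by blast
qed

lemma Int_extend_by_cyclic_subset:
  assumes N: "submodule N R M" and N': "submodule N' R M" and D: "submodule D R M"
    and "N \<subseteq> N'" "N' \<inter> D \<subseteq> N" and u: "u \<in> carrier M"
    and ann: "ann_mod R M (N' \<uplus> D) u \<subseteq> ann_mod R M (N \<uplus> D) u"
  shows "N' \<inter> ((\<lambda>r. r \<bullet> u) ` carrier R \<uplus> D) \<subseteq> N"
proof safe
  fix x assume x: "x \<in> N'" "x \<in> (\<lambda>r. r \<bullet> u) ` carrier R \<uplus> D"
  then obtain r y where r: "r \<in> carrier R" and y: "y \<in> D" and xy: "x = r \<bullet> u \<boxplus> y"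
    by (auto simp: set_add_iff)
  have yc: "y \<in> carrier M" and ruc: "r \<bullet> u \<in> carrier M" using submoduleD(1)[OF D y] r u by auto
  have "r \<bullet> u = x \<boxplus> \<ominus>\<^bsub>M\<^esub> y"
    using M.a_add_diff_cancel_right[OF ruc yc] by (simp add: xy a_minus_def)
  also have "\<dots> \<in> N' \<uplus> D" by (rule set_add_memI[OF x(1) submoduleD(4)[OF D y]])
  finally have "r \<bullet> u \<in> N \<uplus> D" using ann r by (auto simp: ann_mod_def)
  then obtain w z where w: "w \<in> N" and z: "z \<in> D" and ru: "r \<bullet> u = w \<boxplus> z" by (auto simp: set_add_iff)
  have c: "w \<in> carrier M" "z \<in> carrier M" using submoduleD(1)[OF N w] submoduleD(1)[OF D z] by auto
  have x_eq: "x = (z \<boxplus> y) \<boxplus> w" using xy ru c yc by (simp add: M.a_ac)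
  have zy: "z \<boxplus> y \<in> D" by (rule submoduleD(3)[OF D z y])
  then have "z \<boxplus> y \<in> N'"
    using submodule_mem_if_add_mem[OF N' _ subsetD[OF assms(4) w]] x(1) x_eq submoduleD(1)[OF D zy] by simp
  then have "z \<boxplus> y \<in> N" using zy assms(5) by blast
  then show "x \<in> N" unfolding x_eq by (rule submoduleD(3)[OF N _ w])
qed

lemma chain_Int_extend_by_cyclic_stable:
  assumes "noetherian_ring R" and sN: "\<And>i. submodule (N i) R M" and N_Suc: "\<And>i. N i \<subseteq> N (Suc i)"
    and D: "submodule D R M" and D_stable: "\<And>i. i \<ge> k \<Longrightarrow> N i \<inter> D = N k \<inter> D" and u: "u \<in> carrier M"
  defines "D' \<equiv> (\<lambda>r. r \<bullet> u) ` carrier R \<uplus> D"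
  obtains K where "\<And>i. i \<ge> K \<Longrightarrow> N i \<inter> D' = N K \<inter> D'"
proof -
  interpret noetherian_ring R by fact
  have mono: "i \<le> j \<Longrightarrow> N i \<subseteq> N j" for i j by (rule lift_Suc_mono_le[of N]) (rule N_Suc)
  define ann where "ann i = ann_mod R M (N i \<uplus> D) u" for i
  have "ideal (ann i) R" for i
    unfolding ann_def by (rule ideal_ann_mod[OF submodule_set_add[OF sN D] u])
  moreover have "ann i \<subseteq> ann (Suc i)" for i
    using set_add_mono[OF N_Suc order.refl] by (auto simp: ann_def ann_mod_def)
  ultimately obtain k' where ann_stable: "\<And>i. i \<ge> k' \<Longrightarrow> ann i = ann k'"
    by (rule ideal_chain_stable) (rule that)
  define K where "K = max k k'"
  have "N i \<inter> D' = N K \<inter> D'" if i: "i \<ge> K" for i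
  proof
    show "N K \<inter> D' \<subseteq> N i \<inter> D'" using mono[OF i] by auto
    have "N i \<inter> D \<subseteq> N K" using D_stable[of i] D_stable[of K] i by (auto simp: K_def)
    moreover have "ann i \<subseteq> ann K" using ann_stable[of i] ann_stable[of K] i by (auto simp: K_def)
    ultimately have "N i \<inter> D' \<subseteq> N K" unfolding D'_def ann_def
      by (rule Int_extend_by_cyclic_subset[OF sN sN D mono[OF i] _ u])
    then show "N i \<inter> D' \<subseteq> N K \<inter> D'" by auto
  qed
  then show ?thesis by (rule that)
qed

lemma fin_gen_imp_noetherian:
  assumes "noetherian_ring R" "fin_gen_module R M"
  shows "noetherian_module R M"
  unfolding noetherian_module_def
proof (intro allI impI)
  fix N :: "nat \<Rightarrow> _" assume "\<forall>i. submodule (N i) R M" "\<forall>i. N i \<subseteq> N (Suc i)"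
  then have sN: "submodule (N i) R M" and N_Suc: "N i \<subseteq> N (Suc i)" for i by auto
  obtain G where G: "finite G" "G \<subseteq> carrier M" "gen_submodule R M G = carrier M"
    using assms(2) unfolding fin_gen_module_def by blast
  have "\<exists>D. submodule D R M \<and> G \<subseteq> D \<and> (\<exists>k. \<forall>i\<ge>k. N i \<inter> D = N k \<inter> D)"
    using G(1,2)
  proof (induction G rule: finite_induct)
    case empty
    have "\<forall>i\<ge>0. N i \<inter> {\<zero>\<^bsub>M\<^esub>} = N 0 \<inter> {\<zero>\<^bsub>M\<^esub>}" using submoduleD(2)[OF sN] by auto
    then show ?case using submodule_zero by blast
  next
    case (insert u G)
    then obtain D k where D: "submodule D R M" "G \<subseteq> D"
      and D_stable: "\<And>i. i \<ge> k \<Longrightarrow> N i \<inter> D = N k \<inter> D" by auto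
    have u: "u \<in> carrier M" using insert.prems by auto
    let ?Ru = "(\<lambda>r. r \<bullet> u) ` carrier R"
    have sRu: "submodule ?Ru R M" by (rule submodule_cyclic[OF u])
    have "u \<in> ?Ru" by (rule image_eqI[of _ _ \<one>]) (use u in auto)
    then have "insert u G \<subseteq> ?Ru \<uplus> D"
      using set_add_upper1[OF sRu D(1)] set_add_upper2[OF sRu D(1)] D(2) by blast
    moreover obtain K where "\<And>i. i \<ge> K \<Longrightarrow> N i \<inter> (?Ru \<uplus> D) = N K \<inter> (?Ru \<uplus> D)"
      by (rule chain_Int_extend_by_cyclic_stable[of N, OF assms(1) sN N_Suc D(1) D_stable u]) (assumption, rule that)
    ultimately show ?case using submodule_set_add[OF sRu D(1)] by blast
  qed
  then obtain D k where D: "submodule D R M" "G \<subseteq> D" "\<And>i. i \<ge> k \<Longrightarrow> N i \<inter> D = N k \<inter> D" by auto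
  have "carrier M \<subseteq> D" using gen_submodule_least[OF D(1,2)] G(3) by simp
  then have "N i \<inter> D = N i" for i using submoduleD(1)[OF sN] by auto
  then show "\<exists>k. \<forall>i\<ge>k. N i = N k" using D(3) by auto
qed

end

lemma noetherian_module_surj:
  assumes mM: "module R M" and mN: "module R N" and f: "f \<in> mod_hom R M N"
    and surj: "f ` carrier M = carrier N" and noeth: "noetherian_module R M"
  shows "noetherian_module R N"
  unfolding noetherian_module_def
proof (intro allI impI)
  interpret N: module R N by fact
  fix D :: "nat \<Rightarrow> _" assume D: "\<forall>i. submodule (D i) R N" "\<forall>i. D i \<subseteq> D (Suc i)"
  obtain k where k: "\<And>i. i \<ge> k \<Longrightarrow> {x \<in> carrier M. f x \<in> D i} = {x \<in> carrier M. f x \<in> D k}"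
    by (rule module.noetherian_moduleD[OF mM noeth, of "\<lambda>i. {x \<in> carrier M. f x \<in> D i}"])
       (use D submodule_preimage[OF mM mN f] in auto)
  have "D i = f ` {x \<in> carrier M. f x \<in> D i}" for i
    using N.submoduleD(1)[of "D i"] D(1) surj by (auto simp: set_eq_iff image_iff) metis
  then show "\<exists>k. \<forall>i\<ge>k. D i = D k" using k by metis
qed

section \<open>Graded submodules of Rees modules\<close>

text \<open>The families \<open>L\<close> are the graded \<open>R[S t]\<close>-submodules of \<open>\<Oplus> E\<^sub>n t\<^sup>n\<close>; all of them are
  required to be generated in bounded degree.\<close>
definition graded_noetherian :: "('r,'c) ring_scheme \<Rightarrow> ('r,'a,'d) module_scheme \<Rightarrow> 'r set
    \<Rightarrow> (nat \<Rightarrow> 'a set) \<Rightarrow> bool"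
  where "graded_noetherian R M S E \<longleftrightarrow> (\<forall>L. (\<forall>n. submodule (L n) R M) \<longrightarrow> (\<forall>n. L n \<subseteq> E n) \<longrightarrow>
     (\<forall>n. set_smult R M S (L n) \<subseteq> L (Suc n)) \<longrightarrow>
     (\<exists>c. \<forall>n\<ge>c. L (Suc n) \<subseteq> set_smult R M S (L n)))"

lemma graded_noetherianD:
  assumes "graded_noetherian R M S E" "\<And>n. submodule (L n) R M" "\<And>n. L n \<subseteq> E n"
    and "\<And>n. set_smult R M S (L n) \<subseteq> L (Suc n)"
  obtains c where "\<And>n. n \<ge> c \<Longrightarrow> L (Suc n) \<subseteq> set_smult R M S (L n)"
  using assms(1)[unfolded graded_noetherian_def, rule_format, of L] assms(2-4) by blast

lemma graded_noetherian_antimono: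
  assumes "graded_noetherian R M S E" "\<And>n. E' n \<subseteq> E n"
  shows "graded_noetherian R M S E'"
  using assms unfolding graded_noetherian_def by (meson order_trans)

text \<open>The elements \<open>\<Sum>\<^bsub>j<k\<^esub> a\<^sup>j y\<^sub>j\<close> with \<open>y\<^sub>j \<in> E\<^bsub>n-j\<^esub>\<close>; only \<open>k \<le> n + 1\<close> is meaningful.\<close>
primrec low_terms :: "('r,'c) ring_scheme \<Rightarrow> ('r,'a,'d) module_scheme \<Rightarrow> 'r \<Rightarrow> (nat \<Rightarrow> 'a set)
    \<Rightarrow> nat \<Rightarrow> nat \<Rightarrow> 'a set" where
  "low_terms R M a E n 0 = {\<zero>\<^bsub>M\<^esub>}"
| "low_terms R M a E n (Suc k) =
     low_terms R M a E n k <+>\<^bsub>M\<^esub> (\<lambda>x. (a [^]\<^bsub>R\<^esub> k) \<odot>\<^bsub>M\<^esub> x) ` E (n - k)"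

text \<open>The coefficients of \<open>a\<^sup>k\<close> in those elements of \<open>L\<^bsub>k+m\<^esub>\<close> whose leading term is at most \<open>a\<^sup>k\<close>.\<close>
definition leading_coeffs :: "('r,'c) ring_scheme \<Rightarrow> ('r,'a,'d) module_scheme \<Rightarrow> 'r \<Rightarrow> (nat \<Rightarrow> 'a set)
    \<Rightarrow> (nat \<Rightarrow> 'a set) \<Rightarrow> nat \<Rightarrow> nat \<Rightarrow> 'a set"
  where "leading_coeffs R M a E L k m = E m \<inter> {x \<in> carrier M.
     (a [^]\<^bsub>R\<^esub> k) \<odot>\<^bsub>M\<^esub> x \<in> low_terms R M a E (k + m) k <+>\<^bsub>M\<^esub> L (k + m)}"

context module
begin

lemma noetherian_module_chain_upper_bound:
  assumes "noetherian_module R M" "\<And>i. submodule (N i) R M" "\<And>i. N i \<subseteq> N (Suc i)"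
  obtains k where "\<And>i. N i \<subseteq> N k"
proof -
  obtain k where k: "\<And>i. i \<ge> k \<Longrightarrow> N i = N k" by (rule noetherian_moduleD[of N, OF assms]) (rule that)
  have "N i \<subseteq> N k" for i
    using lift_Suc_mono_le[of N, OF assms(3), of i "max i k"] k[of "max i k"] by simp
  then show ?thesis by (rule that)
qed

lemma bigraded_family_stable:
  fixes J :: "nat \<Rightarrow> nat \<Rightarrow> 'c set"
  assumes noeth: "noetherian_module R M" and E: "graded_noetherian R M S E"
    and sJ: "\<And>k m. submodule (J k m) R M" and JE: "\<And>k m. J k m \<subseteq> E m"
    and J_Suc: "\<And>k m. J k m \<subseteq> J (Suc k) m" and J_smult: "\<And>k m. set_smult R M S (J k m) \<subseteq> J k (Suc m)"
  obtains k0 c0 where "\<And>k m. J k m \<subseteq> J k0 m"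
    and "\<And>k m. k \<le> k0 \<Longrightarrow> m \<ge> c0 \<Longrightarrow> J k (Suc m) \<subseteq> set_smult R M S (J k m)"
proof -
  have J_mono: "k \<le> k' \<Longrightarrow> J k m \<subseteq> J k' m" for k k' m
    by (rule lift_Suc_mono_le[of "\<lambda>k. J k m"]) (rule J_Suc)
  have "\<exists>k0. \<forall>k. J k m \<subseteq> J k0 m" for m
    by (rule noetherian_module_chain_upper_bound[of "\<lambda>k. J k m", OF noeth sJ J_Suc]) blast
  then obtain kmax where kmax: "\<And>k m. J k m \<subseteq> J (kmax m) m" by metis
  have "\<exists>c. \<forall>m\<ge>c. J k (Suc m) \<subseteq> set_smult R M S (J k m)" for k
    by (rule graded_noetherianD[OF E sJ JE J_smult[of k]]) blast
  then obtain c where c: "\<And>k m. m \<ge> c k \<Longrightarrow> J k (Suc m) \<subseteq> set_smult R M S (J k m)" by metis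
  obtain d where d: "\<And>m. m \<ge> d \<Longrightarrow> J (kmax (Suc m)) (Suc m) \<subseteq> set_smult R M S (J (kmax m) m)"
  proof (rule graded_noetherianD[OF E sJ JE, of "\<lambda>m. kmax m"])
    show "set_smult R M S (J (kmax n) n) \<subseteq> J (kmax (Suc n)) (Suc n)" for n
      using J_smult kmax by (rule order.trans)
  qed (rule that)
  define k0 where "k0 = Max (kmax ` {..d})"
  have limit_subset: "J (kmax m) m \<subseteq> J k0 m" for m
  proof (induction m)
    have low_degree: "J (kmax m) m \<subseteq> J k0 m" if "m \<le> d" for m
      by (rule J_mono) (use that in \<open>auto simp: k0_def\<close>)
    { case 0 show ?case by (rule low_degree) simp }
    { case (Suc m)
      show ?case
      proof (cases "Suc m \<le> d")
        case False
        then have "J (kmax (Suc m)) (Suc m) \<subseteq> set_smult R M S (J (kmax m) m)" by (intro d) simp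
        also have "\<dots> \<subseteq> set_smult R M S (J k0 m)" by (rule set_smult_mono[OF order.refl Suc])
        also have "\<dots> \<subseteq> J k0 (Suc m)" by (rule J_smult)
        finally show ?thesis .
      qed (rule low_degree) }
  qed
  show ?thesis
  proof (rule that[of k0 "Max (c ` {..k0})"])
    show "J k m \<subseteq> J k0 m" for k m using kmax limit_subset by (rule order.trans)
    fix k m assume "k \<le> k0" "Max (c ` {..k0}) \<le> m"
    then have "c k \<le> m" using Max_ge[of "c ` {..k0}" "c k"] by simp
    then show "J k (Suc m) \<subseteq> set_smult R M S (J k m)" by (rule c)
  qed
qed

context
  fixes a S E
  assumes a: "a \<in> carrier R" and S: "S \<subseteq> carrier R"
    and sE: "\<And>n. submodule (E n) R M" and E_smult: "\<And>n. S \<star> E n \<subseteq> E (Suc n)"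
begin

abbreviation "low \<equiv> low_terms R M a E"

lemma pow_smult_Suc: "x \<in> carrier M \<Longrightarrow> (a [^] Suc k) \<bullet> x = a \<bullet> ((a [^] k) \<bullet> x)"
  using a by (metis R.nat_pow_Suc R.m_comm R.nat_pow_closed smult_assoc1)

lemma submodule_pow_smult_image: "submodule ((\<lambda>x. (a [^] (k::nat)) \<bullet> x) ` E n) R M"
  using a by (intro submodule_image[OF module_axioms module_axioms smult_mod_hom sE]) simp

lemma submodule_low: "submodule (low n k) R M"
  by (induction k) (auto intro: submodule_zero submodule_set_add submodule_pow_smult_image)

lemma low_Suc_mono: "low n k \<subseteq> low n (Suc k)"
  using set_add_upper1[OF submodule_low submodule_pow_smult_image] by simp

lemma smult_low_Suc: "x \<in> low n k \<Longrightarrow> a \<bullet> x \<in> low (Suc n) (Suc k)"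
proof (induction k arbitrary: x)
  case 0
  then show ?case using a submoduleD(2)[OF submodule_low[of "Suc n" "Suc 0"]] by simp
next
  case (Suc k)
  have "a \<bullet> z \<in> (\<lambda>x. (a [^] Suc k) \<bullet> x) ` E (n - k)" if "z \<in> (\<lambda>x. (a [^] k) \<bullet> x) ` E (n - k)" for z
    using that pow_smult_Suc submoduleD(1)[OF sE] by (auto simp del: R.nat_pow_Suc)
  then have "a \<bullet> x \<in> low (Suc n) (Suc k) \<uplus> (\<lambda>x. (a [^] Suc k) \<bullet> x) ` E (n - k)"
    using smult_mem_set_add[OF a submodule_low submodule_pow_smult_image] Suc by auto
  then show ?case by simp
qed

lemma smult_low:
  assumes r: "r \<in> S" shows "k \<le> Suc n \<Longrightarrow> x \<in> low n k \<Longrightarrow> r \<bullet> x \<in> low (Suc n) k"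
proof (induction k arbitrary: x)
  case 0
  then show ?case using r S by auto
next
  case (Suc k)
  have rc: "r \<in> carrier R" using r S by auto
  have "r \<bullet> z \<in> (\<lambda>x. (a [^] k) \<bullet> x) ` E (Suc n - k)" if z: "z \<in> (\<lambda>x. (a [^] k) \<bullet> x) ` E (n - k)" for z
  proof -
    obtain y where y: "y \<in> E (n - k)" "z = (a [^] k) \<bullet> y" using z by auto
    have "r \<bullet> y \<in> E (Suc n - k)"
      using set_smult_incl[OF r y(1)] E_smult[of "n - k"] Suc.prems(1) by (auto simp: Suc_diff_le)
    moreover have "r \<bullet> z = (a [^] k) \<bullet> (r \<bullet> y)"
      unfolding y(2) using a rc submoduleD(1)[OF sE y(1)] by (simp add: smult_left_commute)
    ultimately show ?thesis by blast
  qed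
  then have "r \<bullet> x \<in> low (Suc n) k \<uplus> (\<lambda>x. (a [^] k) \<bullet> x) ` E (Suc n - k)"
    using smult_mem_set_add[OF rc submodule_low submodule_pow_smult_image] Suc by auto
  then show ?case by simp
qed

context
  fixes L
  assumes sL: "\<And>n. submodule (L n) R M" and L_smult: "\<And>n. insert a S \<star> L n \<subseteq> L (Suc n)"
begin

abbreviation "lead \<equiv> leading_coeffs R M a E L"

lemma smult_L: "r \<in> insert a S \<Longrightarrow> x \<in> L n \<Longrightarrow> r \<bullet> x \<in> L (Suc n)"
  using L_smult set_smult_incl[of r "insert a S" x "L n"] by blast

lemma submodule_low_add: "submodule W R M \<Longrightarrow> submodule (low n k \<uplus> W) R M"
  by (rule submodule_set_add[OF submodule_low])

lemma submodule_lead: "submodule (lead k m) R M"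
  unfolding leading_coeffs_def using a
  by (intro submodule_Int sE submodule_smult_vimage submodule_low_add sL) simp

lemma lead_subset: "lead k m \<subseteq> E m"
  by (simp add: leading_coeffs_def)

lemma lead_Suc_mono: "lead k m \<subseteq> lead (Suc k) m"
proof
  fix x assume x: "x \<in> lead k m"
  have "a \<bullet> ((a [^] k) \<bullet> x) \<in> low (Suc k + m) (Suc k) \<uplus> L (Suc k + m)"
    by (rule smult_mem_set_add[OF a submodule_low sL, of _ "k + m" k "k + m"])
       (use x smult_low_Suc smult_L in \<open>auto simp: leading_coeffs_def simp del: low_terms.simps\<close>)
  then show "x \<in> lead (Suc k) m"
    using x pow_smult_Suc[of x k] by (simp add: leading_coeffs_def del: R.nat_pow_Suc low_terms.simps)
qed

lemma lead_smult: "S \<star> lead k m \<subseteq> lead k (Suc m)"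
proof (rule set_smult_least[OF submodule_lead])
  fix r x assume r: "r \<in> S" and x: "x \<in> lead k m"
  have rc: "r \<in> carrier R" and xc: "x \<in> carrier M"
    using r S x by (auto simp: leading_coeffs_def)
  have "r \<bullet> ((a [^] k) \<bullet> x) \<in> low (k + Suc m) k \<uplus> L (k + Suc m)"
    by (rule smult_mem_set_add[OF rc submodule_low sL, of _ "k + m" k "k + m"])
       (use x r smult_low smult_L in \<open>auto simp: leading_coeffs_def\<close>)
  moreover have "r \<bullet> x \<in> E (Suc m)"
    using set_smult_incl[OF r, of x "E m"] E_smult lead_subset x by blast
  ultimately show "r \<bullet> x \<in> lead k (Suc m)"
    using a rc xc by (simp add: leading_coeffs_def smult_left_commute)
qed

lemma pow_smult_lead_mem:
  assumes lim: "\<And>k m. lead k m \<subseteq> lead k0 m"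
    and gen: "\<And>k m. k \<le> k0 \<Longrightarrow> m \<ge> c0 \<Longrightarrow> lead k (Suc m) \<subseteq> S \<star> lead k m"
    and n: "n \<ge> k0 + c0" and k: "k \<le> Suc n" and y: "y \<in> lead k (Suc n - k)"
  shows "(a [^] k) \<bullet> y \<in> low (Suc n) k \<uplus> (insert a S \<star> L n)"
proof -
  let ?W = "insert a S \<star> L n"
  have aS: "insert a S \<subseteq> carrier R" using a S by auto
  have W: "submodule ?W R M"
    by (rule submodule_set_smult[OF aS]) (use submoduleD(1)[OF sL] in auto)
  show ?thesis
  proof (cases "k > k0")
    case True
    then obtain j where j: "k = Suc j" "k0 \<le> j" by (cases k) auto
    have mono: "i \<le> i' \<Longrightarrow> lead i m \<subseteq> lead i' m" for i i' m
      by (rule lift_Suc_mono_le[of "\<lambda>k. lead k m"]) (rule lead_Suc_mono)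
    have "y \<in> lead j (Suc n - k)" using lim[of k] mono[OF j(2)] y by blast
    then have y_low: "(a [^] j) \<bullet> y \<in> low n j \<uplus> L n" and "y \<in> carrier M"
      using k j(1) by (auto simp: leading_coeffs_def)
    have "a \<bullet> ((a [^] j) \<bullet> y) \<in> low (Suc n) (Suc j) \<uplus> ?W"
      by (rule smult_mem_set_add[OF a submodule_low sL y_low smult_low_Suc set_smult_incl]) auto
    then show ?thesis unfolding j(1) pow_smult_Suc[OF \<open>y \<in> carrier M\<close>] .
  next
    case False
    define m where "m = n - k"
    have m: "Suc n - k = Suc m" "k + m = n" "m \<ge> c0" using False n by (auto simp: m_def)
    have ak: "a [^] k \<in> carrier R" using a by simp
    have "S \<star> lead k m \<subseteq> {y \<in> carrier M. (a [^] k) \<bullet> y \<in> low (Suc n) k \<uplus> ?W}"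
    proof (rule set_smult_least[OF submodule_smult_vimage[OF submodule_low_add[OF W] ak]])
      fix r x assume r: "r \<in> S" and x: "x \<in> lead k m"
      have rc: "r \<in> carrier R" and xc: "x \<in> carrier M"
        using r S x by (auto simp: leading_coeffs_def)
      have x_low: "(a [^] k) \<bullet> x \<in> low n k \<uplus> L n" using x by (simp add: leading_coeffs_def m(2))
      have "r \<bullet> ((a [^] k) \<bullet> x) \<in> low (Suc n) k \<uplus> ?W"
        by (rule smult_mem_set_add[OF rc submodule_low sL x_low smult_low[OF r k] set_smult_incl]) (use r in auto)
      then show "r \<bullet> x \<in> {y \<in> carrier M. (a [^] k) \<bullet> y \<in> low (Suc n) k \<uplus> ?W}"
        using rc xc ak by (simp add: smult_left_commute)
    qed
    then show ?thesis using gen[of k m] y m False by auto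
  qed
qed

lemma Int_low_terms_subset:
  assumes W: "submodule W R M" "W \<subseteq> L (Suc n)"
    and lead: "\<And>k y. k \<le> Suc n \<Longrightarrow> y \<in> lead k (Suc n - k) \<Longrightarrow> (a [^] k) \<bullet> y \<in> low (Suc n) k \<uplus> W"
  shows "k \<le> Suc (Suc n) \<Longrightarrow> L (Suc n) \<inter> (low (Suc n) k \<uplus> W) \<subseteq> W"
proof (induction k)
  case 0
  then show ?case using submoduleD(1)[OF W(1)] by (auto simp: set_add_iff)
next
  case (Suc k)
  have sW: "submodule (low (Suc n) k \<uplus> W) R M" and sLW: "submodule (low (Suc n) k \<uplus> L (Suc n)) R M"
    by (rule submodule_low_add[OF W(1)], rule submodule_low_add[OF sL])
  show ?case
  proof safe
    fix x assume x: "x \<in> L (Suc n)" "x \<in> low (Suc n) (Suc k) \<uplus> W"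
    then obtain q y w where q: "q \<in> low (Suc n) k" and y: "y \<in> E (Suc n - k)" and w: "w \<in> W"
      and "x = (q \<boxplus> (a [^] k) \<bullet> y) \<boxplus> w"
      by (auto simp: set_add_iff)
    moreover have yc: "y \<in> carrier M" and ayc: "(a [^] k) \<bullet> y \<in> carrier M"
      using submoduleD(1)[OF sE y] a by auto
    moreover have "q \<in> carrier M" "w \<in> carrier M"
      using submoduleD(1)[OF submodule_low q] submoduleD(1)[OF W(1) w] by auto
    ultimately have x_eq: "x = (a [^] k) \<bullet> y \<boxplus> (q \<boxplus> w)" by (simp add: M.a_ac)
    have qw: "q \<boxplus> w \<in> low (Suc n) k \<uplus> W" by (rule set_add_memI[OF q w])
    have "q \<boxplus> w \<in> low (Suc n) k \<uplus> L (Suc n)" using qw set_add_mono[OF order.refl W(2)] by blast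
    moreover have "x \<in> low (Suc n) k \<uplus> L (Suc n)" using x(1) set_add_upper2[OF submodule_low sL] by blast
    ultimately have "(a [^] k) \<bullet> y \<in> low (Suc n) k \<uplus> L (Suc n)"
      using submodule_mem_if_add_mem[OF sLW ayc] x_eq by simp
    then have "y \<in> lead k (Suc n - k)" using y yc Suc.prems by (simp add: leading_coeffs_def)
    then have "(a [^] k) \<bullet> y \<in> low (Suc n) k \<uplus> W" using lead Suc.prems by simp
    then have "x \<in> low (Suc n) k \<uplus> W" unfolding x_eq by (rule submoduleD(3)[OF sW _ qw])
    then show "x \<in> W" using Suc x(1) by auto
  qed
qed

end

text \<open>Hilbert's basis theorem for the variable \<open>a t\<close>: from some degree on, \<open>L\<close> is generated by
  lifting generators of its leading coefficients.\<close>
lemma graded_noetherian_insert: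
  assumes noeth: "noetherian_module R M" and E: "graded_noetherian R M S E"
  shows "graded_noetherian R M (insert a S) (\<lambda>n. low n (Suc n))"
  unfolding graded_noetherian_def
proof (intro allI impI)
  fix L :: "nat \<Rightarrow> 'c set"
  assume "\<forall>n. submodule (L n) R M" and L_low: "\<forall>n. L n \<subseteq> low n (Suc n)"
    and "\<forall>n. insert a S \<star> L n \<subseteq> L (Suc n)"
  then have L: "\<And>n. submodule (L n) R M" "\<And>n. insert a S \<star> L n \<subseteq> L (Suc n)" by auto
  obtain k0 c0 where k0: "\<And>k m. lead L k m \<subseteq> lead L k0 m"
    and c0: "\<And>k m. k \<le> k0 \<Longrightarrow> m \<ge> c0 \<Longrightarrow> lead L k (Suc m) \<subseteq> S \<star> lead L k m"
  proof (rule bigraded_family_stable[OF noeth E, of "lead L"])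
    show "submodule (lead L k m) R M" for k m by (rule submodule_lead) (rule L)+
    show "lead L k m \<subseteq> lead L (Suc k) m" for k m by (rule lead_Suc_mono) (rule L)+
    show "S \<star> lead L k m \<subseteq> lead L k (Suc m)" for k m by (rule lead_smult) (rule L)+
    show "lead L k m \<subseteq> E m" for k m by (rule lead_subset) (rule L)+
  qed (rule that)
  have "L (Suc n) \<subseteq> insert a S \<star> L n" if n: "n \<ge> k0 + c0" for n
  proof -
    have W: "submodule (insert a S \<star> L n) R M"
      by (rule submodule_set_smult) (use a S submoduleD(1)[OF L(1)] in auto)
    have "L (Suc n) \<inter> (low (Suc n) (Suc (Suc n)) \<uplus> (insert a S \<star> L n)) \<subseteq> insert a S \<star> L n"
    proof (rule Int_low_terms_subset[of L, OF L W L(2)])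
      show "(a [^] k) \<bullet> y \<in> low (Suc n) k \<uplus> (insert a S \<star> L n)"
        if "k \<le> Suc n" "y \<in> lead L k (Suc n - k)" for k y
        by (rule pow_smult_lead_mem[of L, OF L k0 c0 n that])
    qed simp
    moreover have "L (Suc n) \<subseteq> low (Suc n) (Suc (Suc n)) \<uplus> (insert a S \<star> L n)"
      using L_low set_add_upper1[OF submodule_low W] by blast
    ultimately show ?thesis by blast
  qed
  then show "\<exists>c. \<forall>n\<ge>c. L (Suc n) \<subseteq> insert a S \<star> L n" by blast
qed

end

lemma adic_insert_subset_low_terms:
  assumes a: "a \<in> carrier R" and S: "S \<subseteq> carrier R"
  shows "adic (Idl (insert a S)) n \<subseteq> low_terms R M a (adic (Idl S)) n (Suc n)"
proof -
  let ?E = "adic (Idl S)" and ?low = "low_terms R M a (adic (Idl S))"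
  have aS: "insert a S \<subseteq> carrier R" using a S by auto
  note IS = R.genideal_ideal[OF S] and IaS = R.genideal_ideal[OF aS]
  have smult_adic: "S \<star> ?E n \<subseteq> ?E (Suc n)" for n
    using set_smult_Idl[OF S adic_subset_carrier[OF IS]] adic_Suc[OF IS] by blast
  note S_adic = a S submodule_adic[OF IS] smult_adic
  show ?thesis
  proof (induction n)
    case 0
    have "x \<in> (\<lambda>x. (a [^] (0::nat)) \<bullet> x) ` ?E 0" if "x \<in> carrier M" for x
      by (rule image_eqI[of _ _ x]) (use that in \<open>auto simp: adic_0 simp del: ideal_pow.simps\<close>)
    then have "adic (Idl (insert a S)) 0 \<subseteq> (\<lambda>x. (a [^] (0::nat)) \<bullet> x) ` ?E 0"
      using adic_subset_carrier[OF IaS] by blast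
    also have "\<dots> \<subseteq> ?low 0 (Suc 0)"
      using set_add_upper2[OF submodule_zero submodule_pow_smult_image[of a S ?E, OF S_adic, of 0 0]]
      by (simp del: ideal_pow.simps)
    finally show ?case .
  next
    case (Suc n)
    have "insert a S \<star> adic (Idl (insert a S)) n \<subseteq> ?low (Suc n) (Suc (Suc n))"
    proof (rule set_smult_least[OF submodule_low[of a S ?E, OF S_adic]])
      fix r x assume r: "r \<in> insert a S" and "x \<in> adic (Idl (insert a S)) n"
      then have x: "x \<in> ?low n (Suc n)" using Suc by blast
      have "r \<bullet> x \<in> ?low (Suc n) (Suc n)" if "r \<in> S"
        by (rule smult_low[of a S ?E, OF S_adic that order.refl x])
      then have "r \<bullet> x \<in> ?low (Suc n) (Suc (Suc n))" if "r \<in> S"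
        using low_Suc_mono[of a S ?E, OF S_adic] that by blast
      moreover have "a \<bullet> x \<in> ?low (Suc n) (Suc (Suc n))"
        by (rule smult_low_Suc[of a S ?E, OF S_adic x])
      ultimately show "r \<bullet> x \<in> ?low (Suc n) (Suc (Suc n))"
        using r by (auto simp del: low_terms.simps)
    qed
    then show ?case
      unfolding adic_Suc[OF IaS] set_smult_Idl[OF aS adic_subset_carrier[OF IaS]] .
  qed
qed

lemma graded_noetherian_adic:
  assumes noeth: "noetherian_module R M" and "finite S"
  shows "S \<subseteq> carrier R \<Longrightarrow> graded_noetherian R M S (adic (Idl S))"
  using assms(2)
proof (induction S rule: finite_induct)
  case empty
  have I: "ideal (Idl {}) R" by (rule R.genideal_ideal) simp
  have "adic (Idl {}) (Suc n) = {} \<star> adic (Idl {}) n" for n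
    using set_smult_Idl[OF _ adic_subset_carrier[OF I], of "{}"] adic_Suc[OF I] by simp
  then have "adic (Idl {}) (Suc n) \<subseteq> {} \<star> N" for n N
    by (simp add: set_smult_def del: ideal_pow.simps)
  then show ?case unfolding graded_noetherian_def by (meson order_trans)
next
  case (insert a S)
  then have a: "a \<in> carrier R" and S: "S \<subseteq> carrier R" by auto
  note IS = R.genideal_ideal[OF S]
  have smult_adic: "S \<star> adic (Idl S) n \<subseteq> adic (Idl S) (Suc n)" for n
    using set_smult_Idl[OF S adic_subset_carrier[OF IS]] adic_Suc[OF IS] by blast
  have "graded_noetherian R M (insert a S) (\<lambda>n. low_terms R M a (adic (Idl S)) n (Suc n))"
    by (rule graded_noetherian_insert[of a S, OF a S submodule_adic[OF IS] smult_adic noeth insert.IH[OF S]])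
  then show ?case by (rule graded_noetherian_antimono) (rule adic_insert_subset_low_terms[OF a S])
qed

lemma graded_submodule_stable:
  assumes "noetherian_ring R" and I: "ideal I R" and noeth: "noetherian_module R M"
    and sL: "\<And>n. submodule (L n) R M" and L_adic: "\<And>n. L n \<subseteq> adic I n"
    and L_smult: "\<And>n. I \<star> L n \<subseteq> L (Suc n)"
  obtains c where "\<And>n. n \<ge> c \<Longrightarrow> L (Suc n) \<subseteq> I \<star> L n"
proof -
  obtain S where S: "S \<subseteq> carrier R" "finite S" "I = Idl S"
    using noetherian_ring.finetely_gen[OF assms(1) I] by blast
  have "S \<star> L n = I \<star> L n" for n
    using set_smult_Idl[OF S(1), of "L n"] submoduleD(1)[OF sL] S(3) by blast
  then obtain c where "\<And>n. n \<ge> c \<Longrightarrow> L (Suc n) \<subseteq> I \<star> L n"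
    using graded_noetherianD[OF graded_noetherian_adic[OF noeth S(2,1)], of L] sL L_adic L_smult S(3)
    by metis
  then show ?thesis by (rule that)
qed

section \<open>Artin--Rees and Ratliff--Rush\<close>

lemma artin_rees:
  assumes "noetherian_ring R" and I: "ideal I R" and noeth: "noetherian_module R M"
    and N: "submodule N R M"
  obtains c where "\<And>m. adic I (c + m) \<inter> N \<subseteq> ideal_pow R I m \<star> N"
proof -
  have Nc: "N \<subseteq> carrier M" using submoduleD(1)[OF N] by blast
  have "I \<star> (adic I n \<inter> N) \<subseteq> adic I (Suc n) \<inter> N" for n
    using set_smult_mono[OF order.refl, of "adic I n \<inter> N" _ I] set_smult_subset[OF N ideal_subset_carrier[OF I]]
    unfolding adic_Suc[OF I] by blast
  then obtain c where c: "\<And>n. n \<ge> c \<Longrightarrow> adic I (Suc n) \<inter> N \<subseteq> I \<star> (adic I n \<inter> N)"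
    by (rule graded_submodule_stable[OF assms(1) I noeth, of "\<lambda>n. adic I n \<inter> N", rotated 2])
       (auto intro: submodule_Int submodule_adic I N that)
  show ?thesis
  proof (rule that[of c])
    fix m show "adic I (c + m) \<inter> N \<subseteq> ideal_pow R I m \<star> N"
    proof (induction m)
      case 0
      then show ?case by (simp add: carrier_set_smult[OF N])
    next
      case (Suc m)
      have "adic I (c + Suc m) \<inter> N \<subseteq> I \<star> (adic I (c + m) \<inter> N)" using c[of "c + m"] by simp
      also have "\<dots> \<subseteq> I \<star> (ideal_pow R I m \<star> N)" by (rule set_smult_mono[OF order.refl Suc])
      also have "\<dots> = ideal_pow R I (Suc m) \<star> N"
        by (simp add: ideal_prod_set_smult[OF I R.ideal_pow_is_ideal[OF I] Nc])
      finally show ?case .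
    qed
  qed
qed

lemma smult_cancel_adic:
  assumes "noetherian_ring R" and I: "ideal I R" and noeth: "noetherian_module R M"
    and a: "a \<in> carrier R" and inj: "inj_on ((\<bullet>) a) (carrier M)"
  obtains c where "\<And>m x. x \<in> carrier M \<Longrightarrow> a \<bullet> x \<in> adic I (c + m) \<Longrightarrow> x \<in> adic I m"
proof -
  have aM: "submodule ((\<bullet>) a ` carrier M) R M"
    by (rule submodule_image[OF module_axioms module_axioms smult_mod_hom[OF a] carrier_is_submodule])
  have pow_aM: "ideal_pow R I m \<star> ((\<bullet>) a ` carrier M) = (\<bullet>) a ` adic I m" for m
    unfolding ideal_smult_eq_set_smult
    by (rule mod_hom_image_set_smult[OF module_axioms module_axioms smult_mod_hom[OF a]
          R.ideal_pow_subset_carrier[OF I] order.refl, symmetric])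
  obtain c where c: "\<And>m. adic I (c + m) \<inter> (\<bullet>) a ` carrier M \<subseteq> ideal_pow R I m \<star> ((\<bullet>) a ` carrier M)"
    by (rule artin_rees[OF assms(1) I noeth aM]) (rule that)
  show ?thesis
  proof (rule that[of c])
    fix m x assume x: "x \<in> carrier M" and "a \<bullet> x \<in> adic I (c + m)"
    then obtain y where y: "y \<in> adic I m" "a \<bullet> x = a \<bullet> y" using c[of m] pow_aM by blast
    then show "x \<in> adic I m" using inj x submoduleD(1)[OF submodule_adic[OF I]] by (auto dest: inj_onD)
  qed
qed

end

definition module_colon :: "('r,'c) ring_scheme \<Rightarrow> ('r,'a,'d) module_scheme \<Rightarrow> 'a set \<Rightarrow> 'r set \<Rightarrow> 'a set"
  where "module_colon R M N S = {x \<in> carrier M. \<forall>r\<in>S. r \<odot>\<^bsub>M\<^esub> x \<in> N}"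

context module
begin

lemma submodule_module_colon:
  assumes "submodule N R M" "S \<subseteq> carrier R"
  shows "submodule (module_colon R M N S) R M"
proof -
  have "module_colon R M N S = \<Inter>(insert (carrier M) ((\<lambda>r. {x \<in> carrier M. r \<bullet> x \<in> N}) ` S))"
    by (auto simp: module_colon_def)
  also have "submodule \<dots> R M"
    by (rule submodule_Inter)
       (use assms carrier_is_submodule submodule_smult_vimage[OF assms(1)] in auto)
  finally show ?thesis .
qed

lemma adic_colon_stable:
  assumes noethR: "noetherian_ring R" and I: "ideal I R" and noeth: "noetherian_module R M"
    and a: "a \<in> I" and inj: "inj_on ((\<bullet>) a) (carrier M)"
  obtains N where "\<And>n. n \<ge> N \<Longrightarrow> module_colon R M (adic I (Suc n)) I \<subseteq> adic I n"
proof -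
  interpret I: ideal I R by fact
  note sA = submodule_adic[OF I]
  obtain c where c: "\<And>m x. x \<in> carrier M \<Longrightarrow> a \<bullet> x \<in> adic I (c + m) \<Longrightarrow> x \<in> adic I m"
    by (rule smult_cancel_adic[OF noethR I noeth I.Icarr[OF a] inj]) (rule that)
  define L where "L n = adic I n \<inter> module_colon R M (adic I (Suc (n + c))) I" for n
  have sL: "submodule (L n) R M" for n
    unfolding L_def by (intro submodule_Int sA submodule_module_colon I.a_subset)
  obtain N where N: "\<And>n. n \<ge> N \<Longrightarrow> L (Suc n) \<subseteq> I \<star> L n"
  proof (rule graded_submodule_stable[OF noethR I noeth sL])
    show "I \<star> L n \<subseteq> L (Suc n)" for n
    proof (rule set_smult_least[OF sL])
      fix r x assume r: "r \<in> I" and x: "x \<in> L n"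
      then have xc: "x \<in> carrier M" by (simp add: L_def module_colon_def)
      have "b \<bullet> (r \<bullet> x) \<in> adic I (Suc (Suc n + c))" if b: "b \<in> I" for b
        using smult_mem_adic_Suc[OF I r, of "b \<bullet> x" "Suc (n + c)"] x b
          smult_left_commute[OF I.Icarr[OF b] I.Icarr[OF r] xc] by (simp add: L_def module_colon_def)
      then show "r \<bullet> x \<in> L (Suc n)"
        using smult_mem_adic_Suc[OF I r] x xc I.Icarr[OF r] by (simp add: L_def module_colon_def)
    qed
  qed (auto simp: L_def that)
  show ?thesis
  proof (rule that[of "Suc (N + c)"], rule subsetI)
    fix n x assume n: "n \<ge> Suc (N + c)" and x: "x \<in> module_colon R M (adic I (Suc n)) I"
    define k where "k = n - Suc c"
    have k: "n = Suc (k + c)" "k \<ge> N" using n by (auto simp: k_def)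
    have "x \<in> adic I (Suc (Suc k))"
      by (rule c) (use x a k(1) in \<open>auto simp: module_colon_def add.commute\<close>)
    then have "x \<in> adic I (Suc k)" using adic_Suc_subset[OF I] by blast
    then have "x \<in> L (Suc k)" using x k(1) by (simp add: L_def)
    then have "x \<in> I \<star> L k" using N[OF k(2)] by blast
    moreover have "I \<star> L k \<subseteq> adic I n"
      unfolding k(1) by (rule set_smult_least[OF sA]) (simp add: L_def module_colon_def)
    ultimately show "x \<in> adic I n" by blast
  qed
qed

lemma adic_colon_pow_stable:
  assumes "noetherian_ring R" and I: "ideal I R" and "noetherian_module R M"
    and "a \<in> I" and "inj_on ((\<bullet>) a) (carrier M)"
  obtains N where "\<And>n m. n \<ge> N \<Longrightarrow> module_colon R M (adic I (n + m)) (ideal_pow R I m) \<subseteq> adic I n"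
proof -
  interpret I: ideal I R by fact
  obtain N where N: "\<And>n. n \<ge> N \<Longrightarrow> module_colon R M (adic I (Suc n)) I \<subseteq> adic I n"
    by (rule adic_colon_stable[OF assms]) (rule that)
  have "module_colon R M (adic I (n + m)) (ideal_pow R I m) \<subseteq> adic I n" if "n \<ge> N" for n m
    using that
  proof (induction m arbitrary: n)
    case 0
    then show ?case by (auto simp: module_colon_def dest: bspec[OF _ R.one_closed])
  next
    case (Suc m)
    show ?case
    proof
      fix x assume x: "x \<in> module_colon R M (adic I (n + Suc m)) (ideal_pow R I (Suc m))"
      then have xc: "x \<in> carrier M" by (simp add: module_colon_def)
      have "b \<bullet> x \<in> adic I (Suc n)" if b: "b \<in> I" for b
      proof -
        have "p \<bullet> (b \<bullet> x) \<in> adic I (Suc n + m)" if p: "p \<in> ideal_pow R I m" for p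
        proof -
          have pc: "p \<in> carrier R" by (rule ideal.Icarr[OF R.ideal_pow_is_ideal[OF I] p])
          have "(b \<otimes> p) \<bullet> x \<in> adic I (n + Suc m)"
            using x ideal_prod.prod[OF b p, of R] by (simp add: module_colon_def)
          then show ?thesis using smult_assoc1[OF pc I.Icarr[OF b] xc] R.m_comm[OF pc I.Icarr[OF b]] by simp
        qed
        then have "b \<bullet> x \<in> module_colon R M (adic I (Suc n + m)) (ideal_pow R I m)"
          using I.Icarr[OF b] xc by (simp add: module_colon_def)
        then show ?thesis using Suc.IH[of "Suc n"] Suc.prems by auto
      qed
      then show "x \<in> adic I n" using N[OF Suc.prems] xc by (auto simp: module_colon_def)
    qed
  qed
  then show ?thesis by (rule that)
qed

end

section \<open>Quotient modules\<close>

lemma mod_hom_factor: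
  assumes mM: "module R M" and mN: "module R N" and mL: "module R L"
    and p: "p \<in> mod_hom R M N" and surj: "p ` carrier M = carrier N" and f: "f \<in> mod_hom R M L"
    and ker: "\<And>x. x \<in> carrier M \<Longrightarrow> p x = \<zero>\<^bsub>N\<^esub> \<Longrightarrow> f x = \<zero>\<^bsub>L\<^esub>"
  obtains h where "h \<in> mod_hom R N L" "\<And>x. x \<in> carrier M \<Longrightarrow> h (p x) = f x"
proof -
  interpret M: module R M by fact
  interpret N: module R N by fact
  interpret L: module R L by fact
  define h where "h y = f (inv_into (carrier M) p y)" for y
  have h: "h (p x) = f x" if x: "x \<in> carrier M" for x
  proof -
    define y where "y = inv_into (carrier M) p (p x)"
    have y: "y \<in> carrier M" "p y = p x"
      unfolding y_def using x by (auto intro: inv_into_into f_inv_into_f)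
    have "f (y \<ominus>\<^bsub>M\<^esub> x) = \<zero>\<^bsub>L\<^esub>"
      using x y mod_homD(1)[OF p x] by (intro ker) (simp_all add: mod_hom_diff[OF mM mN p] N.a_diff_eq_zero_iff)
    then show ?thesis
      using x y(1) mod_homD(1)[OF f] unfolding h_def y_def[symmetric]
      by (simp add: mod_hom_diff[OF mM mL f] L.a_diff_eq_zero_iff)
  qed
  show ?thesis
  proof (rule that[OF _ h])
    show "h \<in> mod_hom R N L"
    proof (rule mod_homI; unfold surj[symmetric])
    qed (auto simp: h mod_homD[OF f] simp flip: mod_homD(2,3)[OF p])
  qed
qed

context module
begin

context
  fixes N assumes N: "submodule N R M"
begin

interpretation N: abelian_subgroup N M
  by (rule abelian_subgroupI3[OF additive_subgroupI[OF submodule.axioms(1)[OF N]] M.abelian_group_axioms])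

lemma coset_mem_iff:
  assumes "x \<in> carrier M" "y \<in> carrier M"
  shows "y \<in> N +>\<^bsub>M\<^esub> x \<longleftrightarrow> y \<ominus>\<^bsub>M\<^esub> x \<in> N"
  using N.a_rcos_module[OF assms] by (simp add: a_minus_def)

lemma coset_self: "x \<in> carrier M \<Longrightarrow> x \<in> N +>\<^bsub>M\<^esub> x"
  by (rule N.a_rcos_self)

lemma coset_subset_carrier: "x \<in> carrier M \<Longrightarrow> N +>\<^bsub>M\<^esub> x \<subseteq> carrier M"
  using N.a_elemrcos_carrier by blast

lemma coset_eq_iff:
  assumes "x \<in> carrier M" "y \<in> carrier M"
  shows "N +>\<^bsub>M\<^esub> x = N +>\<^bsub>M\<^esub> y \<longleftrightarrow> x \<ominus>\<^bsub>M\<^esub> y \<in> N"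
  using coset_mem_iff[OF assms(2,1)] coset_self[OF assms(1)] N.a_repr_independence'[of x y] assms
  by auto

lemma coset_eq_self_iff:
  assumes "x \<in> carrier M"
  shows "N +>\<^bsub>M\<^esub> x = N \<longleftrightarrow> x \<in> N"
  using coset_self[OF assms] N.a_rcos_const by auto

lemma quot_module_carrier: "carrier (quot_module R M N) = (\<lambda>x. N +>\<^bsub>M\<^esub> x) ` carrier M"
  by (auto simp: quot_module_def A_RCOSETS_def')

lemma quot_module_zero: "\<zero>\<^bsub>quot_module R M N\<^esub> = N"
  by (simp add: quot_module_def)

lemma quot_module_add:
  "x \<in> carrier M \<Longrightarrow> y \<in> carrier M \<Longrightarrow>
     (N +>\<^bsub>M\<^esub> x) \<oplus>\<^bsub>quot_module R M N\<^esub> (N +>\<^bsub>M\<^esub> y) = N +>\<^bsub>M\<^esub> (x \<boxplus> y)"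
  by (simp add: quot_module_def N.a_rcos_sum)

lemma quot_module_smult:
  assumes "r \<in> carrier R" "x \<in> carrier M"
  shows "r \<odot>\<^bsub>quot_module R M N\<^esub> (N +>\<^bsub>M\<^esub> x) = N +>\<^bsub>M\<^esub> (r \<bullet> x)"
proof -
  have "N +>\<^bsub>M\<^esub> (r \<bullet> y) = N +>\<^bsub>M\<^esub> (r \<bullet> x)" if y: "y \<in> N +>\<^bsub>M\<^esub> x" for y
  proof -
    have yc: "y \<in> carrier M" using coset_subset_carrier[OF assms(2)] y by blast
    have "r \<bullet> (y \<ominus>\<^bsub>M\<^esub> x) \<in> N"
      using y coset_mem_iff[OF assms(2) yc] submoduleD(6)[OF N assms(1)] by simp
    then show ?thesis using assms yc by (simp add: coset_eq_iff smult_r_diff)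
  qed
  then have "(\<Union>m\<in>N +>\<^bsub>M\<^esub> x. N +>\<^bsub>M\<^esub> (r \<bullet> m)) = N +>\<^bsub>M\<^esub> (r \<bullet> x)"
    using coset_self[OF assms(2)] by blast
  then show ?thesis by (simp add: quot_module_def)
qed

lemma quot_module_is_module: "module R (quot_module R M N)"
proof (rule moduleI)
  let ?Q = "quot_module R M N"
  show "cring R" by (rule R.is_cring)
  note quot_module_ops = quot_module_add quot_module_smult
  have coset_zero: "N +>\<^bsub>M\<^esub> \<zero>\<^bsub>M\<^esub> = \<zero>\<^bsub>?Q\<^esub>"
    by (simp add: coset_eq_self_iff submoduleD(2)[OF N] quot_module_zero)
  then have zero_closed: "\<zero>\<^bsub>?Q\<^esub> \<in> (\<lambda>x. N +>\<^bsub>M\<^esub> x) ` carrier M"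
    by (metis M.zero_closed image_eqI)
  show "abelian_group ?Q"
  proof (rule abelian_groupI)
    fix x assume "x \<in> carrier ?Q"
    then obtain a where a: "a \<in> carrier M" "x = N +>\<^bsub>M\<^esub> a" by (auto simp: quot_module_carrier)
    show "\<zero>\<^bsub>?Q\<^esub> \<oplus>\<^bsub>?Q\<^esub> x = x"
      using a by (simp add: quot_module_add flip: coset_zero)
    have "(N +>\<^bsub>M\<^esub> \<ominus>\<^bsub>M\<^esub> a) \<oplus>\<^bsub>?Q\<^esub> x = \<zero>\<^bsub>?Q\<^esub>"
      using a by (simp add: quot_module_add M.l_neg coset_zero)
    then show "\<exists>y\<in>carrier ?Q. y \<oplus>\<^bsub>?Q\<^esub> x = \<zero>\<^bsub>?Q\<^esub>"
      using a by (auto simp: quot_module_carrier)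
  qed (auto simp: quot_module_carrier quot_module_ops M.a_ac zero_closed)
qed (auto simp: quot_module_carrier quot_module_add quot_module_smult smult_l_distr smult_r_distr smult_assoc1)

lemma quot_proj_hom: "(\<lambda>x. N +>\<^bsub>M\<^esub> x) \<in> mod_hom R M (quot_module R M N)"
  by (rule mod_homI) (auto simp: quot_module_carrier quot_module_add quot_module_smult)

lemma quot_proj_eq_zero_iff:
  "x \<in> carrier M \<Longrightarrow> N +>\<^bsub>M\<^esub> x = \<zero>\<^bsub>quot_module R M N\<^esub> \<longleftrightarrow> x \<in> N"
  by (simp add: quot_module_zero coset_eq_self_iff)

lemma quot_lift:
  assumes L: "module R L" and f: "f \<in> mod_hom R M L" and fN: "\<And>x. x \<in> N \<Longrightarrow> f x = \<zero>\<^bsub>L\<^esub>"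
  obtains h where "h \<in> mod_hom R (quot_module R M N) L"
    "\<And>x. x \<in> carrier M \<Longrightarrow> h (N +>\<^bsub>M\<^esub> x) = f x"
  by (rule mod_hom_factor[OF module_axioms quot_module_is_module L quot_proj_hom quot_module_carrier[symmetric] f])
     (use fN in \<open>auto simp: quot_proj_eq_zero_iff\<close>)

end

end

lemma Ass_quot_submodule:
  assumes mM: "module R M" and sK: "submodule K R M" and sN: "submodule N R M" and NK: "N \<subseteq> K"
  shows "Ass R (quot_module R (M\<lparr>carrier := K\<rparr>) N) = {P. primeideal P R \<and> (\<exists>x\<in>K. P = ann_mod R M N x)}"
proof -
  interpret M: module R M by fact
  let ?K = "M\<lparr>carrier := K\<rparr>"
  have mK: "module R ?K" by (rule submodule.submodule_is_module[OF sK mM])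
  interpret K: module R ?K by (rule mK)
  have sN': "submodule N R ?K"
  proof (rule K.submoduleI)
    show "\<ominus>\<^bsub>?K\<^esub> x \<in> N" if x: "x \<in> N" for x
    proof -
      have "\<ominus>\<^bsub>?K\<^esub> x = (\<ominus>\<^bsub>R\<^esub> \<one>\<^bsub>R\<^esub>) \<odot>\<^bsub>?K\<^esub> x"
        using K.smult_l_minus[of "\<one>\<^bsub>R\<^esub>" x] K.smult_one[of x] x NK by auto
      then show ?thesis using M.submoduleD(6)[OF sN, of "\<ominus>\<^bsub>R\<^esub> \<one>\<^bsub>R\<^esub>" x] x by simp
    qed
  qed (use NK M.submoduleD[OF sN] in auto)
  have "ann_elem R (quot_module R ?K N) (N +>\<^bsub>?K\<^esub> x) = ann_mod R M N x" if x: "x \<in> K" for x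
  proof -
    have "r \<odot>\<^bsub>quot_module R ?K N\<^esub> (N +>\<^bsub>?K\<^esub> x) = \<zero>\<^bsub>quot_module R ?K N\<^esub> \<longleftrightarrow> r \<odot>\<^bsub>M\<^esub> x \<in> N"
      if r: "r \<in> carrier R" for r
      using K.quot_module_smult[OF sN' r, of x] K.quot_proj_eq_zero_iff[OF sN', of "r \<odot>\<^bsub>?K\<^esub> x"]
        K.smult_closed[OF r, of x] x by simp
    then show ?thesis by (auto simp: ann_elem_def ann_mod_def)
  qed
  moreover have "carrier (quot_module R ?K N) = (\<lambda>x. N +>\<^bsub>?K\<^esub> x) ` K"
    using K.quot_module_carrier[OF sN'] by simp
  ultimately show ?thesis unfolding Ass_def by auto
qed

lemma Ass_quot_preimage:
  assumes mM: "module R M" and mL: "module R L" and f: "f \<in> mod_hom R M L"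
    and surj: "f ` carrier M = carrier L"
    and sK: "submodule K R L" and sN: "submodule N R L" and NK: "N \<subseteq> K"
  shows "Ass R (quot_module R (M\<lparr>carrier := {x \<in> carrier M. f x \<in> K}\<rparr>) {x \<in> carrier M. f x \<in> N}) =
    Ass R (quot_module R (L\<lparr>carrier := K\<rparr>) N)"
proof -
  interpret M: module R M by fact
  have ann: "ann_mod R M {x \<in> carrier M. f x \<in> N} x = ann_mod R L N (f x)" if "x \<in> carrier M" for x
    using that by (auto simp: ann_mod_def mod_homD(3)[OF f])
  have "(\<exists>x\<in>{x \<in> carrier M. f x \<in> K}. P = ann_mod R M {x \<in> carrier M. f x \<in> N} x) \<longleftrightarrow>
      (\<exists>y\<in>K. P = ann_mod R L N y)" for P
    using ann module.submoduleD(1)[OF mL sK] surj by (auto simp: image_iff set_eq_iff) metis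
  then show ?thesis
    using NK Ass_quot_submodule[OF mL sK sN NK]
      Ass_quot_submodule[OF mM submodule_preimage[OF mM mL f sK] submodule_preimage[OF mM mL f sN]]
    by auto
qed

section \<open>Local comparison of filtrations\<close>

text \<open>\<open>M \<inter> N\<^sub>P\<close>, the preimage in \<open>M\<close> of the localization of \<open>N\<close> at \<open>P\<close>.\<close>
definition saturation :: "('r,'c) ring_scheme \<Rightarrow> ('r,'a,'d) module_scheme \<Rightarrow> 'r set \<Rightarrow> 'a set \<Rightarrow> 'a set"
  where "saturation R M P N = {x \<in> carrier M. \<exists>s\<in>carrier R - P. s \<odot>\<^bsub>M\<^esub> x \<in> N}"

context module
begin

abbreviation "torsion \<equiv> saturation R M {\<zero>} {\<zero>\<^bsub>M\<^esub>}"

lemma saturation_mono: "N \<subseteq> N' \<Longrightarrow> saturation R M P N \<subseteq> saturation R M P N'"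
  by (auto simp: saturation_def)

context
  fixes P assumes P: "primeideal P R"
begin

lemma submodule_saturation:
  assumes "submodule N R M"
  shows "submodule (saturation R M P N) R M"
proof (rule submoduleI)
  note N = submoduleD[OF assms]
  show "\<zero>\<^bsub>M\<^esub> \<in> saturation R M P N"
    using N(2) R.primeideal_one_notin[OF P] by (auto simp: saturation_def intro!: bexI[of _ \<one>])
  show "\<ominus>\<^bsub>M\<^esub> x \<in> saturation R M P N" if "x \<in> saturation R M P N" for x
    using that N(4) by (auto simp: saturation_def smult_r_minus)
  show "x \<boxplus> y \<in> saturation R M P N"
    if x: "x \<in> saturation R M P N" and y: "y \<in> saturation R M P N" for x y
  proof -
    have c: "x \<in> carrier M" "y \<in> carrier M" using x y by (auto simp: saturation_def)
    obtain s where s: "s \<in> carrier R - P" "s \<bullet> x \<in> N" using x by (auto simp: saturation_def)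
    obtain t where t: "t \<in> carrier R - P" "t \<bullet> y \<in> N" using y by (auto simp: saturation_def)
    have "(s \<otimes> t) \<bullet> (x \<boxplus> y) = t \<bullet> (s \<bullet> x) \<boxplus> s \<bullet> (t \<bullet> y)"
      using s t c by (simp add: smult_r_distr smult_assoc1 smult_left_commute[of s t])
    also have "\<dots> \<in> N" using s t by (intro N(3)[OF N(6)[OF _ s(2)] N(6)[OF _ t(2)]]) auto
    finally show ?thesis
      using R.primeideal_mult_notin[OF P s(1) t(1)] c by (auto simp: saturation_def)
  qed
  show "r \<bullet> x \<in> saturation R M P N" if "r \<in> carrier R" "x \<in> saturation R M P N" for r x
    using that N(6) by (auto simp: saturation_def smult_left_commute[of _ r])
qed (auto simp: saturation_def)

lemma subset_saturation:
  assumes "submodule N R M"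
  shows "N \<subseteq> saturation R M P N"
  using submoduleD(1)[OF assms] R.primeideal_one_notin[OF P]
  by (auto simp: saturation_def intro!: bexI[of _ \<one>])

lemma saturation_smult_memD:
  assumes "s \<in> carrier R - P" "x \<in> carrier M" "s \<bullet> x \<in> saturation R M P N"
  shows "x \<in> saturation R M P N"
proof -
  obtain t where t: "t \<in> carrier R - P" "t \<bullet> (s \<bullet> x) \<in> N" using assms(3) by (auto simp: saturation_def)
  then have "(t \<otimes> s) \<bullet> x \<in> N" using assms(1,2) by (simp add: smult_assoc1)
  then show ?thesis using R.primeideal_mult_notin[OF P t(1) assms(1)] assms(2) by (auto simp: saturation_def)
qed

text \<open>A maximal element among the \<open>(N : s)\<close> with \<open>s \<notin> P\<close> contains all of them.\<close>
lemma saturation_eq_smult_vimage: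
  assumes "noetherian_module R M" and N: "submodule N R M"
  obtains s where "s \<in> carrier R - P" "saturation R M P N = {x \<in> carrier M. s \<bullet> x \<in> N}"
proof -
  define V where "V s = {x \<in> carrier M. s \<bullet> x \<in> N}" for s
  have "V ` (carrier R - P) \<noteq> {}" using R.primeideal_one_notin[OF P] by auto
  then obtain s where s: "s \<in> carrier R - P"
    and max: "\<And>N'. N' \<in> V ` (carrier R - P) \<Longrightarrow> V s \<subseteq> N' \<Longrightarrow> N' = V s"
    by (rule noetherian_module_maximal[OF assms(1)])
       (use submodule_smult_vimage[OF N] in \<open>auto simp: V_def\<close>)
  have "V t \<subseteq> V s" if t: "t \<in> carrier R - P" for t
  proof -
    have "V t \<subseteq> V (s \<otimes> t)"
      using s t submoduleD(6)[OF N] by (auto simp: V_def smult_assoc1)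
    moreover have "V s \<subseteq> V (s \<otimes> t)"
      using s t submoduleD(6)[OF N] by (auto simp: V_def smult_assoc1 smult_left_commute[of s t])
    ultimately show ?thesis using max[of "V (s \<otimes> t)"] R.primeideal_mult_notin[OF P s t] by blast
  qed
  then have "saturation R M P N = V s" using s by (auto simp: saturation_def V_def)
  then show ?thesis using that s unfolding V_def by blast
qed

end

end

context module
begin

lemma quot_torsion_smult_inj:
  assumes "domain R" and a: "a \<in> carrier R" "a \<noteq> \<zero>"
  defines "Q \<equiv> quot_module R M torsion"
  shows "inj_on ((\<odot>\<^bsub>Q\<^esub>) a) (carrier Q)"
proof (rule inj_onI)
  interpret domain R by fact
  note sT = submodule_saturation[OF zeroprimeideal submodule_zero]
  note coset_eq_iff = coset_eq_iff[OF sT]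
  fix z w assume zw: "z \<in> carrier Q" "w \<in> carrier Q" and azw: "a \<odot>\<^bsub>Q\<^esub> z = a \<odot>\<^bsub>Q\<^esub> w"
  obtain x y where xy: "x \<in> carrier M" "y \<in> carrier M" "z = torsion +>\<^bsub>M\<^esub> x" "w = torsion +>\<^bsub>M\<^esub> y"
    using zw unfolding Q_def quot_module_carrier[OF sT] by blast
  have "a \<bullet> (x \<ominus>\<^bsub>M\<^esub> y) \<in> torsion"
    using azw xy a(1) by (simp add: Q_def quot_module_smult[OF sT] coset_eq_iff smult_r_diff)
  then have "x \<ominus>\<^bsub>M\<^esub> y \<in> torsion"
    by (rule saturation_smult_memD[OF zeroprimeideal, rotated 2]) (use a xy in auto)
  then show "z = w" using coset_eq_iff xy by simp
qed

lemma adic_colon_pow_subset_torsion: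
  assumes "noetherian_domain R" and noeth: "noetherian_module R M" and I: "ideal I R" "I \<noteq> {\<zero>}"
  obtains N where "\<And>n m. n \<ge> N \<Longrightarrow>
    module_colon R M (adic I (n + m)) (ideal_pow R I m) \<subseteq> adic I n \<uplus> torsion"
proof -
  interpret noetherian_domain R by fact
  interpret I: ideal I R by fact
  obtain a where a: "a \<in> I" "a \<noteq> \<zero>" using I(2) I.zero_closed by blast
  note sT = submodule_saturation[OF zeroprimeideal submodule_zero]
  define Q where "Q = quot_module R M torsion"
  define p where "p x = torsion +>\<^bsub>M\<^esub> x" for x
  have mQ: "module R Q" unfolding Q_def by (rule quot_module_is_module[OF sT])
  have p: "p \<in> mod_hom R M Q" unfolding Q_def p_def by (rule quot_proj_hom[OF sT])
  have surj: "p ` carrier M = carrier Q"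
    unfolding Q_def p_def by (rule quot_module_carrier[OF sT, symmetric])
  note p_adic = mod_hom_image_ideal_smult[OF module_axioms mQ p R.ideal_pow_subset_carrier[OF I(1)] surj]
  let ?QI = "\<lambda>n. ideal_smult R (ideal_pow R I n) Q"
  obtain N where N: "\<And>n m. n \<ge> N \<Longrightarrow> module_colon R Q (?QI (n + m)) (ideal_pow R I m) \<subseteq> ?QI n"
    by (rule module.adic_colon_pow_stable[OF mQ noetherian_ring_axioms I(1)
          noetherian_module_surj[OF module_axioms mQ p surj noeth] a(1)])
       (use quot_torsion_smult_inj[OF domain_axioms I.Icarr[OF a(1)] a(2)] in \<open>simp add: Q_def\<close>, rule that)
  show ?thesis
  proof (rule that[of N], rule subsetI)
    fix n m x assume n: "n \<ge> N" and x: "x \<in> module_colon R M (adic I (n + m)) (ideal_pow R I m)"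
    then have xc: "x \<in> carrier M" by (simp add: module_colon_def)
    have "r \<odot>\<^bsub>Q\<^esub> p x \<in> ?QI (n + m)" if "r \<in> ideal_pow R I m" for r
    proof -
      have "p (r \<bullet> x) \<in> ?QI (n + m)"
        unfolding p_adic[symmetric] using x that by (intro imageI) (simp add: module_colon_def)
      moreover have "r \<in> carrier R" using that R.ideal_pow_subset_carrier[OF I(1)] by blast
      ultimately show ?thesis using mod_homD(3)[OF p _ xc] by simp
    qed
    then have "p x \<in> p ` adic I n"
      using N[OF n, of m] mod_homD(1)[OF p xc] by (auto simp: module_colon_def p_adic)
    then obtain y where y: "y \<in> adic I n" "p x = p y" by blast
    have yc: "y \<in> carrier M" using adic_subset_carrier[OF I(1)] y(1) by blast
    have "x \<ominus>\<^bsub>M\<^esub> y \<in> torsion" using y(2) coset_eq_iff[OF sT xc yc] by (simp add: p_def)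
    then have "y \<boxplus> (x \<ominus>\<^bsub>M\<^esub> y) \<in> adic I n \<uplus> torsion" by (rule set_add_memI[OF y(1)])
    then show "x \<in> adic I n \<uplus> torsion"
      using M.a_diff_add_cancel[OF xc yc] xc yc by (simp add: M.a_comm)
  qed
qed

end

lemma (in module) torsion_adic_subset_saturation:
  assumes "one_dim_noetherian_domain R" and noeth: "noetherian_module R M"
    and I: "ideal I R" and P: "primeideal P R" and "I \<subseteq> P"
  obtains m where "adic I m \<inter> torsion \<subseteq> saturation R M P {\<zero>\<^bsub>M\<^esub>}"
proof -
  interpret one_dim_noetherian_domain R by fact
  obtain d where d: "d \<in> carrier R - {\<zero>}" and torsion_eq: "torsion = {x \<in> carrier M. d \<bullet> x \<in> {\<zero>\<^bsub>M\<^esub>}}"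
    by (rule saturation_eq_smult_vimage[OF zeroprimeideal noeth submodule_zero])
  obtain s m where s: "s \<in> carrier R - P" and sd: "s \<in> ideal_colon R (PIdl d) (ideal_pow R I m)"
    using ideal_pow_locally_principal[OF I P assms(5)] d by blast
  have dM: "submodule ((\<bullet>) d ` carrier M) R M"
    using d by (intro submodule_image[OF module_axioms module_axioms smult_mod_hom carrier_is_submodule]) simp
  have "adic I m \<subseteq> {x \<in> carrier M. s \<bullet> x \<in> (\<bullet>) d ` carrier M}"
    unfolding ideal_smult_eq_set_smult
  proof (rule set_smult_least[OF submodule_smult_vimage[OF dM]])
    fix r x assume r: "r \<in> ideal_pow R I m" and x: "x \<in> carrier M"
    have rc: "r \<in> carrier R" using r ideal_pow_subset_carrier[OF I] by blast
    obtain c where c: "c \<in> carrier R" "s \<otimes> r = c \<otimes> d"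
      using sd r by (auto simp: ideal_colon_def cgenideal_def)
    have "s \<bullet> (r \<bullet> x) = d \<bullet> (c \<bullet> x)"
      using s d rc c x by (simp add: R.m_comm flip: smult_assoc1)
    then show "r \<bullet> x \<in> {x \<in> carrier M. s \<bullet> x \<in> (\<bullet>) d ` carrier M}" using rc c x by auto
  qed (use s in simp)
  moreover have "s \<bullet> x = \<zero>\<^bsub>M\<^esub>" if x: "x \<in> torsion" and sx: "s \<bullet> x \<in> (\<bullet>) d ` carrier M" for x
  proof -
    obtain y where y: "y \<in> carrier M" "s \<bullet> x = d \<bullet> y" using sx by blast
    have "s \<bullet> x \<in> torsion"
      using submoduleD(6)[OF submodule_saturation[OF zeroprimeideal submodule_zero] _ x] s by simp
    then have "y \<in> torsion" using saturation_smult_memD[OF zeroprimeideal d y(1)] y(2) by simp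
    then show ?thesis using y(2) by (simp add: torsion_eq)
  qed
  ultimately have "adic I m \<inter> torsion \<subseteq> saturation R M P {\<zero>\<^bsub>M\<^esub>}"
    using s by (auto simp: saturation_def)
  then show ?thesis by (rule that)
qed

locale adic_filtration = module R M for R (structure) and M (structure) +
  fixes I :: "'a set" and K :: "nat \<Rightarrow> 'c set"
  assumes ideal_I: "ideal I R"
    and submodule_K: "\<And>n. submodule (K n) R M"
    and K_Suc_subset: "\<And>n. K (Suc n) \<subseteq> K n"
    and ideal_smult_K: "\<And>n. set_smult R M I (K n) \<subseteq> K (Suc n)"
    and adic_subset_K: "\<And>n. ideal_smult R (ideal_pow R I n) M \<subseteq> K n"
begin

lemmas submodule_adic_I = submodule_adic[OF ideal_I]

lemma locally_adic_mod_torsion: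
  assumes noeth: "noetherian_module R M" and P: "primeideal P R"
    and colon: "\<And>m. module_colon R M (adic I (n + m)) (ideal_pow R I m) \<subseteq> adic I n \<uplus> torsion"
    and k: "k \<ge> n" "K k \<subseteq> saturation R M P (adic I k)"
  shows "K n \<subseteq> saturation R M P (adic I n \<uplus> torsion)"
proof
  fix x assume x: "x \<in> K n"
  have xc: "x \<in> carrier M" by (rule submoduleD(1)[OF submodule_K x])
  obtain m where m: "k = n + m" using k(1) le_Suc_ex by blast
  obtain s where s: "s \<in> carrier R - P" and sat: "saturation R M P (adic I k) = {x \<in> carrier M. s \<bullet> x \<in> adic I k}"
    by (rule saturation_eq_smult_vimage[OF P noeth submodule_adic_I])
  have "r \<bullet> (s \<bullet> x) \<in> adic I (n + m)" if r: "r \<in> ideal_pow R I m" for r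
  proof -
    have rc: "r \<in> carrier R" using r R.ideal_pow_subset_carrier[OF ideal_I] by blast
    have "r \<bullet> x \<in> K k"
      using ideal_pow_set_smult_subset[of I K, OF ideal_I submodule_K ideal_smult_K] set_smult_incl[OF r x]
      unfolding m by blast
    then have "s \<bullet> (r \<bullet> x) \<in> adic I k" using k(2) sat by blast
    then show ?thesis using s rc xc by (simp add: m smult_left_commute)
  qed
  then have "s \<bullet> x \<in> adic I n \<uplus> torsion"
    using colon[of m] s xc by (auto simp: module_colon_def)
  then show "x \<in> saturation R M P (adic I n \<uplus> torsion)" using s xc by (auto simp: saturation_def)
qed

lemma locally_adic_if_mod_torsion:
  assumes P: "primeideal P R" and mod_torsion: "K n \<subseteq> saturation R M P (adic I n \<uplus> torsion)"
    and tors: "K n \<inter> torsion \<subseteq> saturation R M P {\<zero>\<^bsub>M\<^esub>}"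
  shows "K n \<subseteq> saturation R M P (adic I n)"
proof
  fix x assume x: "x \<in> K n"
  then obtain s where s: "s \<in> carrier R - P" and "s \<bullet> x \<in> adic I n \<uplus> torsion" and xc: "x \<in> carrier M"
    using mod_torsion by (auto simp: saturation_def)
  then obtain y t where y: "y \<in> adic I n" and t: "t \<in> torsion" and yt: "s \<bullet> x = y \<boxplus> t"
    by (auto simp: set_add_iff)
  have tc: "t \<in> carrier M" and yc: "y \<in> carrier M"
    using t submoduleD(1)[OF submodule_adic_I y] by (auto simp: saturation_def)
  have "s \<bullet> x \<in> K n" using submoduleD(6)[OF submodule_K _ x] s by blast
  then have "t \<boxplus> y \<in> K n" unfolding yt using M.a_comm[OF yc tc] by simp
  then have "t \<in> K n" using submodule_mem_if_add_mem[OF submodule_K tc] y adic_subset_K by blast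
  then have "t \<in> saturation R M P (adic I n)"
    using t tors saturation_mono[of "{\<zero>\<^bsub>M\<^esub>}" "adic I n" P] submoduleD(2)[OF submodule_adic_I] by blast
  moreover have "y \<in> saturation R M P (adic I n)" using subset_saturation[OF P submodule_adic_I] y by blast
  ultimately have "s \<bullet> x \<in> saturation R M P (adic I n)"
    unfolding yt using submoduleD(3)[OF submodule_saturation[OF P submodule_adic_I]] by blast
  then show "x \<in> saturation R M P (adic I n)" by (rule saturation_smult_memD[OF P s xc])
qed

lemma locally_adic_eventually:
  assumes dim: "one_dim_noetherian_domain R" and noeth: "noetherian_module R M"
    and "I \<noteq> {\<zero>}" and P: "primeideal P R" "I \<subseteq> P"
    and freq: "\<exists>\<^sub>F k in sequentially. K k \<subseteq> saturation R M P (adic I k)"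
  shows "\<forall>\<^sub>F n in sequentially. K n \<subseteq> saturation R M P (adic I n)"
proof -
  interpret one_dim_noetherian_domain R by fact
  have good: "\<exists>k\<ge>n. K k \<subseteq> saturation R M P (adic I k)" for n
    using freq by (auto simp: frequently_sequentially)
  obtain N where N: "\<And>n m. n \<ge> N \<Longrightarrow>
      module_colon R M (adic I (n + m)) (ideal_pow R I m) \<subseteq> adic I n \<uplus> torsion"
    by (rule adic_colon_pow_subset_torsion[OF noetherian_domain_axioms noeth ideal_I assms(3)])
       (rule that)
  obtain m where m: "adic I m \<inter> torsion \<subseteq> saturation R M P {\<zero>\<^bsub>M\<^esub>}"
    by (rule torsion_adic_subset_saturation[OF dim noeth ideal_I P])
  obtain k where k: "k \<ge> m" "K k \<subseteq> saturation R M P (adic I k)" using good by blast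
  have "K k \<inter> torsion \<subseteq> saturation R M P {\<zero>\<^bsub>M\<^esub>}"
  proof
    fix t assume t: "t \<in> K k \<inter> torsion"
    then obtain s where s: "s \<in> carrier R - P" "s \<bullet> t \<in> adic I k" using k(2) by (auto simp: saturation_def)
    then have "s \<bullet> t \<in> adic I m \<inter> torsion"
      using t adic_antimono[OF ideal_I k(1)]
        submoduleD(6)[OF submodule_saturation[OF zeroprimeideal submodule_zero], of s t] by auto
    then have "s \<bullet> t \<in> saturation R M P {\<zero>\<^bsub>M\<^esub>}" using m by blast
    then show "t \<in> saturation R M P {\<zero>\<^bsub>M\<^esub>}"
      by (rule saturation_smult_memD[OF P(1) s(1), rotated]) (use submoduleD(1)[OF submodule_K] t in blast)
  qed
  then have tors: "K n \<inter> torsion \<subseteq> saturation R M P {\<zero>\<^bsub>M\<^esub>}" if "n \<ge> k" for n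
    using lift_Suc_antimono_le[of K, OF K_Suc_subset that] by blast
  have "K n \<subseteq> saturation R M P (adic I n)" if "n \<ge> max N k" for n
  proof (rule locally_adic_if_mod_torsion[OF P(1) _ tors])
    obtain k' where "k' \<ge> n" "K k' \<subseteq> saturation R M P (adic I k')" using good by blast
    then show "K n \<subseteq> saturation R M P (adic I n \<uplus> torsion)"
      using N that by (intro locally_adic_mod_torsion[OF noeth P(1)]) auto
  qed (use that in simp)
  then show ?thesis unfolding eventually_sequentially by blast
qed

text \<open>Nonzero primes are maximal, so every nonzero annihilator \<open>H \<subseteq> P\<close> satisfies \<open>P = (H : r)\<close> for some \<open>r\<close>.\<close>
lemma Ass_iff_not_locally_adic:
  assumes "one_dim_noetherian_domain R" and "I \<noteq> {\<zero>}" and P: "primeideal P R"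
  shows "P \<in> Ass R (quot_module R (M\<lparr>carrier := K n\<rparr>) (adic I n)) \<longleftrightarrow>
    \<not> K n \<subseteq> saturation R M P (adic I n)"
proof -
  interpret one_dim_noetherian_domain R by fact
  note Ass_eq = Ass_quot_submodule[OF module_axioms submodule_K submodule_adic_I adic_subset_K]
  show ?thesis
  proof
    assume "P \<in> Ass R (quot_module R (M\<lparr>carrier := K n\<rparr>) (adic I n))"
    then obtain x where "x \<in> K n" "P = ann_mod R M (adic I n) x" unfolding Ass_eq by blast
    then show "\<not> K n \<subseteq> saturation R M P (adic I n)" by (auto simp: saturation_def ann_mod_def)
  next
    assume "\<not> K n \<subseteq> saturation R M P (adic I n)"
    then obtain x where x: "x \<in> K n" "x \<notin> saturation R M P (adic I n)" by blast
    have xc: "x \<in> carrier M" by (rule submoduleD(1)[OF submodule_K x(1)])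
    define H where "H = ann_mod R M (adic I n) x"
    have H: "ideal H R" unfolding H_def by (rule ideal_ann_mod[OF submodule_adic_I xc])
    have "H \<subseteq> P" using x(2) xc by (auto simp: H_def ann_mod_def saturation_def)
    have "ideal_pow R I n \<subseteq> H"
      using set_smult_incl[OF _ xc] R.ideal_pow_subset_carrier[OF ideal_I]
      by (auto simp: H_def ann_mod_def ideal_smult_eq_set_smult)
    then have "H \<noteq> {\<zero>}"
      using primeideal_ideal_pow_subset[OF zeroprimeideal ideal_I, of n] assms(2)
        additive_subgroup.zero_closed[OF ideal.axioms(1)[OF ideal_I]] by auto
    then obtain r where r: "r \<in> carrier R" "ideal_colon R H {r} = P"
      by (rule primeideal_eq_ideal_colon[OF H _ P \<open>H \<subseteq> P\<close>])
    have "ideal_colon R H {r} = ann_mod R M (adic I n) (r \<bullet> x)"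
      using r(1) xc by (auto simp: H_def ideal_colon_def ann_mod_def smult_assoc1)
    then show "P \<in> Ass R (quot_module R (M\<lparr>carrier := K n\<rparr>) (adic I n))"
      using P r submoduleD(6)[OF submodule_K r(1) x(1)] unfolding Ass_eq by blast
  qed
qed

lemma Ass_subset_primes_above:
  "Ass R (quot_module R (M\<lparr>carrier := K n\<rparr>) (adic I n)) \<subseteq> {P. primeideal P R \<and> I \<subseteq> P}"
proof
  fix P assume "P \<in> Ass R (quot_module R (M\<lparr>carrier := K n\<rparr>) (adic I n))"
  then obtain x where P: "primeideal P R" and x: "x \<in> K n" "P = ann_mod R M (adic I n) x"
    unfolding Ass_quot_submodule[OF module_axioms submodule_K submodule_adic_I adic_subset_K] by blast
  have "ideal_pow R I n \<subseteq> P"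
    using set_smult_incl[of _ "ideal_pow R I n" x "carrier M"] submoduleD(1)[OF submodule_K x(1)]
      R.ideal_pow_subset_carrier[OF ideal_I]
    by (auto simp: x(2) ann_mod_def ideal_smult_eq_set_smult)
  then show "P \<in> {P. primeideal P R \<and> I \<subseteq> P}"
    using P R.primeideal_ideal_pow_subset[OF P ideal_I] by blast
qed

theorem Ass_eventually_constant:
  assumes dim: "one_dim_noetherian_domain R" and noeth: "noetherian_module R M" and "I \<noteq> {\<zero>}"
  shows "\<exists>C. \<forall>\<^sub>F n in sequentially. Ass R (quot_module R (M\<lparr>carrier := K n\<rparr>) (adic I n)) = C"
proof -
  interpret one_dim_noetherian_domain R by fact
  define F where "F n = Ass R (quot_module R (M\<lparr>carrier := K n\<rparr>) (adic I n))" for n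
  define PP where "PP = {P. primeideal P R \<and> I \<subseteq> P}"
  define C where "C = {P \<in> PP. \<forall>\<^sub>F n in sequentially. P \<in> F n}"
  have "\<forall>\<^sub>F n in sequentially. P \<in> F n \<longleftrightarrow> P \<in> C" if P: "P \<in> PP" for P
  proof (cases "\<exists>\<^sub>F n in sequentially. P \<notin> F n")
    case True
    have pP: "primeideal P R" "I \<subseteq> P" using P by (auto simp: PP_def)
    note F_iff = Ass_iff_not_locally_adic[OF dim assms(3) pP(1), folded F_def]
    have "\<forall>\<^sub>F n in sequentially. P \<notin> F n"
      using locally_adic_eventually[OF dim noeth assms(3) pP] True by (simp add: F_iff)
    moreover have "P \<notin> C" using True by (simp add: C_def frequently_def)
    ultimately show ?thesis by simp
  next
    case False
    then show ?thesis using P by (simp add: C_def frequently_def)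
  qed
  moreover have "finite PP" unfolding PP_def by (rule finite_primes_above[OF ideal_I assms(3)])
  ultimately have "\<forall>\<^sub>F n in sequentially. \<forall>P\<in>PP. P \<in> F n \<longleftrightarrow> P \<in> C"
    by (intro eventually_ball_finite) auto
  moreover have "F n \<subseteq> PP" "C \<subseteq> PP" for n
    using Ass_subset_primes_above by (auto simp: F_def PP_def C_def)
  ultimately have "\<forall>\<^sub>F n in sequentially. F n = C" by (elim eventually_mono) blast
  then show ?thesis unfolding F_def by blast
qed

end

section \<open>Spanning sets and free modules\<close>

definition spans :: "('r,'c) ring_scheme \<Rightarrow> ('r,'a,'d) module_scheme \<Rightarrow> 'a set \<Rightarrow> bool"
  where "spans R M G \<longleftrightarrow> G \<subseteq> carrier M \<and> gen_submodule R M G = carrier M"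

lemma spans_subset_carrier: "spans R M G \<Longrightarrow> G \<subseteq> carrier M"
  by (simp add: spans_def)

lemma spans_least: "spans R M G \<Longrightarrow> submodule D R M \<Longrightarrow> G \<subseteq> D \<Longrightarrow> carrier M \<subseteq> D"
  by (auto simp: spans_def gen_submodule_def)

lemma fin_gen_module_iff_spans: "fin_gen_module R M \<longleftrightarrow> (\<exists>G. finite G \<and> spans R M G)"
  by (simp add: fin_gen_module_def spans_def)

context module
begin

lemma spansI:
  assumes "G \<subseteq> carrier M" "\<And>D. submodule D R M \<Longrightarrow> G \<subseteq> D \<Longrightarrow> carrier M \<subseteq> D"
  shows "spans R M G"
  unfolding spans_def
  using assms gen_submodule_least[OF carrier_is_submodule assms(1)]
    submodule_gen[OF assms(1)] gen_submodule_incl[of G] by blast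

lemma submodule_finsum:
  assumes D: "submodule D R M" and "\<And>i. i \<in> A \<Longrightarrow> h i \<in> D"
  shows "finsum M h A \<in> D"
  using assms(2)
proof (induction A rule: infinite_finite_induct)
  case (insert i A)
  then show ?case using submoduleD(1,3)[OF D] by (subst M.finsum_insert) auto
qed (use submoduleD(2)[OF D] in \<open>auto simp: M.finsum_infinite\<close>)

end

lemma spans_image:
  assumes mM: "module R M" and mN: "module R N" and f: "f \<in> mod_hom R M N"
    and surj: "f ` carrier M = carrier N" and G: "spans R M G"
  shows "spans R N (f ` G)"
proof (rule module.spansI[OF mN])
  show "f ` G \<subseteq> carrier N" using spans_subset_carrier[OF G] surj by blast
  fix D assume D: "submodule D R N" "f ` G \<subseteq> D"
  have "carrier M \<subseteq> {x \<in> carrier M. f x \<in> D}"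
    by (rule spans_least[OF G submodule_preimage[OF mM mN f D(1)]]) (use D spans_subset_carrier[OF G] in auto)
  then show "carrier N \<subseteq> D" unfolding surj[symmetric] by blast
qed

lemma mod_hom_eq_on_span:
  assumes mM: "module R M" and mN: "module R N" and f: "f \<in> mod_hom R M N" and g: "g \<in> mod_hom R M N"
    and G: "spans R M G" and "\<And>x. x \<in> G \<Longrightarrow> f x = g x" and "x \<in> carrier M"
  shows "f x = g x"
proof -
  interpret M: module R M by fact
  have "submodule {x \<in> carrier M. f x = g x} R M"
    by (rule M.submoduleI)
       (auto simp: mod_hom_zero[OF mM mN] mod_hom_minus[OF mM mN] f g mod_homD(2,3)[OF f] mod_homD(2,3)[OF g])
  moreover have "G \<subseteq> {x \<in> carrier M. f x = g x}" using assms(6) spans_subset_carrier[OF G] by auto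
  ultimately show ?thesis using spans_least[OF G] assms(7) by blast
qed

lemma free_module_simps:
  "f \<in> carrier (free_module R S) \<longleftrightarrow>
     (\<forall>p. f p \<in> carrier R) \<and> (\<forall>p. p \<notin> S \<longrightarrow> f p = \<zero>\<^bsub>R\<^esub>) \<and> finite {p. f p \<noteq> \<zero>\<^bsub>R\<^esub>}"
  "\<zero>\<^bsub>free_module R S\<^esub> = (\<lambda>_. \<zero>\<^bsub>R\<^esub>)"
  "f \<oplus>\<^bsub>free_module R S\<^esub> g = (\<lambda>p. f p \<oplus>\<^bsub>R\<^esub> g p)"
  "r \<odot>\<^bsub>free_module R S\<^esub> f = (\<lambda>p. r \<otimes>\<^bsub>R\<^esub> f p)"
  by (auto simp: free_module_def)

context cring
begin

lemma free_module_is_module: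
  fixes S :: "'p set"
  shows "module R (free_module R S)"
proof (rule moduleI)
  let ?F = "free_module R S"
  show "cring R" by (rule is_cring)
  have fin: "finite {p. f p \<oplus> g p \<noteq> \<zero>}" if "finite {p. f p \<noteq> \<zero>}" "finite {p. g p \<noteq> \<zero>}" for f g :: "'p \<Rightarrow> 'a"
    by (rule finite_subset[OF _ finite_UnI[OF that]]) auto
  show "abelian_group ?F"
  proof (rule abelian_groupI)
    fix f assume f: "f \<in> carrier ?F"
    have "{p. \<ominus> f p \<noteq> \<zero>} \<subseteq> {p. f p \<noteq> \<zero>}" by auto
    then have "(\<lambda>p. \<ominus> f p) \<in> carrier ?F"
      using f finite_subset by (auto simp: free_module_simps)
    moreover have "(\<lambda>p. \<ominus> f p) \<oplus>\<^bsub>?F\<^esub> f = \<zero>\<^bsub>?F\<^esub>"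
      using f by (auto simp: free_module_simps l_neg)
    ultimately show "\<exists>g\<in>carrier ?F. g \<oplus>\<^bsub>?F\<^esub> f = \<zero>\<^bsub>?F\<^esub>" by blast
  qed (auto simp: free_module_simps a_ac fin)
  show "r \<odot>\<^bsub>?F\<^esub> f \<in> carrier ?F"
    if "r \<in> carrier R" "f \<in> carrier ?F" for r f
  proof -
    have "{p. r \<otimes> f p \<noteq> \<zero>} \<subseteq> {p. f p \<noteq> \<zero>}" using that by auto
    then show ?thesis using that finite_subset by (auto simp: free_module_simps)
  qed
qed (auto simp: free_module_simps l_distr r_distr m_assoc)

lemma free_module_diff:
  assumes "f \<in> carrier (free_module R S)" "g \<in> carrier (free_module R S)"
  shows "f \<ominus>\<^bsub>free_module R S\<^esub> g = (\<lambda>p. f p \<ominus> g p)"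
proof
  let ?F = "free_module R S"
  interpret F: module R ?F by (rule free_module_is_module)
  fix p
  have closed: "f \<ominus>\<^bsub>?F\<^esub> g \<in> carrier ?F" using assms by simp
  have "f p = (f \<ominus>\<^bsub>?F\<^esub> g) p \<oplus> g p"
    using F.a_diff_add_cancel[OF assms] by (metis free_module_simps(3))
  then show "(f \<ominus>\<^bsub>?F\<^esub> g) p = f p \<ominus> g p"
    using closed assms(2) by (simp add: free_module_simps a_add_diff_cancel_right)
qed

lemma basis_vec_closed: "p \<in> S \<Longrightarrow> basis_vec R p \<in> carrier (free_module R S)"
  by (auto simp: basis_vec_def free_module_simps)

lemma free_module_finsum:
  assumes "\<And>i. i \<in> A \<Longrightarrow> h i \<in> carrier (free_module R S)"
  shows "(finsum (free_module R S) h A) p = (\<Oplus>i\<in>A. h i p)"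
proof -
  interpret F: module R "free_module R S" by (rule free_module_is_module)
  have "h i p \<in> carrier R" if "i \<in> A" for i using assms[OF that] by (simp add: free_module_simps)
  with assms show ?thesis
    by (induction A rule: infinite_finite_induct)
       (auto simp: finsum_infinite F.finsum_infinite free_module_simps(2,3) Pi_def)
qed

end

definition lin_ext :: "('r,'c) ring_scheme \<Rightarrow> ('r,'a,'d) module_scheme \<Rightarrow> ('p \<Rightarrow> 'a) \<Rightarrow> ('p \<Rightarrow> 'r) \<Rightarrow> 'a"
  where "lin_ext R M \<phi> g = (\<Oplus>\<^bsub>M\<^esub>p\<in>{p. g p \<noteq> \<zero>\<^bsub>R\<^esub>}. g p \<odot>\<^bsub>M\<^esub> \<phi> p)"

context module
begin

context
  fixes S :: "'p set" and \<phi> assumes \<phi>: "\<And>p. p \<in> S \<Longrightarrow> \<phi> p \<in> carrier M"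
begin

lemma lin_ext_eq_finsum:
  assumes "g \<in> carrier (free_module R S)" "finite A" "{p. g p \<noteq> \<zero>} \<subseteq> A" "A \<subseteq> S"
  shows "lin_ext R M \<phi> g = (\<Oplus>\<^bsub>M\<^esub>p\<in>A. g p \<bullet> \<phi> p)"
  unfolding lin_ext_def
proof (rule M.add.finprod_mono_neutral_cong_left[OF assms(2,3)])
  have gc: "g p \<in> carrier R" for p using assms(1) by (simp add: free_module_simps)
  show "(\<lambda>p. g p \<bullet> \<phi> p) \<in> A \<rightarrow> carrier M" using gc \<phi> assms(4) by auto
  show "g p \<bullet> \<phi> p = \<zero>\<^bsub>M\<^esub>" if "p \<in> A - {p. g p \<noteq> \<zero>}" for p
    using that \<phi> assms(4) by auto
qed auto

lemma lin_ext_add: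
  assumes f: "f \<in> carrier (free_module R S)" and g: "g \<in> carrier (free_module R S)"
  shows "lin_ext R M \<phi> (f \<oplus>\<^bsub>free_module R S\<^esub> g) = lin_ext R M \<phi> f \<boxplus> lin_ext R M \<phi> g"
proof -
  interpret F: module R "free_module R S" by (rule R.free_module_is_module)
  define A where "A = {p. f p \<noteq> \<zero>} \<union> {p. g p \<noteq> \<zero>}"
  have A: "finite A" "A \<subseteq> S" using f g by (auto simp: A_def free_module_simps)
  have coeff: "f p \<in> carrier R" "g p \<in> carrier R" for p using f g by (auto simp: free_module_simps)
  have "{p. (f \<oplus>\<^bsub>free_module R S\<^esub> g) p \<noteq> \<zero>} \<subseteq> A" by (auto simp: A_def free_module_simps)
  then have "lin_ext R M \<phi> (f \<oplus>\<^bsub>free_module R S\<^esub> g) = (\<Oplus>\<^bsub>M\<^esub>p\<in>A. (f p \<oplus> g p) \<bullet> \<phi> p)"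
    using lin_ext_eq_finsum[OF F.a_closed[OF f g] A(1) _ A(2)] by (simp add: free_module_simps)
  also have "\<dots> = (\<Oplus>\<^bsub>M\<^esub>p\<in>A. f p \<bullet> \<phi> p \<boxplus> g p \<bullet> \<phi> p)"
    by (rule M.finsum_cong') (use A \<phi> coeff in \<open>auto simp: smult_l_distr\<close>)
  also have "\<dots> = (\<Oplus>\<^bsub>M\<^esub>p\<in>A. f p \<bullet> \<phi> p) \<boxplus> (\<Oplus>\<^bsub>M\<^esub>p\<in>A. g p \<bullet> \<phi> p)"
    by (rule M.finsum_addf) (use A \<phi> coeff in auto)
  also have "\<dots> = lin_ext R M \<phi> f \<boxplus> lin_ext R M \<phi> g"
    using lin_ext_eq_finsum[OF f A(1) _ A(2)] lin_ext_eq_finsum[OF g A(1) _ A(2)] by (auto simp: A_def)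
  finally show ?thesis .
qed

lemma lin_ext_smult:
  assumes r: "r \<in> carrier R" and f: "f \<in> carrier (free_module R S)"
  shows "lin_ext R M \<phi> (r \<odot>\<^bsub>free_module R S\<^esub> f) = r \<bullet> lin_ext R M \<phi> f"
proof -
  interpret F: module R "free_module R S" by (rule R.free_module_is_module)
  define A where "A = {p. f p \<noteq> \<zero>}"
  have A: "finite A" "A \<subseteq> S" and coeff: "f p \<in> carrier R" for p
    using f by (auto simp: A_def free_module_simps)
  have "{p. (r \<odot>\<^bsub>free_module R S\<^esub> f) p \<noteq> \<zero>} \<subseteq> A" using r by (auto simp: A_def free_module_simps)
  then have "lin_ext R M \<phi> (r \<odot>\<^bsub>free_module R S\<^esub> f) = (\<Oplus>\<^bsub>M\<^esub>p\<in>A. (r \<otimes> f p) \<bullet> \<phi> p)"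
    using lin_ext_eq_finsum[OF F.smult_closed[OF r f] A(1) _ A(2)] by (simp add: free_module_simps)
  also have "\<dots> = (\<Oplus>\<^bsub>M\<^esub>p\<in>A. r \<bullet> (f p \<bullet> \<phi> p))"
    by (rule M.finsum_cong') (use A \<phi> coeff r in \<open>auto simp: smult_assoc1\<close>)
  also have "\<dots> = r \<bullet> (\<Oplus>\<^bsub>M\<^esub>p\<in>A. f p \<bullet> \<phi> p)"
    by (rule finsum_smult_ldistr[symmetric]) (use A \<phi> coeff r in auto)
  finally show ?thesis by (simp add: lin_ext_def A_def)
qed

lemma lin_ext_hom: "lin_ext R M \<phi> \<in> mod_hom R (free_module R S) M"
proof (rule mod_homI)
  show "lin_ext R M \<phi> f \<in> carrier M" if "f \<in> carrier (free_module R S)" for f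
    unfolding lin_ext_def by (rule M.finsum_closed) (use that \<phi> in \<open>auto simp: free_module_simps\<close>)
qed (rule lin_ext_add lin_ext_smult; assumption)+

lemma lin_ext_basis_vec:
  assumes "p \<in> S"
  shows "lin_ext R M \<phi> (basis_vec R p) = \<phi> p"
proof -
  have "lin_ext R M \<phi> (basis_vec R p) = (\<Oplus>\<^bsub>M\<^esub>q\<in>{p}. basis_vec R p q \<bullet> \<phi> q)"
    by (rule lin_ext_eq_finsum[OF R.basis_vec_closed[OF assms]]) (use assms in \<open>auto simp: basis_vec_def\<close>)
  also have "\<dots> = \<phi> p" using \<phi>[OF assms] by (simp add: basis_vec_def)
  finally show ?thesis .
qed

end

end

context cring
begin

lemma lin_ext_free_module:
  assumes "g \<in> carrier (free_module R S)" "\<And>p. p \<in> S \<Longrightarrow> \<phi> p \<in> carrier (free_module R S')"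
  shows "lin_ext R (free_module R S') \<phi> g q = (\<Oplus>p\<in>{p. g p \<noteq> \<zero>}. g p \<otimes> \<phi> p q)"
proof -
  interpret F: module R "free_module R S'" by (rule free_module_is_module)
  have "g p \<odot>\<^bsub>free_module R S'\<^esub> \<phi> p \<in> carrier (free_module R S')" if "g p \<noteq> \<zero>" for p
    using assms that by (intro F.smult_closed) (auto simp: free_module_simps(1)[of g])
  then show ?thesis
    unfolding lin_ext_def by (subst free_module_finsum) (auto simp: free_module_simps(4))
qed

lemma spans_free_module: "spans R (free_module R S) (basis_vec R ` S)"
proof -
  let ?F = "free_module R S"
  interpret F: module R ?F by (rule free_module_is_module)
  show ?thesis
  proof (rule F.spansI)
    show "basis_vec R ` S \<subseteq> carrier ?F" using basis_vec_closed by auto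
    fix D assume D: "submodule D R ?F" "basis_vec R ` S \<subseteq> D"
    show "carrier ?F \<subseteq> D"
    proof
      fix g assume g: "g \<in> carrier ?F"
      have "g p \<odot>\<^bsub>?F\<^esub> basis_vec R p \<in> D" if "g p \<noteq> \<zero>" for p
        using g that D by (intro F.submoduleD(6)[OF D(1)]) (auto simp: free_module_simps)
      then have "lin_ext R ?F (basis_vec R) g \<in> D"
        unfolding lin_ext_def by (intro F.submodule_finsum[OF D(1)]) auto
      moreover have "lin_ext R ?F (basis_vec R) g = g"
      proof
        fix q
        have coeff: "g p \<in> carrier R" for p using g by (simp add: free_module_simps)
        have "lin_ext R ?F (basis_vec R) g q = (\<Oplus>p\<in>{p. g p \<noteq> \<zero>}. g p \<otimes> basis_vec R p q)"
          by (rule lin_ext_free_module[OF g]) (rule basis_vec_closed)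
        also have "\<dots> = (\<Oplus>p\<in>{p. g p \<noteq> \<zero>}. if q = p then g p else \<zero>)"
          by (rule finsum_cong') (auto simp: basis_vec_def coeff)
        also have "\<dots> = g q"
        proof (cases "g q = \<zero>")
          case True
          then show ?thesis using finsum_zero by (subst finsum_cong'[of _ _ "\<lambda>_. \<zero>"]) auto
        next
          case False
          then show ?thesis using g by (intro finsum_singleton) (auto simp: free_module_simps)
        qed
        finally show "lin_ext R ?F (basis_vec R) g q = g q" .
      qed
      ultimately show "g \<in> D" by simp
    qed
  qed
qed

lemma push_fwd_eq_lin_ext:
  fixes f :: "'x \<Rightarrow> 'y" and Y :: "'z set"
  assumes f: "\<And>a. a \<in> A \<Longrightarrow> f a \<in> B" and g: "g \<in> carrier (free_module R (A \<times> Y))"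
  shows "push_fwd R f g = lin_ext R (free_module R (B \<times> Y)) (\<lambda>(a, x). basis_vec R (f a, x)) g"
proof
  fix q :: "'y \<times> 'z" obtain b y where q: "q = (b, y)" by force
  let ?fiber = "{a. g (a, y) \<noteq> \<zero> \<and> f a = b}"
  have coeff: "g p \<in> carrier R" for p using g unfolding free_module_simps by blast
  have "lin_ext R (free_module R (B \<times> Y)) (\<lambda>(a, x). basis_vec R (f a, x)) g q =
      (\<Oplus>p\<in>{p. g p \<noteq> \<zero>}. g p \<otimes> (case p of (a, x) \<Rightarrow> basis_vec R (f a, x)) q)"
    by (rule lin_ext_free_module[OF g]) (use f in \<open>auto intro: basis_vec_closed\<close>)
  also have "\<dots> = (\<Oplus>p\<in>(\<lambda>a. (a, y)) ` ?fiber. g p)"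
  proof (rule add.finprod_mono_neutral_cong_right)
    show "finite {p. g p \<noteq> \<zero>}" using g by (simp add: free_module_simps)
  qed (auto simp: q basis_vec_def coeff)
  also have "\<dots> = (\<Oplus>a\<in>?fiber. g (a, y))"
    by (rule finsum_reindex) (auto simp: coeff inj_on_def)
  finally show "push_fwd R f g q = lin_ext R (free_module R (B \<times> Y)) (\<lambda>(a, x). basis_vec R (f a, x)) g q"
    by (simp add: push_fwd_def q)
qed

lemma push_fwd_hom:
  assumes "\<And>a. a \<in> A \<Longrightarrow> f a \<in> B"
  shows "push_fwd R f \<in> mod_hom R (free_module R (A \<times> Y)) (free_module R (B \<times> Y))"
proof -
  interpret G: module R "free_module R (B \<times> Y)" by (rule free_module_is_module)
  interpret F: module R "free_module R (A \<times> Y)" by (rule free_module_is_module)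
  have hom: "lin_ext R (free_module R (B \<times> Y)) (\<lambda>(a, x). basis_vec R (f a, x))
      \<in> mod_hom R (free_module R (A \<times> Y)) (free_module R (B \<times> Y))"
    by (rule G.lin_ext_hom) (use assms in \<open>auto intro: basis_vec_closed\<close>)
  show ?thesis
    by (rule mod_homI) (simp_all add: push_fwd_eq_lin_ext[where A = A and B = B and Y = Y, OF assms] mod_homD[OF hom])
qed

lemma push_fwd_basis_vec:
  assumes "\<And>a. a \<in> A \<Longrightarrow> f a \<in> B" "a \<in> A" "y \<in> Y"
  shows "push_fwd R f (basis_vec R (a, y)) = basis_vec R (f a, y)"
proof -
  interpret G: module R "free_module R (B \<times> Y)" by (rule free_module_is_module)
  show ?thesis
    by (subst push_fwd_eq_lin_ext[where A = A and B = B and Y = Y], use assms in \<open>auto intro: basis_vec_closed\<close>,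
        subst G.lin_ext_basis_vec[of "A \<times> Y"], use assms in \<open>auto intro: basis_vec_closed\<close>)
qed

end

section \<open>Tensor products\<close>

definition bilinear :: "('r,'c) ring_scheme \<Rightarrow> ('r,'a,'d) module_scheme \<Rightarrow> ('r,'x,'e) module_scheme
    \<Rightarrow> ('r,'l,'k) module_scheme \<Rightarrow> ('a \<Rightarrow> 'x \<Rightarrow> 'l) \<Rightarrow> bool"
  where "bilinear R A Y L \<phi> \<longleftrightarrow>
     (\<forall>x\<in>carrier Y. (\<lambda>a. \<phi> a x) \<in> mod_hom R A L) \<and> (\<forall>a\<in>carrier A. \<phi> a \<in> mod_hom R Y L)"

lemma bilinearD:
  assumes "bilinear R A Y L \<phi>"
  shows "x \<in> carrier Y \<Longrightarrow> (\<lambda>a. \<phi> a x) \<in> mod_hom R A L" "a \<in> carrier A \<Longrightarrow> \<phi> a \<in> mod_hom R Y L"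
  using assms by (auto simp: bilinear_def)

lemma bilinear_compose:
  assumes "bilinear R A Y L \<phi>" "f \<in> mod_hom R A' A" "p \<in> mod_hom R Y' Y" "h \<in> mod_hom R L L'"
  shows "bilinear R A' Y' L' (\<lambda>a y. h (\<phi> (f a) (p y)))"
  unfolding bilinear_def
proof (intro conjI ballI)
  show "(\<lambda>a. h (\<phi> (f a) (p y))) \<in> mod_hom R A' L'" if "y \<in> carrier Y'" for y
    by (rule mod_hom_compose[OF mod_hom_compose[OF assms(2) bilinearD(1)[OF assms(1)]] assms(4)])
       (use that mod_homD(1)[OF assms(3)] in simp)
  show "(\<lambda>y. h (\<phi> (f a) (p y))) \<in> mod_hom R Y' L'" if "a \<in> carrier A'" for a
    by (rule mod_hom_compose[OF mod_hom_compose[OF assms(3) bilinearD(2)[OF assms(1)]] assms(4)])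
       (use that mod_homD(1)[OF assms(2)] in simp)
qed

definition pure_tensor :: "('r,'c) ring_scheme \<Rightarrow> ('r,'a,'d) module_scheme \<Rightarrow> ('r,'x,'e) module_scheme
    \<Rightarrow> 'a \<Rightarrow> 'x \<Rightarrow> ('a \<times> 'x \<Rightarrow> 'r) set"
  where "pure_tensor R A Y a x =
     tensor_rel_sub R A Y +>\<^bsub>free_module R (carrier A \<times> carrier Y)\<^esub> basis_vec R (a, x)"

locale module_pair = A?: module R A + Y?: module R Y for R (structure) and A and Y
begin

abbreviation "Fr \<equiv> free_module R (carrier A \<times> carrier Y)"

abbreviation "T \<equiv> tensor R A Y"

lemma free_module_pair: "module R Fr"
  by (rule A.R.free_module_is_module)

sublocale Fr: module R Fr by (rule free_module_pair)

lemma basis_pair_closed: "a \<in> carrier A \<Longrightarrow> x \<in> carrier Y \<Longrightarrow> basis_vec R (a, x) \<in> carrier Fr"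
  by (rule A.R.basis_vec_closed) simp

lemma tensor_rels_eq:
  "tensor_rels R A Y =
     {basis_vec R (a \<oplus>\<^bsub>A\<^esub> a', x) \<ominus>\<^bsub>Fr\<^esub> basis_vec R (a, x) \<ominus>\<^bsub>Fr\<^esub> basis_vec R (a', x)
        | a a' x. a \<in> carrier A \<and> a' \<in> carrier A \<and> x \<in> carrier Y}
   \<union> {basis_vec R (a, x \<oplus>\<^bsub>Y\<^esub> x') \<ominus>\<^bsub>Fr\<^esub> basis_vec R (a, x) \<ominus>\<^bsub>Fr\<^esub> basis_vec R (a, x')
        | a x x'. a \<in> carrier A \<and> x \<in> carrier Y \<and> x' \<in> carrier Y}
   \<union> {basis_vec R (r \<odot>\<^bsub>A\<^esub> a, x) \<ominus>\<^bsub>Fr\<^esub> r \<odot>\<^bsub>Fr\<^esub> basis_vec R (a, x)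
        | r a x. r \<in> carrier R \<and> a \<in> carrier A \<and> x \<in> carrier Y}
   \<union> {basis_vec R (a, r \<odot>\<^bsub>Y\<^esub> x) \<ominus>\<^bsub>Fr\<^esub> r \<odot>\<^bsub>Fr\<^esub> basis_vec R (a, x)
        | r a x. r \<in> carrier R \<and> a \<in> carrier A \<and> x \<in> carrier Y}"
proof -
  have diff: "(\<lambda>p. f p \<ominus> g p) = f \<ominus>\<^bsub>Fr\<^esub> g" if "f \<in> carrier Fr" "g \<in> carrier Fr" for f g
    using A.R.free_module_diff[OF that] by simp
  have diff_diff: "(\<lambda>p. f p \<ominus> g p \<ominus> h p) = f \<ominus>\<^bsub>Fr\<^esub> g \<ominus>\<^bsub>Fr\<^esub> h"
    if "f \<in> carrier Fr" "g \<in> carrier Fr" "h \<in> carrier Fr" for f g h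
    using diff[OF Fr.M.minus_closed[OF that(1,2)] that(3)] unfolding A.R.free_module_diff[OF that(1,2)] .
  have diff_smult: "(\<lambda>p. f p \<ominus> r \<otimes> g p) = f \<ominus>\<^bsub>Fr\<^esub> r \<odot>\<^bsub>Fr\<^esub> g"
    if "f \<in> carrier Fr" "g \<in> carrier Fr" "r \<in> carrier R" for f g r
    using diff[of f "r \<odot>\<^bsub>Fr\<^esub> g"] Fr.smult_closed[of r g] that by (simp add: free_module_simps(4))
  show ?thesis unfolding tensor_rels_def
    by (intro arg_cong2[where f = "(\<union>)"] Collect_cong ex_cong1)
       (auto simp: diff_diff diff_smult basis_pair_closed)
qed

lemma tensor_rels_closed: "tensor_rels R A Y \<subseteq> carrier Fr"
  unfolding tensor_rels_eq
  by (auto intro!: Fr.M.minus_closed Fr.smult_closed basis_pair_closed)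

lemma bilinear_iff_kills_tensor_rels:
  assumes L: "module R L" and f: "f \<in> mod_hom R Fr L"
  shows "bilinear R A Y L (\<lambda>a x. f (basis_vec R (a, x))) \<longleftrightarrow> (\<forall>g\<in>tensor_rels R A Y. f g = \<zero>\<^bsub>L\<^esub>)"
proof -
  interpret L: module R L by fact
  have diff_diff: "f (u \<ominus>\<^bsub>Fr\<^esub> v \<ominus>\<^bsub>Fr\<^esub> w) = \<zero>\<^bsub>L\<^esub> \<longleftrightarrow> f u = f v \<oplus>\<^bsub>L\<^esub> f w"
    if c: "u \<in> carrier Fr" "v \<in> carrier Fr" "w \<in> carrier Fr" for u v w
  proof -
    note fc = mod_homD(1)[OF f]
    have "f (u \<ominus>\<^bsub>Fr\<^esub> v \<ominus>\<^bsub>Fr\<^esub> w) = f u \<ominus>\<^bsub>L\<^esub> f v \<ominus>\<^bsub>L\<^esub> f w"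
      using c by (simp add: mod_hom_diff[OF free_module_pair L f])
    also have "\<dots> = f u \<ominus>\<^bsub>L\<^esub> (f v \<oplus>\<^bsub>L\<^esub> f w)"
      using c fc by (simp add: a_minus_def L.M.minus_add L.M.a_assoc)
    finally show ?thesis using L.M.a_diff_eq_zero_iff[of "f u" "f v \<oplus>\<^bsub>L\<^esub> f w"] c fc by simp
  qed
  have diff_smult: "f (u \<ominus>\<^bsub>Fr\<^esub> r \<odot>\<^bsub>Fr\<^esub> v) = \<zero>\<^bsub>L\<^esub> \<longleftrightarrow> f u = r \<odot>\<^bsub>L\<^esub> f v"
    if "u \<in> carrier Fr" "v \<in> carrier Fr" "r \<in> carrier R" for u r v
    using that mod_homD(1)[OF f]
    by (simp add: mod_hom_diff[OF free_module_pair L f] mod_homD(3)[OF f] L.M.a_diff_eq_zero_iff)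
  have ball_Collect3: "(\<forall>g\<in>{t a b c | a b c. Q a b c}. f g = \<zero>\<^bsub>L\<^esub>) \<longleftrightarrow>
      (\<forall>a b c. Q a b c \<longrightarrow> f (t a b c) = \<zero>\<^bsub>L\<^esub>)" for t :: "'i \<Rightarrow> 'j \<Rightarrow> 'k \<Rightarrow> _" and Q
    by blast
  show ?thesis
    unfolding tensor_rels_eq ball_Un ball_Collect3 bilinear_def mod_hom_def
    by (auto simp: diff_diff diff_smult basis_pair_closed mod_homD(1)[OF f])
qed

lemma submodule_tensor_rel: "submodule (tensor_rel_sub R A Y) R Fr"
  unfolding tensor_rel_sub_def by (rule Fr.submodule_gen[OF tensor_rels_closed])

lemma bilinear_kills_tensor_rel_sub:
  assumes L: "module R L" and f: "f \<in> mod_hom R Fr L"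
    and "bilinear R A Y L (\<lambda>a x. f (basis_vec R (a, x)))" and "g \<in> tensor_rel_sub R A Y"
  shows "f g = \<zero>\<^bsub>L\<^esub>"
proof -
  have "tensor_rel_sub R A Y \<subseteq> {g \<in> carrier Fr. f g = \<zero>\<^bsub>L\<^esub>}"
    unfolding tensor_rel_sub_def
    using assms(3) tensor_rels_closed bilinear_iff_kills_tensor_rels[OF L f]
    by (intro Fr.gen_submodule_least[OF submodule_kernel[OF free_module_pair L f]]) auto
  then show ?thesis using assms(4) by auto
qed

lemma tensor_is_module: "module R T"
  unfolding tensor_def by (rule Fr.quot_module_is_module[OF submodule_tensor_rel])

lemma tensor_proj_hom: "(\<lambda>g. tensor_rel_sub R A Y +>\<^bsub>Fr\<^esub> g) \<in> mod_hom R Fr T"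
  unfolding tensor_def by (rule Fr.quot_proj_hom[OF submodule_tensor_rel])

lemma tensor_proj_surj: "(\<lambda>g. tensor_rel_sub R A Y +>\<^bsub>Fr\<^esub> g) ` carrier Fr = carrier T"
  unfolding tensor_def by (rule Fr.quot_module_carrier[OF submodule_tensor_rel, symmetric])

lemma bilinear_pure_tensor: "bilinear R A Y T (pure_tensor R A Y)"
proof -
  have "tensor_rel_sub R A Y +>\<^bsub>Fr\<^esub> g = \<zero>\<^bsub>T\<^esub>" if "g \<in> tensor_rels R A Y" for g
  proof -
    have "g \<in> tensor_rel_sub R A Y"
      unfolding tensor_rel_sub_def using that Fr.gen_submodule_incl by blast
    then show ?thesis
      unfolding tensor_def using that tensor_rels_closed
      by (subst Fr.quot_proj_eq_zero_iff[OF submodule_tensor_rel]) auto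
  qed
  then show ?thesis
    using bilinear_iff_kills_tensor_rels[OF tensor_is_module tensor_proj_hom]
    by (simp add: pure_tensor_def[abs_def])
qed

lemmas pure_tensor_left_hom = bilinearD(1)[OF bilinear_pure_tensor]
  and pure_tensor_right_hom = bilinearD(2)[OF bilinear_pure_tensor]

lemma pure_tensor_closed: "a \<in> carrier A \<Longrightarrow> x \<in> carrier Y \<Longrightarrow> pure_tensor R A Y a x \<in> carrier T"
  by (rule mod_homD(1)[OF pure_tensor_right_hom])

lemma spans_tensor: "spans R T {pure_tensor R A Y a x | a x. a \<in> carrier A \<and> x \<in> carrier Y}"
proof -
  have "{pure_tensor R A Y a x | a x. a \<in> carrier A \<and> x \<in> carrier Y} =
      (\<lambda>g. tensor_rel_sub R A Y +>\<^bsub>Fr\<^esub> g) ` (basis_vec R ` (carrier A \<times> carrier Y))"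
    by (auto simp: pure_tensor_def)
  then show ?thesis
    using spans_image[OF free_module_pair tensor_is_module tensor_proj_hom tensor_proj_surj A.R.spans_free_module]
    by simp
qed

lemma tensor_universal:
  assumes L: "module R L" and \<phi>: "bilinear R A Y L \<phi>"
  obtains h where "h \<in> mod_hom R T L"
    "\<And>a x. a \<in> carrier A \<Longrightarrow> x \<in> carrier Y \<Longrightarrow> h (pure_tensor R A Y a x) = \<phi> a x"
proof -
  interpret L: module R L by fact
  define f where "f = lin_ext R L (\<lambda>(a, x). \<phi> a x)"
  have \<phi>_closed: "(\<lambda>(a, x). \<phi> a x) p \<in> carrier L" if "p \<in> carrier A \<times> carrier Y" for p
    using that mod_homD(1)[OF bilinearD(2)[OF \<phi>]] by auto
  have f: "f \<in> mod_hom R Fr L" unfolding f_def by (rule L.lin_ext_hom[OF \<phi>_closed])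
  have f_basis: "f (basis_vec R (a, x)) = \<phi> a x" if "a \<in> carrier A" "x \<in> carrier Y" for a x
    unfolding f_def using L.lin_ext_basis_vec[where p = "(a, x)", OF \<phi>_closed] that by simp
  have "bilinear R A Y L (\<lambda>a x. f (basis_vec R (a, x)))"
    using \<phi> by (simp add: bilinear_def mod_hom_def f_basis Pi_def)
  then have kills: "f g = \<zero>\<^bsub>L\<^esub>" if "g \<in> tensor_rel_sub R A Y" for g
    by (rule bilinear_kills_tensor_rel_sub[OF L f _ that])
  obtain h where h: "h \<in> mod_hom R T L" "\<And>g. g \<in> carrier Fr \<Longrightarrow> h (tensor_rel_sub R A Y +>\<^bsub>Fr\<^esub> g) = f g"
    using Fr.quot_lift[OF submodule_tensor_rel L f kills] unfolding tensor_def by blast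
  show ?thesis
    by (rule that[OF h(1)]) (simp add: pure_tensor_def h(2) f_basis basis_pair_closed)
qed

lemma tensor_hom_eq:
  assumes "module R L" "f \<in> mod_hom R T L" "g \<in> mod_hom R T L"
    and "\<And>a x. a \<in> carrier A \<Longrightarrow> x \<in> carrier Y \<Longrightarrow> f (pure_tensor R A Y a x) = g (pure_tensor R A Y a x)"
    and "t \<in> carrier T"
  shows "f t = g t"
  by (rule mod_hom_eq_on_span[OF tensor_is_module assms(1-3) spans_tensor _ assms(5)]) (use assms(4) in blast)

lemma spans_pure_tensors:
  assumes G: "spans R A G" and H: "spans R Y H"
  shows "spans R T ((\<lambda>(a, x). pure_tensor R A Y a x) ` (G \<times> H))"
proof (rule module.spansI[OF tensor_is_module])
  note GA = spans_subset_carrier[OF G] and HY = spans_subset_carrier[OF H]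
  show "(\<lambda>(a, x). pure_tensor R A Y a x) ` (G \<times> H) \<subseteq> carrier T"
    using GA HY by (auto intro: pure_tensor_closed)
  fix D assume D: "submodule D R T" and GH: "(\<lambda>(a, x). pure_tensor R A Y a x) ` (G \<times> H) \<subseteq> D"
  have G_mem: "pure_tensor R A Y a x \<in> D" if a: "a \<in> G" and x: "x \<in> carrier Y" for a x
  proof -
    have "submodule {x \<in> carrier Y. pure_tensor R A Y a x \<in> D} R Y"
      by (rule submodule_preimage[OF Y.module_axioms tensor_is_module pure_tensor_right_hom D]) (use a GA in blast)
    then have "carrier Y \<subseteq> {x \<in> carrier Y. pure_tensor R A Y a x \<in> D}"
      by (rule spans_least[OF H]) (use GH a HY in auto)
    then show ?thesis using x by blast
  qed
  have "pure_tensor R A Y a x \<in> D" if a: "a \<in> carrier A" and x: "x \<in> carrier Y" for a x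
  proof -
    have "submodule {a \<in> carrier A. pure_tensor R A Y a x \<in> D} R A"
      by (rule submodule_preimage[OF A.module_axioms tensor_is_module pure_tensor_left_hom[OF x] D])
    then have "carrier A \<subseteq> {a \<in> carrier A. pure_tensor R A Y a x \<in> D}"
      by (rule spans_least[OF G]) (use G_mem x GA in auto)
    then show ?thesis using a by blast
  qed
  then show "carrier T \<subseteq> D" by (intro spans_least[OF spans_tensor D]) auto
qed

lemma fin_gen_tensor:
  assumes "fin_gen_module R A" "fin_gen_module R Y"
  shows "fin_gen_module R T"
proof -
  obtain G H where "finite G" "spans R A G" "finite H" "spans R Y H"
    using assms unfolding fin_gen_module_iff_spans by blast
  then show ?thesis
    unfolding fin_gen_module_iff_spans
    by (intro exI[of _ "(\<lambda>(a, x). pure_tensor R A Y a x) ` (G \<times> H)"]) (simp add: spans_pure_tensors)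
qed

end

lemma module_pairI: "module R A \<Longrightarrow> module R Y \<Longrightarrow> module_pair R A Y"
  by (simp add: module_pair_def)

context
  fixes R :: "('r,'c) ring_scheme" and A :: "('r,'a,'d) module_scheme" and B :: "('r,'b,'e) module_scheme"
    and Y :: "('r,'x,'f) module_scheme" and f
  assumes mA: "module R A" and mB: "module R B" and mY: "module R Y" and f: "f \<in> mod_hom R A B"
begin

interpretation A: module_pair R A Y by (rule module_pairI[OF mA mY])
interpretation B: module_pair R B Y by (rule module_pairI[OF mB mY])

lemma coset_push_fwd_hom: "(\<lambda>g. tensor_rel_sub R B Y +>\<^bsub>B.Fr\<^esub> push_fwd R f g) \<in> mod_hom R A.Fr B.T"
  by (rule mod_hom_compose[OF A.R.push_fwd_hom[OF mod_homD(1)[OF f]] B.tensor_proj_hom])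

lemma coset_push_fwd_basis_vec:
  "a \<in> carrier A \<Longrightarrow> x \<in> carrier Y \<Longrightarrow>
    tensor_rel_sub R B Y +>\<^bsub>B.Fr\<^esub> push_fwd R f (basis_vec R (a, x)) = pure_tensor R B Y (f a) x"
  by (simp add: A.R.push_fwd_basis_vec[OF mod_homD(1)[OF f]] pure_tensor_def)

lemma coset_push_fwd_tensor_rel:
  assumes "g \<in> tensor_rel_sub R A Y"
  shows "tensor_rel_sub R B Y +>\<^bsub>B.Fr\<^esub> push_fwd R f g = \<zero>\<^bsub>B.T\<^esub>"
proof (rule A.bilinear_kills_tensor_rel_sub[OF B.tensor_is_module coset_push_fwd_hom _ assms])
  have "bilinear R A Y B.T (\<lambda>a x. pure_tensor R B Y (f a) x)"
    by (rule bilinear_compose[OF B.bilinear_pure_tensor f]) (simp_all add: mod_hom_def)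
  then show "bilinear R A Y B.T (\<lambda>a x. tensor_rel_sub R B Y +>\<^bsub>B.Fr\<^esub> push_fwd R f (basis_vec R (a, x)))"
    by (simp add: bilinear_def mod_hom_def coset_push_fwd_basis_vec Pi_def)
qed

lemma tensor_map_coset:
  assumes g: "g \<in> carrier A.Fr"
  shows "tensor_map R B Y f (tensor_rel_sub R A Y +>\<^bsub>A.Fr\<^esub> g) = tensor_rel_sub R B Y +>\<^bsub>B.Fr\<^esub> push_fwd R f g"
  unfolding tensor_map_def
proof (rule SUP_eq_const)
  note N = A.submodule_tensor_rel and h = coset_push_fwd_hom
  interpret BT: module R B.T by (rule B.tensor_is_module)
  show "tensor_rel_sub R A Y +>\<^bsub>A.Fr\<^esub> g \<noteq> {}" using A.Fr.coset_self[OF N g] by blast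
  fix g' assume g': "g' \<in> tensor_rel_sub R A Y +>\<^bsub>A.Fr\<^esub> g"
  then have c: "g' \<in> carrier A.Fr" using A.Fr.coset_subset_carrier[OF N g] by (rule subsetD[rotated])
  then have "g' \<ominus>\<^bsub>A.Fr\<^esub> g \<in> tensor_rel_sub R A Y" using g' A.Fr.coset_mem_iff[OF N g c] by simp
  from coset_push_fwd_tensor_rel[OF this]
  show "tensor_rel_sub R B Y +>\<^bsub>B.Fr\<^esub> push_fwd R f g' = tensor_rel_sub R B Y +>\<^bsub>B.Fr\<^esub> push_fwd R f g"
    using mod_hom_diff[OF A.free_module_pair B.tensor_is_module h c g] BT.M.a_diff_eq_zero_iff
      mod_homD(1)[OF h c] mod_homD(1)[OF h g] by simp
qed

lemma tensor_map_hom: "tensor_map R B Y f \<in> mod_hom R (tensor R A Y) (tensor R B Y)"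
proof -
  obtain h where h: "h \<in> mod_hom R A.T B.T"
    "\<And>g. g \<in> carrier A.Fr \<Longrightarrow>
      h (tensor_rel_sub R A Y +>\<^bsub>A.Fr\<^esub> g) = tensor_rel_sub R B Y +>\<^bsub>B.Fr\<^esub> push_fwd R f g"
    using A.Fr.quot_lift[OF A.submodule_tensor_rel B.tensor_is_module coset_push_fwd_hom coset_push_fwd_tensor_rel]
    unfolding tensor_def[of R A] by blast
  then have tensor_map_eq: "tensor_map R B Y f t = h t" if "t \<in> carrier A.T" for t
    using that tensor_map_coset unfolding A.tensor_proj_surj[symmetric] by auto
  interpret TA: module R A.T by (rule A.tensor_is_module)
  show ?thesis by (rule mod_homI) (simp_all add: tensor_map_eq mod_homD[OF h(1)])
qed

lemma tensor_map_pure_tensor: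
  "a \<in> carrier A \<Longrightarrow> x \<in> carrier Y \<Longrightarrow>
     tensor_map R B Y f (pure_tensor R A Y a x) = pure_tensor R B Y (f a) x"
  using tensor_map_coset[OF A.basis_pair_closed] coset_push_fwd_basis_vec by (simp add: pure_tensor_def)

end

section \<open>Right exactness of the tensor product\<close>

definition is_right_tensor_map :: "('r,'c) ring_scheme \<Rightarrow> ('r,'a,'d) module_scheme \<Rightarrow> ('r,'x,'e) module_scheme
    \<Rightarrow> ('r,'y,'f) module_scheme \<Rightarrow> ('x \<Rightarrow> 'y) \<Rightarrow> (('a \<times> 'x \<Rightarrow> 'r) set \<Rightarrow> ('a \<times> 'y \<Rightarrow> 'r) set) \<Rightarrow> bool"
  where "is_right_tensor_map R A Y Y' p q \<longleftrightarrow> q \<in> mod_hom R (tensor R A Y) (tensor R A Y') \<and>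
     (\<forall>a\<in>carrier A. \<forall>y\<in>carrier Y. q (pure_tensor R A Y a y) = pure_tensor R A Y' a (p y))"

lemma is_right_tensor_mapD:
  assumes "is_right_tensor_map R A Y Y' p q"
  shows "q \<in> mod_hom R (tensor R A Y) (tensor R A Y')"
    and "a \<in> carrier A \<Longrightarrow> y \<in> carrier Y \<Longrightarrow> q (pure_tensor R A Y a y) = pure_tensor R A Y' a (p y)"
  using assms by (auto simp: is_right_tensor_map_def)

lemma right_tensor_map_exists:
  assumes mA: "module R A" and mY: "module R Y" and mY': "module R Y'" and p: "p \<in> mod_hom R Y Y'"
  obtains q where "is_right_tensor_map R A Y Y' p q"
proof -
  interpret Y: module_pair R A Y by (rule module_pairI[OF mA mY])
  interpret Y': module_pair R A Y' by (rule module_pairI[OF mA mY'])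
  have "bilinear R A Y Y'.T (\<lambda>a y. pure_tensor R A Y' a (p y))"
    by (rule bilinear_compose[OF Y'.bilinear_pure_tensor _ p]) (simp_all add: mod_hom_def)
  then obtain q where "q \<in> mod_hom R Y.T Y'.T"
    "\<And>a y. a \<in> carrier A \<Longrightarrow> y \<in> carrier Y \<Longrightarrow> q (pure_tensor R A Y a y) = pure_tensor R A Y' a (p y)"
    by (rule Y.tensor_universal[OF Y'.tensor_is_module]) (rule that)
  then show ?thesis by (intro that[of q]) (simp add: is_right_tensor_map_def)
qed

lemma right_tensor_map_natural:
  assumes mA: "module R A" and mB: "module R B" and mY: "module R Y" and mY': "module R Y'"
    and f: "f \<in> mod_hom R A B" and p: "p \<in> mod_hom R Y Y'"
    and qA: "is_right_tensor_map R A Y Y' p qA" and qB: "is_right_tensor_map R B Y Y' p qB"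
    and t: "t \<in> carrier (tensor R A Y)"
  shows "qB (tensor_map R B Y f t) = tensor_map R B Y' f (qA t)"
proof -
  interpret AY: module_pair R A Y by (rule module_pairI[OF mA mY])
  interpret BY': module_pair R B Y' by (rule module_pairI[OF mB mY'])
  note fY = tensor_map_hom[OF mA mB mY f] tensor_map_pure_tensor[OF mA mB mY f]
    and fY' = tensor_map_hom[OF mA mB mY' f] tensor_map_pure_tensor[OF mA mB mY' f]
  show ?thesis
  proof (rule AY.tensor_hom_eq[OF BY'.tensor_is_module _ _ _ t])
    show "(\<lambda>t. qB (tensor_map R B Y f t)) \<in> mod_hom R AY.T BY'.T"
      by (rule mod_hom_compose[OF fY(1) is_right_tensor_mapD(1)[OF qB]])
    show "(\<lambda>t. tensor_map R B Y' f (qA t)) \<in> mod_hom R AY.T BY'.T"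
      by (rule mod_hom_compose[OF is_right_tensor_mapD(1)[OF qA] fY'(1)])
  qed (simp add: fY(2) fY'(2) is_right_tensor_mapD(2)[OF qA] is_right_tensor_mapD(2)[OF qB]
      mod_homD(1)[OF f] mod_homD(1)[OF p])
qed

context
  fixes R :: "('r,'c) ring_scheme" and A :: "('r,'a,'d) module_scheme"
    and Y :: "('r,'x,'e) module_scheme" and Y' :: "('r,'y,'f) module_scheme" and p q
  assumes mA: "module R A" and mY: "module R Y" and mY': "module R Y'"
    and p: "p \<in> mod_hom R Y Y'" and surj: "p ` carrier Y = carrier Y'"
    and q: "is_right_tensor_map R A Y Y' p q"
begin

interpretation Y: module_pair R A Y by (rule module_pairI[OF mA mY])
interpretation Y': module_pair R A Y' by (rule module_pairI[OF mA mY'])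

lemma right_tensor_map_surj: "q ` carrier (tensor R A Y) = carrier (tensor R A Y')"
proof
  note q_hom = is_right_tensor_mapD(1)[OF q]
  show "q ` carrier Y.T \<subseteq> carrier Y'.T" using mod_homD(1)[OF q_hom] by auto
  have "pure_tensor R A Y' a y' \<in> q ` carrier Y.T" if a: "a \<in> carrier A" and y': "y' \<in> carrier Y'" for a y'
  proof -
    obtain y where y: "y \<in> carrier Y" "y' = p y" using y' surj by blast
    show ?thesis
      unfolding y(2) is_right_tensor_mapD(2)[OF q a y(1), symmetric]
      by (rule imageI[OF Y.pure_tensor_closed[OF a y(1)]])
  qed
  then show "carrier Y'.T \<subseteq> q ` carrier Y.T"
    by (intro spans_least[OF Y'.spans_tensor]
        submodule_image[OF Y.tensor_is_module Y'.tensor_is_module q_hom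
          module.carrier_is_submodule[OF Y.tensor_is_module]])
       auto
qed

text \<open>The inverse \<open>A \<otimes> Y' \<rightarrow> (A \<otimes> Y)/E\<close> of the map induced by \<open>q\<close> sends \<open>a \<otimes> p y\<close> to the class of \<open>a \<otimes> y\<close>.\<close>
lemma tensor_quotient_hom_exists:
  assumes E: "submodule E R (tensor R A Y)"
    and kernel_E: "\<And>a y. a \<in> carrier A \<Longrightarrow> y \<in> carrier Y \<Longrightarrow> p y = \<zero>\<^bsub>Y'\<^esub> \<Longrightarrow> pure_tensor R A Y a y \<in> E"
  obtains h where "h \<in> mod_hom R (tensor R A Y') (quot_module R (tensor R A Y) E)"
    "\<And>t. t \<in> carrier (tensor R A Y) \<Longrightarrow> h (q t) = E +>\<^bsub>tensor R A Y\<^esub> t"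
proof -
  interpret T: module R Y.T by (rule Y.tensor_is_module)
  define Q where "Q = quot_module R Y.T E"
  define \<pi> where "\<pi> t = E +>\<^bsub>Y.T\<^esub> t" for t
  have mQ: "module R Q" unfolding Q_def by (rule T.quot_module_is_module[OF E])
  have \<pi>: "\<pi> \<in> mod_hom R Y.T Q" unfolding \<pi>_def Q_def by (rule T.quot_proj_hom[OF E])
  define \<theta> where "\<theta> a y = \<pi> (pure_tensor R A Y a y)" for a y
  have \<theta>: "bilinear R A Y Q \<theta>"
    unfolding \<theta>_def by (rule bilinear_compose[OF Y.bilinear_pure_tensor _ _ \<pi>]) (simp_all add: mod_hom_def)
  have "\<exists>\<psi>. \<psi> \<in> mod_hom R Y' Q \<and> (\<forall>y\<in>carrier Y. \<psi> (p y) = \<theta> a y)" if a: "a \<in> carrier A" for a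
  proof (rule mod_hom_factor[OF mY mY' mQ p surj bilinearD(2)[OF \<theta> a]])
    show "\<theta> a y = \<zero>\<^bsub>Q\<^esub>" if "y \<in> carrier Y" "p y = \<zero>\<^bsub>Y'\<^esub>" for y
      using kernel_E[OF a that] T.quot_proj_eq_zero_iff[OF E Y.pure_tensor_closed[OF a that(1)]]
      by (simp add: \<theta>_def \<pi>_def Q_def)
  qed blast
  then obtain \<psi> where \<psi>: "\<And>a. a \<in> carrier A \<Longrightarrow> \<psi> a \<in> mod_hom R Y' Q"
    "\<And>a y. a \<in> carrier A \<Longrightarrow> y \<in> carrier Y \<Longrightarrow> \<psi> a (p y) = \<theta> a y" by metis
  have "(\<lambda>a. \<psi> a y') \<in> mod_hom R A Q" if y': "y' \<in> carrier Y'" for y'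
  proof -
    obtain y where y: "y \<in> carrier Y" "y' = p y" using y' surj by blast
    interpret A: module R A by (rule mA)
    show ?thesis
      unfolding y(2) by (rule mod_homI) (simp_all add: \<psi>(2) y(1) mod_homD[OF bilinearD(1)[OF \<theta>]])
  qed
  then have "bilinear R A Y' Q \<psi>" using \<psi>(1) by (simp add: bilinear_def)
  then obtain h where h: "h \<in> mod_hom R Y'.T Q"
    "\<And>a y. a \<in> carrier A \<Longrightarrow> y \<in> carrier Y' \<Longrightarrow> h (pure_tensor R A Y' a y) = \<psi> a y"
    by (rule Y'.tensor_universal[OF mQ]) (rule that)
  have "h (q t) = \<pi> t" if "t \<in> carrier Y.T" for t
    by (rule Y.tensor_hom_eq[OF mQ mod_hom_compose[OF is_right_tensor_mapD(1)[OF q] h(1)] \<pi> _ that])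
       (simp add: is_right_tensor_mapD(2)[OF q] h(2) \<psi>(2) mod_homD(1)[OF p] \<theta>_def)
  then show ?thesis using h(1) that unfolding Q_def \<pi>_def by blast
qed

lemma right_tensor_map_eq_zero_iff:
  assumes "t \<in> carrier (tensor R A Y)"
  shows "q t = \<zero>\<^bsub>tensor R A Y'\<^esub> \<longleftrightarrow>
    t \<in> gen_submodule R (tensor R A Y) {pure_tensor R A Y a y | a y. a \<in> carrier A \<and> y \<in> carrier Y \<and> p y = \<zero>\<^bsub>Y'\<^esub>}"
    (is "_ \<longleftrightarrow> t \<in> gen_submodule R _ ?G")
proof
  interpret T: module R Y.T by (rule Y.tensor_is_module)
  note q_hom = is_right_tensor_mapD(1)[OF q] and mT = Y.tensor_is_module and mT' = Y'.tensor_is_module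
  have GT: "?G \<subseteq> carrier Y.T" by (auto intro: Y.pure_tensor_closed)
  note E = T.submodule_gen[OF GT]
  { assume qt: "q t = \<zero>\<^bsub>Y'.T\<^esub>"
    obtain h where h: "h \<in> mod_hom R Y'.T (quot_module R Y.T (gen_submodule R Y.T ?G))"
      "\<And>t. t \<in> carrier Y.T \<Longrightarrow> h (q t) = gen_submodule R Y.T ?G +>\<^bsub>Y.T\<^esub> t"
      by (rule tensor_quotient_hom_exists[OF E]) (use T.gen_submodule_incl[of ?G] in blast, rule that)
    have "gen_submodule R Y.T ?G +>\<^bsub>Y.T\<^esub> t = \<zero>\<^bsub>quot_module R Y.T (gen_submodule R Y.T ?G)\<^esub>"
      using h(2)[OF assms] mod_hom_zero[OF mT' T.quot_module_is_module[OF E] h(1)] qt by simp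
    then show "t \<in> gen_submodule R Y.T ?G" using T.quot_proj_eq_zero_iff[OF E assms] by simp }
  { assume t: "t \<in> gen_submodule R Y.T ?G"
    have "pure_tensor R A Y' a \<zero>\<^bsub>Y'\<^esub> = \<zero>\<^bsub>Y'.T\<^esub>" if "a \<in> carrier A" for a
      by (rule mod_hom_zero[OF mY' mT' Y'.pure_tensor_right_hom[OF that]])
    then have "?G \<subseteq> {t \<in> carrier Y.T. q t = \<zero>\<^bsub>Y'.T\<^esub>}"
      using is_right_tensor_mapD(2)[OF q] by (auto intro: Y.pure_tensor_closed)
    then have "gen_submodule R Y.T ?G \<subseteq> {t \<in> carrier Y.T. q t = \<zero>\<^bsub>Y'.T\<^esub>}"
      by (rule T.gen_submodule_least[OF submodule_kernel[OF mT mT' q_hom]])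
    then show "q t = \<zero>\<^bsub>Y'.T\<^esub>" using t by blast }
qed

end

lemma (in module_pair) gen_pure_tensors_ideal_smult:
  assumes J: "J \<subseteq> carrier R"
  shows "gen_submodule R T {pure_tensor R A Y a y | a y. a \<in> carrier A \<and> y \<in> ideal_smult R J Y} = ideal_smult R J T"
    (is "gen_submodule R T ?G = _")
proof
  interpret T: module R T by (rule tensor_is_module)
  note JT = T.submodule_ideal_smult[OF J] and JY = Y.submodule_ideal_smult[OF J]
  have smult_pure: "r \<odot>\<^bsub>T\<^esub> pure_tensor R A Y a y = pure_tensor R A Y a (r \<odot>\<^bsub>Y\<^esub> y)"
    if "a \<in> carrier A" "y \<in> carrier Y" "r \<in> J" for r a y
    using mod_homD(3)[OF pure_tensor_right_hom[OF that(1)]] that J by auto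
  have "ideal_smult R J Y \<subseteq> {y \<in> carrier Y. pure_tensor R A Y a y \<in> ideal_smult R J T}"
    if a: "a \<in> carrier A" for a
    unfolding ideal_smult_eq_set_smult[of R J Y]
  proof (rule Y.set_smult_least)
    show "submodule {y \<in> carrier Y. pure_tensor R A Y a y \<in> ideal_smult R J T} R Y"
      by (rule submodule_preimage[OF Y.module_axioms tensor_is_module pure_tensor_right_hom[OF a] JT])
    fix r y assume r: "r \<in> J" and y: "y \<in> carrier Y"
    have "r \<odot>\<^bsub>T\<^esub> pure_tensor R A Y a y \<in> ideal_smult R J T"
      unfolding ideal_smult_eq_set_smult by (rule T.set_smult_incl[OF r pure_tensor_closed[OF a y]])
    then show "r \<odot>\<^bsub>Y\<^esub> y \<in> {y \<in> carrier Y. pure_tensor R A Y a y \<in> ideal_smult R J T}"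
      using r y a J smult_pure by auto
  qed
  then show "gen_submodule R T ?G \<subseteq> ideal_smult R J T" by (intro T.gen_submodule_least[OF JT]) blast
  have "?G \<subseteq> carrier T" using Y.submoduleD(1)[OF JY] by (auto intro: pure_tensor_closed)
  note G = T.submodule_gen[OF this]
  have "carrier T \<subseteq> {t \<in> carrier T. r \<odot>\<^bsub>T\<^esub> t \<in> gen_submodule R T ?G}" if r: "r \<in> J" for r
  proof (rule spans_least[OF spans_tensor T.submodule_smult_vimage[OF G]])
    have "r \<odot>\<^bsub>Y\<^esub> y \<in> ideal_smult R J Y" if "y \<in> carrier Y" for y
      unfolding ideal_smult_eq_set_smult by (rule Y.set_smult_incl[OF r that])
    then have "r \<odot>\<^bsub>T\<^esub> pure_tensor R A Y a y \<in> gen_submodule R T ?G" if "a \<in> carrier A" "y \<in> carrier Y" for a y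
      unfolding smult_pure[OF that r] using that by (intro subsetD[OF T.gen_submodule_incl]) blast
    then show "{pure_tensor R A Y a y | a y. a \<in> carrier A \<and> y \<in> carrier Y}
        \<subseteq> {t \<in> carrier T. r \<odot>\<^bsub>T\<^esub> t \<in> gen_submodule R T ?G}"
      using pure_tensor_closed by blast
  qed (use r J in blast)
  then show "ideal_smult R J T \<subseteq> gen_submodule R T ?G"
    unfolding ideal_smult_eq_set_smult[of R J T] by (intro T.set_smult_least[OF G]) blast
qed

lemma tensor_quot_ideal_smult:
  assumes mA: "module R A" and mM: "module R M" and J: "J \<subseteq> carrier R"
  defines "Y \<equiv> quot_module R M (ideal_smult R J M)"
  obtains q where "is_right_tensor_map R A M Y (\<lambda>m. ideal_smult R J M +>\<^bsub>M\<^esub> m) q"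
    "q ` carrier (tensor R A M) = carrier (tensor R A Y)"
    "\<And>t. t \<in> carrier (tensor R A M) \<Longrightarrow> q t = \<zero>\<^bsub>tensor R A Y\<^esub> \<longleftrightarrow> t \<in> ideal_smult R J (tensor R A M)"
proof -
  interpret M: module R M by fact
  interpret AM: module_pair R A M by (rule module_pairI[OF mA mM])
  note JM = M.submodule_ideal_smult[OF J]
  have mY: "module R Y" unfolding Y_def by (rule M.quot_module_is_module[OF JM])
  define p where "p m = ideal_smult R J M +>\<^bsub>M\<^esub> m" for m
  have p: "p \<in> mod_hom R M Y" unfolding p_def Y_def by (rule M.quot_proj_hom[OF JM])
  have surj: "p ` carrier M = carrier Y" unfolding p_def Y_def by (rule M.quot_module_carrier[OF JM, symmetric])
  have "m \<in> carrier M \<and> p m = \<zero>\<^bsub>Y\<^esub> \<longleftrightarrow> m \<in> ideal_smult R J M" for m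
    using M.quot_proj_eq_zero_iff[OF JM] M.submoduleD(1)[OF JM] unfolding p_def Y_def by blast
  then have kernel: "{pure_tensor R A M a m | a m. a \<in> carrier A \<and> m \<in> carrier M \<and> p m = \<zero>\<^bsub>Y\<^esub>} =
      {pure_tensor R A M a m | a m. a \<in> carrier A \<and> m \<in> ideal_smult R J M}" by simp
  obtain q where q: "is_right_tensor_map R A M Y p q" by (rule right_tensor_map_exists[OF mA mM mY p])
  show ?thesis
  proof (rule that[OF q[unfolded p_def] right_tensor_map_surj[OF mA mM mY p surj q]])
    show "q t = \<zero>\<^bsub>tensor R A Y\<^esub> \<longleftrightarrow> t \<in> ideal_smult R J (tensor R A M)" if "t \<in> carrier (tensor R A M)" for t
      using right_tensor_map_eq_zero_iff[OF mA mM mY p surj q that]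
      unfolding kernel AM.gen_pure_tensors_ideal_smult[OF J] .
  qed
qed

section \<open>Associated primes of the functor\<close>

lemma tensor_map_complex:
  assumes mA: "module R A" and mB: "module R B" and mC: "module R C" and mY: "module R Y"
    and \<alpha>: "\<alpha> \<in> mod_hom R A B" and \<beta>: "\<beta> \<in> mod_hom R B C"
    and complex: "\<And>a. a \<in> carrier A \<Longrightarrow> \<beta> (\<alpha> a) = \<zero>\<^bsub>C\<^esub>" and t: "t \<in> carrier (tensor R A Y)"
  shows "tensor_map R C Y \<beta> (tensor_map R B Y \<alpha> t) = \<zero>\<^bsub>tensor R C Y\<^esub>"
proof -
  interpret AY: module_pair R A Y by (rule module_pairI[OF mA mY])
  interpret CY: module_pair R C Y by (rule module_pairI[OF mC mY])
  interpret T: module R CY.T by (rule CY.tensor_is_module)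
  note \<alpha>Y = tensor_map_hom[OF mA mB mY \<alpha>] tensor_map_pure_tensor[OF mA mB mY \<alpha>]
    and \<beta>Y = tensor_map_hom[OF mB mC mY \<beta>] tensor_map_pure_tensor[OF mB mC mY \<beta>]
  have zero: "(\<lambda>_. \<zero>\<^bsub>CY.T\<^esub>) \<in> mod_hom R AY.T CY.T" by (rule mod_homI) auto
  show ?thesis
  proof (rule AY.tensor_hom_eq[OF CY.tensor_is_module mod_hom_compose[OF \<alpha>Y(1) \<beta>Y(1)] zero _ t])
    fix a y assume a: "a \<in> carrier A" and y: "y \<in> carrier Y"
    have "tensor_map R C Y \<beta> (tensor_map R B Y \<alpha> (pure_tensor R A Y a y)) = pure_tensor R C Y \<zero>\<^bsub>C\<^esub> y"
      using \<alpha>Y(2)[OF a y] \<beta>Y(2)[OF mod_homD(1)[OF \<alpha> a] y] complex[OF a] by simp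
    also have "\<dots> = \<zero>\<^bsub>CY.T\<^esub>"
      by (rule mod_hom_zero[OF mC CY.tensor_is_module CY.pure_tensor_left_hom[OF y]])
    finally show "tensor_map R C Y \<beta> (tensor_map R B Y \<alpha> (pure_tensor R A Y a y)) = \<zero>\<^bsub>CY.T\<^esub>" .
  qed
qed

locale module_complex = A: module R A + B: module R B + C: module R C
  for R :: "('r,'c) ring_scheme" (structure) and A :: "('r,'a,'d1) module_scheme"
    and B :: "('r,'b,'d2) module_scheme" and C :: "('r,'g,'d3) module_scheme" +
  fixes \<alpha> :: "'a \<Rightarrow> 'b" and \<beta> :: "'b \<Rightarrow> 'g"
  assumes \<alpha>_hom: "\<alpha> \<in> mod_hom R A B" and \<beta>_hom: "\<beta> \<in> mod_hom R B C"
    and complex: "a \<in> carrier A \<Longrightarrow> \<beta> (\<alpha> a) = \<zero>\<^bsub>C\<^esub>"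
begin

abbreviation im_tensor :: "('r,'x,'y) module_scheme \<Rightarrow> ('b \<times> 'x \<Rightarrow> 'r) set set"
  where "im_tensor Y \<equiv> tensor_map R B Y \<alpha> ` carrier (tensor R A Y)"

abbreviation ker_tensor :: "('r,'x,'y) module_scheme \<Rightarrow> ('b \<times> 'x \<Rightarrow> 'r) set set"
  where "ker_tensor Y \<equiv> {t \<in> carrier (tensor R B Y). tensor_map R C Y \<beta> t = \<zero>\<^bsub>tensor R C Y\<^esub>}"

definition coker_tensor :: "('r,'x,'y) module_scheme \<Rightarrow> ('r, ('b \<times> 'x \<Rightarrow> 'r) set set) module"
  where "coker_tensor Y = quot_module R (tensor R B Y) (im_tensor Y)"

definition coker_proj :: "('r,'x,'y) module_scheme \<Rightarrow> ('b \<times> 'x \<Rightarrow> 'r) set \<Rightarrow> ('b \<times> 'x \<Rightarrow> 'r) set set"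
  where "coker_proj Y t = im_tensor Y +>\<^bsub>tensor R B Y\<^esub> t"

context
  fixes Y :: "('r,'x,'y) module_scheme" assumes mY: "module R Y"
begin

interpretation AY: module_pair R A Y by (rule module_pairI[OF A.module_axioms mY])
interpretation BY: module_pair R B Y by (rule module_pairI[OF B.module_axioms mY])
interpretation CY: module_pair R C Y by (rule module_pairI[OF C.module_axioms mY])

lemmas \<alpha>_tensor_hom = tensor_map_hom[OF A.module_axioms B.module_axioms mY \<alpha>_hom]
  and \<beta>_tensor_hom = tensor_map_hom[OF B.module_axioms C.module_axioms mY \<beta>_hom]

lemma submodule_im_tensor: "submodule (im_tensor Y) R (tensor R B Y)"
  by (rule submodule_image[OF AY.tensor_is_module BY.tensor_is_module \<alpha>_tensor_hom
        module.carrier_is_submodule[OF AY.tensor_is_module]])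

lemma coker_tensor_is_module: "module R (coker_tensor Y)"
  unfolding coker_tensor_def by (rule module.quot_module_is_module[OF BY.tensor_is_module submodule_im_tensor])

lemma coker_proj_hom: "coker_proj Y \<in> mod_hom R (tensor R B Y) (coker_tensor Y)"
  unfolding coker_tensor_def coker_proj_def[abs_def]
  by (rule module.quot_proj_hom[OF BY.tensor_is_module submodule_im_tensor])

lemma coker_proj_surj: "coker_proj Y ` carrier (tensor R B Y) = carrier (coker_tensor Y)"
  unfolding coker_tensor_def coker_proj_def[abs_def]
  by (rule module.quot_module_carrier[OF BY.tensor_is_module submodule_im_tensor, symmetric])

lemma coker_proj_eq_iff:
  "s \<in> carrier (tensor R B Y) \<Longrightarrow> t \<in> carrier (tensor R B Y) \<Longrightarrow>
     coker_proj Y s = coker_proj Y t \<longleftrightarrow> s \<ominus>\<^bsub>tensor R B Y\<^esub> t \<in> im_tensor Y"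
  unfolding coker_proj_def by (rule module.coset_eq_iff[OF BY.tensor_is_module submodule_im_tensor])

lemma \<beta>_tensor_im_tensor:
  assumes "t \<in> im_tensor Y"
  shows "tensor_map R C Y \<beta> t = \<zero>\<^bsub>tensor R C Y\<^esub>"
  using assms
    tensor_map_complex[OF A.module_axioms B.module_axioms C.module_axioms mY \<alpha>_hom \<beta>_hom complex] by auto

lemma coker_tensor_map_exists:
  obtains \<gamma> where "\<gamma> \<in> mod_hom R (coker_tensor Y) (tensor R C Y)"
    "\<And>t. t \<in> carrier (tensor R B Y) \<Longrightarrow> \<gamma> (coker_proj Y t) = tensor_map R C Y \<beta> t"
  unfolding coker_tensor_def coker_proj_def
  using module.quot_lift[OF BY.tensor_is_module submodule_im_tensor CY.tensor_is_module
      \<beta>_tensor_hom \<beta>_tensor_im_tensor]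
  by blast

lemma submodule_ker_tensor: "submodule (ker_tensor Y) R (tensor R B Y)"
  by (rule submodule_kernel[OF BY.tensor_is_module CY.tensor_is_module \<beta>_tensor_hom])

lemma im_tensor_subset_ker_tensor: "im_tensor Y \<subseteq> ker_tensor Y"
  using \<beta>_tensor_im_tensor module.submoduleD(1)[OF BY.tensor_is_module submodule_im_tensor] by blast

end

lemma complex_functor_eq:
  "complex_functor R A B C \<alpha> \<beta> Y = quot_module R ((tensor R B Y)\<lparr>carrier := ker_tensor Y\<rparr>) (im_tensor Y)"
  by (simp add: complex_functor_def Let_def)

lemma right_tensor_map_mem_im_tensor_iff:
  assumes mM: "module R M" and mY: "module R Y" and p: "p \<in> mod_hom R M Y" and J: "J \<subseteq> carrier R"
    and qA: "is_right_tensor_map R A M Y p qA" "qA ` carrier (tensor R A M) = carrier (tensor R A Y)"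
    and qB: "is_right_tensor_map R B M Y p qB"
    and qB_zero: "\<And>t. t \<in> carrier (tensor R B M) \<Longrightarrow>
      qB t = \<zero>\<^bsub>tensor R B Y\<^esub> \<longleftrightarrow> t \<in> ideal_smult R J (tensor R B M)"
    and u: "u \<in> carrier (tensor R B M)"
  shows "qB u \<in> im_tensor Y \<longleftrightarrow> coker_proj M u \<in> ideal_smult R J (coker_tensor M)"
proof -
  interpret BM: module_pair R B M by (rule module_pairI[OF B.module_axioms mM])
  interpret BY: module_pair R B Y by (rule module_pairI[OF B.module_axioms mY])
  interpret U: module R BM.T by (rule BM.tensor_is_module)
  interpret TY: module R BY.T by (rule BY.tensor_is_module)
  note qB_hom = is_right_tensor_mapD(1)[OF qB] and im_closed = U.submoduleD(1)[OF submodule_im_tensor[OF mM]]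
  note qB_diff = mod_hom_diff[OF BM.tensor_is_module BY.tensor_is_module qB_hom]
  have JU: "ideal_smult R J BM.T \<subseteq> carrier BM.T"
    using U.submoduleD(1)[OF U.submodule_ideal_smult[OF J]] by blast
  note J_coker = mod_hom_image_ideal_smult[OF BM.tensor_is_module coker_tensor_is_module[OF mM]
      coker_proj_hom[OF mM] J coker_proj_surj[OF mM], symmetric]
  have "qB (tensor_map R B M \<alpha> s) = tensor_map R B Y \<alpha> (qA s)" if "s \<in> carrier (tensor R A M)" for s
    by (rule right_tensor_map_natural[OF A.module_axioms B.module_axioms mM mY \<alpha>_hom p qA(1) qB that])
  then have im_Y: "im_tensor Y = qB ` im_tensor M"
    unfolding qA(2)[symmetric] image_image by (rule image_cong[OF refl, symmetric])
  have "qB u \<in> qB ` im_tensor M \<longleftrightarrow> (\<exists>v\<in>im_tensor M. u \<ominus>\<^bsub>BM.T\<^esub> v \<in> ideal_smult R J BM.T)"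
  proof -
    have "qB u = qB v \<longleftrightarrow> u \<ominus>\<^bsub>BM.T\<^esub> v \<in> ideal_smult R J BM.T" if "v \<in> carrier BM.T" for v
      using qB_zero[of "u \<ominus>\<^bsub>BM.T\<^esub> v"] u that mod_homD(1)[OF qB_hom]
      by (simp add: qB_diff TY.M.a_diff_eq_zero_iff)
    then show ?thesis using im_closed by auto
  qed
  also have "\<dots> \<longleftrightarrow> (\<exists>w\<in>ideal_smult R J BM.T. u \<ominus>\<^bsub>BM.T\<^esub> w \<in> im_tensor M)"
  proof -
    have diff_diff: "u \<ominus>\<^bsub>BM.T\<^esub> (u \<ominus>\<^bsub>BM.T\<^esub> v) = v" if "v \<in> carrier BM.T" for v
      using u that U.M.a_add_diff_cancel_left[OF that, of "u \<ominus>\<^bsub>BM.T\<^esub> v"] by (simp add: U.M.a_diff_add_cancel)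
    show ?thesis
    proof (intro iffI; elim bexE)
      show "\<exists>w\<in>ideal_smult R J BM.T. u \<ominus>\<^bsub>BM.T\<^esub> w \<in> im_tensor M"
        if "v \<in> im_tensor M" "u \<ominus>\<^bsub>BM.T\<^esub> v \<in> ideal_smult R J BM.T" for v
        by (rule bexI[OF _ that(2)]) (simp only: diff_diff[OF im_closed[OF that(1)]] that(1))
      show "\<exists>v\<in>im_tensor M. u \<ominus>\<^bsub>BM.T\<^esub> v \<in> ideal_smult R J BM.T"
        if "w \<in> ideal_smult R J BM.T" "u \<ominus>\<^bsub>BM.T\<^esub> w \<in> im_tensor M" for w
        by (rule bexI[OF _ that(2)]) (simp only: diff_diff[OF subsetD[OF JU that(1)]] that(1))
    qed
  qed
  also have "\<dots> \<longleftrightarrow> coker_proj M u \<in> coker_proj M ` ideal_smult R J BM.T"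
    by (simp add: image_iff coker_proj_eq_iff[OF mM u subsetD[OF JU]] cong: bex_cong)
  finally show ?thesis unfolding im_Y J_coker .
qed

lemma right_tensor_map_mem_ker_tensor_iff:
  assumes mM: "module R M" and mY: "module R Y" and p: "p \<in> mod_hom R M Y"
    and qB: "is_right_tensor_map R B M Y p qB" and qC: "is_right_tensor_map R C M Y p qC"
    and qC_zero: "\<And>t. t \<in> carrier (tensor R C M) \<Longrightarrow>
      qC t = \<zero>\<^bsub>tensor R C Y\<^esub> \<longleftrightarrow> t \<in> ideal_smult R J (tensor R C M)"
    and \<gamma>: "\<And>t. t \<in> carrier (tensor R B M) \<Longrightarrow> \<gamma> (coker_proj M t) = tensor_map R C M \<beta> t"
    and u: "u \<in> carrier (tensor R B M)"
  shows "qB u \<in> ker_tensor Y \<longleftrightarrow>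
    coker_proj M u \<in> {x \<in> carrier (coker_tensor M). \<gamma> x \<in> ideal_smult R J (tensor R C M)}"
proof -
  have "tensor_map R C Y \<beta> (qB u) = qC (tensor_map R C M \<beta> u)"
    by (rule right_tensor_map_natural[OF B.module_axioms C.module_axioms mM mY \<beta>_hom p qB qC u, symmetric])
  then show ?thesis
    using u qC_zero[OF mod_homD(1)[OF \<beta>_tensor_hom[OF mM] u]] \<gamma>[OF u]
      mod_homD(1)[OF is_right_tensor_mapD(1)[OF qB] u] mod_homD(1)[OF coker_proj_hom[OF mM] u] by simp
qed

lemma Ass_complex_functor_quot:
  assumes mM: "module R M" and J: "J \<subseteq> carrier R"
    and \<gamma>: "\<gamma> \<in> mod_hom R (coker_tensor M) (tensor R C M)"
      "\<And>t. t \<in> carrier (tensor R B M) \<Longrightarrow> \<gamma> (coker_proj M t) = tensor_map R C M \<beta> t"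
  defines "K \<equiv> {x \<in> carrier (coker_tensor M). \<gamma> x \<in> ideal_smult R J (tensor R C M)}"
  shows "Ass R (complex_functor R A B C \<alpha> \<beta> (quot_module R M (ideal_smult R J M))) =
    Ass R (quot_module R ((coker_tensor M)\<lparr>carrier := K\<rparr>) (ideal_smult R J (coker_tensor M)))"
proof -
  let ?U = "tensor R B M" and ?X = "coker_tensor M" and ?JX = "ideal_smult R J (coker_tensor M)"
  define Y where "Y = quot_module R M (ideal_smult R J M)"
  define p where "p m = ideal_smult R J M +>\<^bsub>M\<^esub> m" for m
  note JM = module.submodule_ideal_smult[OF mM J]
  have mY: "module R Y" unfolding Y_def by (rule module.quot_module_is_module[OF mM JM])
  have p: "p \<in> mod_hom R M Y" unfolding p_def Y_def by (rule module.quot_proj_hom[OF mM JM])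
  interpret BM: module_pair R B M by (rule module_pairI[OF B.module_axioms mM])
  interpret CM: module_pair R C M by (rule module_pairI[OF C.module_axioms mM])
  interpret BY: module_pair R B Y by (rule module_pairI[OF B.module_axioms mY])
  note tensor_quot = tensor_quot_ideal_smult[OF _ mM J, folded Y_def p_def]
  obtain qA where qA: "is_right_tensor_map R A M Y p qA" "qA ` carrier (tensor R A M) = carrier (tensor R A Y)"
    by (rule tensor_quot[OF A.module_axioms]) (rule that)
  obtain qB where qB: "is_right_tensor_map R B M Y p qB" "qB ` carrier ?U = carrier BY.T"
    "\<And>t. t \<in> carrier ?U \<Longrightarrow> qB t = \<zero>\<^bsub>BY.T\<^esub> \<longleftrightarrow> t \<in> ideal_smult R J ?U"
    by (rule tensor_quot[OF B.module_axioms]) (rule that)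
  obtain qC where qC: "is_right_tensor_map R C M Y p qC"
    "\<And>t. t \<in> carrier CM.T \<Longrightarrow> qC t = \<zero>\<^bsub>tensor R C Y\<^esub> \<longleftrightarrow> t \<in> ideal_smult R J CM.T"
    by (rule tensor_quot[OF C.module_axioms]) (rule that)
  note mX = coker_tensor_is_module[OF mM]
  note JX = module.submodule_ideal_smult[OF mX J]
  have K: "submodule K R ?X"
    unfolding K_def
    by (rule submodule_preimage[OF mX CM.tensor_is_module \<gamma>(1)
          module.submodule_ideal_smult[OF CM.tensor_is_module J]])
  have "?JX \<subseteq> K"
    using mod_hom_ideal_smult[OF mX CM.tensor_is_module \<gamma>(1) J] module.submoduleD(1)[OF mX JX] by (auto simp: K_def)
  have "Ass R (complex_functor R A B C \<alpha> \<beta> Y) =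
      Ass R (quot_module R (?U\<lparr>carrier := {u \<in> carrier ?U. qB u \<in> ker_tensor Y}\<rparr>)
        {u \<in> carrier ?U. qB u \<in> im_tensor Y})"
    unfolding complex_functor_eq
    by (rule Ass_quot_preimage[OF BM.tensor_is_module BY.tensor_is_module is_right_tensor_mapD(1)[OF qB(1)] qB(2)
          submodule_ker_tensor[OF mY] submodule_im_tensor[OF mY] im_tensor_subset_ker_tensor[OF mY], symmetric])
  also have "{u \<in> carrier ?U. qB u \<in> im_tensor Y} = {u \<in> carrier ?U. coker_proj M u \<in> ?JX}"
    using right_tensor_map_mem_im_tensor_iff[OF mM mY p J qA qB(1,3)] by blast
  also have "{u \<in> carrier ?U. qB u \<in> ker_tensor Y} = {u \<in> carrier ?U. coker_proj M u \<in> K}"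
    using right_tensor_map_mem_ker_tensor_iff[OF mM mY p qB(1) qC \<gamma>(2)] unfolding K_def by blast
  also have "Ass R (quot_module R (?U\<lparr>carrier := {u \<in> carrier ?U. coker_proj M u \<in> K}\<rparr>)
      {u \<in> carrier ?U. coker_proj M u \<in> ?JX}) = Ass R (quot_module R (?X\<lparr>carrier := K\<rparr>) ?JX)"
    by (rule Ass_quot_preimage[OF BM.tensor_is_module mX coker_proj_hom[OF mM] coker_proj_surj[OF mM] K JX \<open>?JX \<subseteq> K\<close>])
  finally show ?thesis unfolding Y_def .
qed

lemma noetherian_coker_tensor:
  assumes "noetherian_ring R" and mM: "module R M" and "fin_gen_module R B" "fin_gen_module R M"
  shows "noetherian_module R (coker_tensor M)"
proof -
  interpret BM: module_pair R B M by (rule module_pairI[OF B.module_axioms mM])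
  have "noetherian_module R BM.T"
    by (rule module.fin_gen_imp_noetherian[OF BM.tensor_is_module assms(1) BM.fin_gen_tensor[OF assms(3,4)]])
  then show ?thesis
    by (rule noetherian_module_surj[OF BM.tensor_is_module coker_tensor_is_module[OF mM]
          coker_proj_hom[OF mM] coker_proj_surj[OF mM]])
qed

end

lemma adic_filtration_preimage:
  assumes mM: "module R M" and mN: "module R N" and f: "f \<in> mod_hom R M N" and I: "ideal I R"
  shows "adic_filtration R M I (\<lambda>n. {x \<in> carrier M. f x \<in> ideal_smult R (ideal_pow R I n) N})"
proof -
  interpret M: module R M by fact
  interpret N: module R N by fact
  note sub = submodule_preimage[OF mM mN f N.submodule_adic[OF I]]
  show ?thesis
  proof (intro adic_filtration.intro adic_filtration_axioms.intro mM I)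
    fix n
    show "submodule {x \<in> carrier M. f x \<in> N.adic I n} R M" by (rule sub)
    show "{x \<in> carrier M. f x \<in> N.adic I (Suc n)} \<subseteq> {x \<in> carrier M. f x \<in> N.adic I n}"
      using N.adic_Suc_subset[OF I] by blast
    show "set_smult R M I {x \<in> carrier M. f x \<in> N.adic I n} \<subseteq> {x \<in> carrier M. f x \<in> N.adic I (Suc n)}"
      using N.smult_mem_adic_Suc[OF I] mod_homD(3)[OF f] ideal.Icarr[OF I]
      by (intro M.set_smult_least[OF sub]) auto
    show "M.adic I n \<subseteq> {x \<in> carrier M. f x \<in> N.adic I n}"
      using mod_hom_ideal_smult[OF mM mN f M.R.ideal_pow_subset_carrier[OF I]] M.adic_subset_carrier[OF I] by blast
  qed
qed

lemma (in cring) ideal_pow_zero_Suc: "ideal_pow R {\<zero>} (Suc n) = {\<zero>}"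
  using ideal_prod_commute[OF zeroideal] ideal_prod_zero ideal_pow_is_ideal[OF zeroideal] by simp

lemma (in module_complex) Ass_complex_functor_eventually_constant:
  assumes dim: "one_dim_noetherian_domain R" and I: "ideal I R"
    and mM: "module R M" and fg: "fin_gen_module R B" "fin_gen_module R M"
  shows "\<exists>D. \<forall>\<^sub>F n in sequentially.
    Ass R (complex_functor R A B C \<alpha> \<beta> (quot_module R M (ideal_smult R (ideal_pow R I n) M))) = D"
    (is "\<exists>D. \<forall>\<^sub>F n in sequentially. ?F (ideal_pow R I n) = D")
proof -
  interpret one_dim_noetherian_domain R by fact
  show ?thesis
  proof (cases "I = {\<zero>}")
    case True
    then have "?F (ideal_pow R I n) = ?F {\<zero>}" if "n \<ge> 1" for n
      using that A.R.ideal_pow_zero_Suc[of "n - 1"] by simp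
    then show ?thesis unfolding eventually_sequentially by blast
  next
    case False
    obtain \<gamma> where \<gamma>: "\<gamma> \<in> mod_hom R (coker_tensor M) (tensor R C M)"
      "\<And>t. t \<in> carrier (tensor R B M) \<Longrightarrow> \<gamma> (coker_proj M t) = tensor_map R C M \<beta> t"
      by (rule coker_tensor_map_exists[OF mM]) (rule that)
    define K where "K n = {x \<in> carrier (coker_tensor M). \<gamma> x \<in> ideal_smult R (ideal_pow R I n) (tensor R C M)}" for n
    interpret adic_filtration R "coker_tensor M" I K
      unfolding K_def
      by (rule adic_filtration_preimage[OF coker_tensor_is_module[OF mM] _ \<gamma>(1) I])
         (rule module_pair.tensor_is_module[OF module_pairI[OF C.module_axioms mM]])
    have "?F (ideal_pow R I n) = Ass R (quot_module R ((coker_tensor M)\<lparr>carrier := K n\<rparr>) (adic I n))" for n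
      unfolding K_def by (rule Ass_complex_functor_quot[OF mM A.R.ideal_pow_subset_carrier[OF I] \<gamma>])
    then show ?thesis
      using Ass_eventually_constant[OF dim noetherian_coker_tensor[OF noetherian_ring_axioms mM fg] False] by simp
  qed
qed

theorem theorem5p6:
  fixes R :: "('r,'c) ring_scheme"
    and A :: "('r,'a,'d1) module_scheme" and B :: "('r,'b,'d2) module_scheme"
    and C :: "('r,'g,'d3) module_scheme"
    and M :: "('r,'m,'d4) module_scheme"
    and \<alpha> :: "'a \<Rightarrow> 'b" and \<beta> :: "'b \<Rightarrow> 'g"
    and I :: "'r set"
  assumes "noetherian_domain R"
    and "krull_dim R = 1"
    and "ideal I R"
    and "module R M" and "fin_gen_module R M"
    and "module R A" and "module R B" and "module R C"
    and "\<alpha> \<in> mod_hom R A B" and "\<beta> \<in> mod_hom R B C"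
    and "\<forall>a\<in>carrier A. \<beta> (\<alpha> a) = \<zero>\<^bsub>C\<^esub>"
    and "fin_gen_module R B"
  shows "\<exists>N\<ge>1. \<forall>n\<ge>N.
           Ass R (complex_functor R A B C \<alpha> \<beta> (quot_module R M (ideal_smult R (ideal_pow R I n) M)))
         = Ass R (complex_functor R A B C \<alpha> \<beta> (quot_module R M (ideal_smult R (ideal_pow R I N) M)))"
proof -
  let ?F = "\<lambda>n. Ass R (complex_functor R A B C \<alpha> \<beta> (quot_module R M (ideal_smult R (ideal_pow R I n) M)))"
  interpret module_complex R A B C \<alpha> \<beta>
    using assms(6-11) by (simp add: module_complex_def module_complex_axioms_def)
  obtain D where "\<forall>\<^sub>F n in sequentially. ?F n = D"
    using Ass_complex_functor_eventually_constant[OF one_dim_noetherian_domainI[OF assms(1,2)] assms(3,4,12,5)]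
    by (rule exE)
  then obtain N where N: "\<forall>n\<ge>N. ?F n = D" unfolding eventually_sequentially by (rule exE)
  then have "\<forall>n\<ge>max N 1. ?F n = ?F (max N 1)" by simp
  with max.cobounded2 show ?thesis by (intro exI[of _ "max N 1"] conjI)
qed

end
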